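(* Let $(X,\mu,S)$ be a finitely generated multiplicative system. Then $$L^2(X)=\mathcal{H}_{\mathrm{pr.eig}}\oplus\mathcal{H}_{\mathrm{pr.wm}}$$ (orthogonal direct sum).
   Context: $\mathbb{N}=\{1,2,\dots\}$, $\mathbb{P}$ is the set of primes, $\mathbb{S}^1$ the complex unit circle. Every probability space $(X,\mu)$ is assumed regular: $X$ is a compact metric space with its Borel $\sigma$-algebra. A multiplicative system $(X,\mu,S)$ consists of a probability space $(X,\mu)$ and a sequence $S=(S_n)_{n\in\mathbb{N}}$ of commuting invertible measure-preserving transformations of $(X,\mu)$ with $S_{nm}=S_n\circ S_m$ for all $n,m\in\mathbb{N}$. It is finitely generated if $\{S_p:p\in\mathbb{P}\}$ is finite. For $F\in L^2(X)$, $S_nF=F\circ S_n$. $\mathcal{M}^{\mathrm c}_{\mathrm{fg}}$ is the set of completely multiplicative $f:\mathbb{N}\to\mathbb{S}^1$ with $\{f(p):p\in\mathbb{P}\}$ finite. For $f\in\mathcal{M}^{\mathrm c}_{\mathrm{fg}}$ let $\mathcal{H}_f=\{F\in L^2(X):\sum_{p\in\mathbb{P}}\frac{\|S_pF-f(p)F\|_2^2}{p}<\infty\}$. Define $$\mathcal{H}_{\mathrm{pr.eig}}=\overline{\mathrm{span}\Big(\bigcup_{f\in\mathcal{M}^{\mathrm c}_{\mathrm{fg}}}\mathcal{H}_f\Big)},\qquad \mathcal{H}_{\mathrm{pr.wm}}=\Big\{F\in L^2(X):\lim_{N\to\infty}\frac1N\sum_{n=1}^N\Big|\int_X S_nF\cdot\overline{F}\,d\mu\Big|=0\Big\}.$$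 *)

theory Defs
  imports
    "HOL-Probability.Probability"
    "HOL-Computational_Algebra.Primes"
    "HOL-Library.Function_Algebras"
begin

section \<open>Square-integrable functions\<close>

text \<open>
  Elements of $L^2$ are represented by genuine square-integrable functions rather than by
  almost-everywhere equivalence classes. The subspaces \<open>H_pr_eig\<close> and \<open>H_pr_wm\<close> below
  contain, with a function, every measurable function almost everywhere equal to it, so
  statements about them as sets of functions are statements about subspaces of $L^2$.
\<close>

definition L2 :: "'a measure \<Rightarrow> ('a \<Rightarrow> complex) set" where
  "L2 M = {F. F \<in> borel_measurable M \<and> integrable M (\<lambda>x. (cmod (F x))\<^sup>2)}"

definition l2_inner :: "'a measure \<Rightarrow> ('a \<Rightarrow> complex) \<Rightarrow> ('a \<Rightarrow> complex) \<Rightarrow> complex" where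
  "l2_inner M F G = (\<integral>x. F x * cnj (G x) \<partial>M)"

definition l2_norm :: "'a measure \<Rightarrow> ('a \<Rightarrow> complex) \<Rightarrow> real" where
  "l2_norm M F = sqrt (\<integral>x. (cmod (F x))\<^sup>2 \<partial>M)"

definition l2_closure :: "'a measure \<Rightarrow> ('a \<Rightarrow> complex) set \<Rightarrow> ('a \<Rightarrow> complex) set" where
  "l2_closure M A = {F \<in> L2 M. \<forall>e>0. \<exists>G\<in>A. l2_norm M (F - G) < e}"

definition cscale :: "complex \<Rightarrow> ('a \<Rightarrow> complex) \<Rightarrow> ('a \<Rightarrow> complex)" where
  "cscale c F = (\<lambda>x. c * F x)"

global_interpretation cfun: vector_space "cscale :: complex \<Rightarrow> ('a \<Rightarrow> complex) \<Rightarrow> 'a \<Rightarrow> complex"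
  by unfold_locales (auto simp: cscale_def fun_eq_iff algebra_simps)

definition l2_orthogonal_direct_sum ::
    "'a measure \<Rightarrow> ('a \<Rightarrow> complex) set \<Rightarrow> ('a \<Rightarrow> complex) set \<Rightarrow> bool" where
  "l2_orthogonal_direct_sum M V W \<longleftrightarrow>
     cfun.subspace V \<and> cfun.subspace W \<and>
     (\<forall>G\<in>V. \<forall>H\<in>W. l2_inner M G H = 0) \<and>
     {G + H | G H. G \<in> V \<and> H \<in> W} = L2 M"

lemma l2_mult_integrable:
  assumes "F \<in> L2 M" "G \<in> L2 M"
  shows "integrable M (\<lambda>x. F x * cnj (G x))"
proof (rule Bochner_Integration.integrable_bound)
  show "integrable M (\<lambda>x. (cmod (F x))\<^sup>2 + (cmod (G x))\<^sup>2)"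
    using assms by (auto simp: L2_def)
  have [measurable]: "F \<in> borel_measurable M" "G \<in> borel_measurable M"
    using assms by (auto simp: L2_def)
  have "cnj \<circ> G \<in> borel_measurable M"
    by (intro measurable_comp[of _ _ borel] borel_measurable_continuous_onI continuous_intros) auto
  then show "(\<lambda>x. F x * cnj (G x)) \<in> borel_measurable M"
    by (auto simp: o_def)
  have "a * b \<le> a\<^sup>2 + b\<^sup>2" for a b :: real
    using sum_squares_bound[of a b] zero_le_power2[of a] zero_le_power2[of b]
      zero_le_power2[of "a + b"] by (simp add: power2_sum)
  then show "AE x in M. norm (F x * cnj (G x)) \<le> norm ((cmod (F x))\<^sup>2 + (cmod (G x))\<^sup>2)"
    by (simp add: norm_mult)
qed

text \<open>The summands in such a decomposition are unique as elements of $L^2$.\<close>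

lemma l2_orthogonal_direct_sum_unique:
  assumes sum: "l2_orthogonal_direct_sum M V W"
    and mem: "G \<in> V" "G' \<in> V" "H \<in> W" "H' \<in> W"
    and eq: "AE x in M. G x + H x = G' x + H' x"
  shows "AE x in M. G x = G' x" and "AE x in M. H x = H' x"
proof -
  define D E where "D = G - G'" and "E = H' - H"
  have D: "D \<in> V" and E: "E \<in> W"
    using sum mem by (auto simp: l2_orthogonal_direct_sum_def D_def E_def cfun.subspace_diff)
  have "0 \<in> V" "0 \<in> W"
    using sum by (auto simp: l2_orthogonal_direct_sum_def cfun.subspace_0)
  then have "D + 0 \<in> L2 M" "0 + E \<in> L2 M"
    using sum D E unfolding l2_orthogonal_direct_sum_def by blast+
  then have L: "D \<in> L2 M" "E \<in> L2 M" by simp_all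
  have DE: "AE x in M. D x = E x"
    using eq by eventually_elim (auto simp: D_def E_def algebra_simps)
  have "(\<integral>x. D x * cnj (D x) \<partial>M) = (\<integral>x. D x * cnj (E x) \<partial>M)"
    using l2_mult_integrable[OF L(1) L(1)] l2_mult_integrable[OF L(1) L(2)] DE
    by (intro integral_cong_AE) (auto dest: borel_measurable_integrable)
  also have "\<dots> = 0"
    using sum D E by (auto simp: l2_orthogonal_direct_sum_def l2_inner_def)
  finally have "complex_of_real (\<integral>x. (cmod (D x))\<^sup>2 \<partial>M) = 0"
    by (simp add: complex_norm_square[symmetric] flip: integral_complex_of_real)
  then have "(\<integral>x. (cmod (D x))\<^sup>2 \<partial>M) = 0" by simp
  then have "AE x in M. (cmod (D x))\<^sup>2 = 0"
    using L by (subst (asm) integral_nonneg_eq_0_iff_AE) (auto simp: L2_def)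
  then show G: "AE x in M. G x = G' x" by (auto simp: D_def)
  show "AE x in M. H x = H' x" using G eq by eventually_elim auto
qed


section \<open>Multiplicative systems\<close>

text \<open>
  The compact metric space is the whole type. The sequences \<^term>\<open>S\<close> and \<^term>\<open>f\<close> below are
  indexed by the positive integers; their values at 0 are irrelevant.
\<close>

locale multiplicative_system = prob_space M
  for M :: "'a::metric_space measure" and S :: "nat \<Rightarrow> 'a \<Rightarrow> 'a" +
  assumes compact_UNIV: "compact (UNIV :: 'a set)"
    and sets_M: "sets M = sets borel"
    and S_bij: "n \<ge> 1 \<Longrightarrow> bij (S n)"
    and S_measurable: "n \<ge> 1 \<Longrightarrow> S n \<in> M \<rightarrow>\<^sub>M M"
    and S_inv_measurable: "n \<ge> 1 \<Longrightarrow> inv (S n) \<in> M \<rightarrow>\<^sub>M M"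
    and S_measure_preserving: "n \<ge> 1 \<Longrightarrow> distr M M (S n) = M"
    and S_commute: "n \<ge> 1 \<Longrightarrow> m \<ge> 1 \<Longrightarrow> S n \<circ> S m = S m \<circ> S n"
    and S_mult: "n \<ge> 1 \<Longrightarrow> m \<ge> 1 \<Longrightarrow> S (n * m) = S n \<circ> S m"

locale fg_multiplicative_system = multiplicative_system M S
  for M :: "'a::metric_space measure" and S :: "nat \<Rightarrow> 'a \<Rightarrow> 'a" +
  assumes finitely_generated: "finite (S ` {p. prime p})"

definition Mc_fg :: "(nat \<Rightarrow> complex) set" where
  "Mc_fg = {f. (\<forall>n\<ge>1. cmod (f n) = 1) \<and>
               (\<forall>n\<ge>1. \<forall>m\<ge>1. f (n * m) = f n * f m) \<and>
               finite (f ` {p. prime p})}"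

definition H_char :: "'a measure \<Rightarrow> (nat \<Rightarrow> 'a \<Rightarrow> 'a) \<Rightarrow> (nat \<Rightarrow> complex) \<Rightarrow> ('a \<Rightarrow> complex) set" where
  "H_char M S f = {F \<in> L2 M.
     (\<lambda>p. (l2_norm M ((F \<circ> S p) - cscale (f p) F))\<^sup>2 / real p) summable_on {p. prime p}}"

definition H_pr_eig :: "'a measure \<Rightarrow> (nat \<Rightarrow> 'a \<Rightarrow> 'a) \<Rightarrow> ('a \<Rightarrow> complex) set" where
  "H_pr_eig M S = l2_closure M (cfun.span (\<Union>f\<in>Mc_fg. H_char M S f))"

definition H_pr_wm :: "'a measure \<Rightarrow> (nat \<Rightarrow> 'a \<Rightarrow> 'a) \<Rightarrow> ('a \<Rightarrow> complex) set" where
  "H_pr_wm M S = {F \<in> L2 M.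
     (\<lambda>N. (\<Sum>n=1..N. cmod (l2_inner M (F \<circ> S n) F)) / real N) \<longlonglongrightarrow> 0}"

end

theory Submission
  imports
    Defs
    "HOL-Number_Theory.Prime_Powers"
    "HOL-Computational_Algebra.Squarefree"
begin

text \<open>
  Group the primes by their transformation, and call a transformation big if the reciprocals of its
  primes have a divergent sum. Each \<open>H_char M S f\<close> consists of joint eigenfunctions of the big
  transformations, and every such joint eigenfunction lies in \<open>H_char M S f\<close> for the completely
  multiplicative \<open>f\<close> whose values at primes are the eigenvalues. It remains to show that \<open>H_pr_wm M S\<close>
  is the orthogonal complement of these eigenfunctions.

  The arithmetic input is that for a bounded \<open>f\<close> which only depends on how many prime factors of
  each colour its argument has, and for a prime \<open>p\<close> of a big colour, the averages of \<open>f (p * n)\<close>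
  and \<open>f n\<close> over \<open>n \<le> x\<close> are asymptotically equal, uniformly in \<open>f\<close>. By Selberg's formula every short window
  contains many products of at most two primes. Among sufficiently many windows in arithmetic
  progression two share their majority colour, and the Turan-Kubilius inequality, applied to the
  numbers of that colour in both windows, shows that the averages up to \<open>x\<close> and up to \<open>x * exp (- r * s)\<close>
  agree asymptotically for some \<open>r\<close> in a fixed finite set. As \<open>s\<close> is arbitrary, the averages vary
  slowly on the logarithmic scale; the Turan-Kubilius inequality for the primes of one colour then
  gives the claim.

  If \<open>F\<close> is orthogonal to all joint eigenfunctions then, for each choice of eigenvalues, it is a limit of
  sums of twisted coboundaries, so the twisted averages of \<open>F \<circ> S n\<close> tend to 0, uniformly by compactness
  of the torus of eigenvalues. Finite Fourier analysis bounds the mean square of the correlations of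
  \<open>F\<close> by these averages. Conversely, average the correlations of \<open>F\<close>, twisted by a character, over the
  integers without prime factors of small colours: the limit is governed by the norm of the projection
  of \<open>F\<close> to the joint eigenspace, because these integers have positive logarithmic density.
\<close>

section \<open>Selberg's formula\<close>

text \<open>The primes of a single colour may be distributed very irregularly, with no primes at all
  on long ranges of scales. For one colour the Turan-Kubilius inequality therefore compares the
  average of \<open>f\<close> up to x only with averages of \<open>f (p * n)\<close> up to x / p,
  over scales that cannot be controlled. It becomes useful once averages are known not to depend on
  the scale, and this slow variation is the arithmetic difficulty. The price is that a pigeonhole
  argument fixes neither the colour nor the shift in advance.

  Uniformity in \<open>f\<close> is carried through all estimates because the character that
  controls the correlations up to N changes with N. A finite grid of characters with positive
  weights replaces spectral measures. Elements of the Hilbert space are functions, so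
  \<open>l2_norm\<close> is a seminorm and identities such as eigenvalue equations are expressed by
  a vanishing norm.\<close>

lemma sum_divisors_swap:
  fixes g :: "nat \<Rightarrow> nat \<Rightarrow> 'b::comm_monoid_add"
  shows "(\<Sum>n=1..N. \<Sum>d | d dvd n. g d (n div d)) = (\<Sum>d=1..N. \<Sum>m=1..N div d. g d m)"
proof -
  have "(\<Sum>n=1..N. \<Sum>d | d dvd n. g d (n div d)) =
      (\<Sum>(n,d)\<in>(SIGMA n:{1..N}. {d. d dvd n}). g d (n div d))"
    by (subst sum.Sigma) auto
  also have "\<dots> = (\<Sum>(d,m)\<in>(SIGMA d:{1..N}. {1..N div d}). g d m)"
  proof (rule sum.reindex_bij_witness[where i = "\<lambda>(d,m). (d * m, d)" and j = "\<lambda>(n,d). (d, n div d)"])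
    fix a assume "a \<in> (SIGMA n:{1..N}. {d. d dvd n})"
    then obtain n d where a: "a = (n, d)" "1 \<le> n" "n \<le> N" "d dvd n" by auto
    then have "d \<ge> 1" "d \<le> N" "n div d \<ge> 1" "n div d \<le> N div d"
      by (auto simp: Suc_le_eq div_greater_zero_iff div_le_mono dest: dvd_imp_le intro!: Nat.gr0I)
    then show "(case a of (n, d) \<Rightarrow> (d, n div d)) \<in> (SIGMA d:{1..N}. {1..N div d})"
      using a by simp
  next
    fix b assume "b \<in> (SIGMA d:{1..N}. {1..N div d})"
    then obtain d m where b: "b = (d, m)" "1 \<le> d" "d \<le> N" "1 \<le> m" "m \<le> N div d" by auto
    then have "d * m \<le> N" by (metis div_times_less_eq_dividend le_trans mult.commute mult_le_mono1)
    then show "(case b of (d, m) \<Rightarrow> (d * m, d)) \<in> (SIGMA n:{1..N}. {d. d dvd n})"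
      using b by auto
  qed auto
  also have "\<dots> = (\<Sum>d=1..N. \<Sum>m=1..N div d. g d m)"
    by (subst sum.Sigma) auto
  finally show ?thesis .
qed

lemma sum_hyperbola_swap:
  fixes g :: "nat \<Rightarrow> nat \<Rightarrow> 'b::comm_monoid_add"
  shows "(\<Sum>d=1..N. \<Sum>m=1..N div d. g d m) = (\<Sum>m=1..N. \<Sum>d=1..N div m. g d m)"
proof -
  have *: "d \<le> N div m \<and> m \<le> N" if "Suc 0 \<le> d" "Suc 0 \<le> m" "m \<le> N div d" "d \<le> N" for d m :: nat
    using that by (metis Suc_le_eq div_le_dividend le_trans less_eq_div_iff_mult_less_eq mult.commute)
  have "(\<Sum>d=1..N. \<Sum>m=1..N div d. g d m) = (\<Sum>(d,m)\<in>(SIGMA d:{1..N}. {1..N div d}). g d m)"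
    by (subst sum.Sigma) auto
  also have "\<dots> = (\<Sum>(m,d)\<in>(SIGMA m:{1..N}. {1..N div m}). g d m)"
    by (rule sum.reindex_bij_witness[where i = prod.swap and j = prod.swap]) (auto dest: *)
  also have "\<dots> = (\<Sum>m=1..N. \<Sum>d=1..N div m. g d m)"
    by (subst sum.Sigma) auto
  finally show ?thesis .
qed

section \<open>Chebyshev's upper bound and Mertens' estimate for the von Mangoldt function\<close>

definition psi :: "nat \<Rightarrow> real" where
  "psi N = (\<Sum>k=1..N. mangoldt k)"

lemma psi_nonneg: "psi N \<ge> 0"
  by (auto simp: psi_def intro!: sum_nonneg mangoldt_nonneg)

lemma psi_mono: "M \<le> N \<Longrightarrow> psi M \<le> psi N"
  by (auto simp: psi_def intro!: sum_mono2 mangoldt_nonneg)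

lemma ln_fact_eq_sum: "ln (fact N :: real) = (\<Sum>n=1..N. ln (real n))"
  by (induction N) (auto simp: ln_mult)

text \<open>\<open>ln n\<close> is the sum of \<open>mangoldt\<close> over the divisors of n, and d
  has \<open>N div d\<close> multiples up to N. Both the Chebyshev and the Mertens bound start from
  this identity.\<close>

lemma ln_fact_eq_sum_mangoldt: "ln (fact N :: real) = (\<Sum>d=1..N. mangoldt d * real (N div d))"
proof -
  have "ln (fact N :: real) = (\<Sum>n=1..N. \<Sum>d | d dvd n. mangoldt d)"
    unfolding ln_fact_eq_sum by (intro sum.cong refl) (subst mangoldt_sum, auto)
  also have "\<dots> = (\<Sum>d=1..N. \<Sum>m=1..N div d. mangoldt d)"
    by (rule sum_divisors_swap)
  finally show ?thesis by (simp add: mult.commute)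
qed

lemma ln_fact_eq_sum_psi: "ln (fact N :: real) = (\<Sum>m=1..N. psi (N div m))"
proof -
  have "ln (fact N :: real) = (\<Sum>d=1..N. \<Sum>m=1..N div d. mangoldt d)"
    by (simp add: ln_fact_eq_sum_mangoldt mult.commute)
  also have "\<dots> = (\<Sum>m=1..N. psi (N div m))"
    unfolding psi_def by (rule sum_hyperbola_swap)
  finally show ?thesis .
qed

lemma ln_Suc_diff_bounds:
  assumes "n \<ge> 1"
  shows "1 / (real n + 1) \<le> ln (real n + 1) - ln (real n)"
    and "ln (real n + 1) - ln (real n) \<le> 1 / real n"
proof -
  have "ln (real n / (real n + 1)) \<le> real n / (real n + 1) - 1"
    using assms by (intro ln_le_minus_one) auto
  then show "1 / (real n + 1) \<le> ln (real n + 1) - ln (real n)"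
    using assms by (simp add: ln_div field_simps)
  have "ln ((real n + 1) / real n) \<le> (real n + 1) / real n - 1"
    using assms by (intro ln_le_minus_one) auto
  then show "ln (real n + 1) - ln (real n) \<le> 1 / real n"
    using assms by (simp add: ln_div field_simps)
qed

lemma ln_fact_bounds:
  assumes "n \<ge> 1"
  shows "real n * ln n - n \<le> ln (fact n)" "ln (fact n) \<le> real n * ln n - n + 1 + ln n"
proof -
  have "real n * ln n - n \<le> ln (fact n) \<and> ln (fact n) \<le> real n * ln n - n + 1 + ln n"
    using assms
  proof (induction n rule: dec_induct)
    case (step n)
    have 1: "real n * (ln (real n + 1) - ln (real n)) \<le> 1"
      using ln_Suc_diff_bounds(2)[of n] step by (simp add: field_simps)
    have 2: "(real n + 1) * (ln (real n + 1) - ln (real n)) \<ge> 1"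
      using ln_Suc_diff_bounds(1)[of n] step by (simp add: field_simps)
    have 3: "ln (fact (Suc n) :: real) = ln (real n + 1) + ln (fact n)"
      by (simp add: ln_mult add_ac)
    show ?case using 1 2 step.IH unfolding 3 by (auto simp: algebra_simps)
  qed auto
  then show "real n * ln n - n \<le> ln (fact n)" "ln (fact n) \<le> real n * ln n - n + 1 + ln n"
    by auto
qed

text \<open>Chebyshev's argument: in \<open>ln (fact (2*m)) - 2 * ln (fact m)\<close> the
  coefficient of \<open>mangoldt d\<close> is never negative and equals 1 for m < d \<le> 2 m. This
  logarithm belongs to the central binomial coefficient, which is at most 4^m.\<close>

lemma psi_double_diff_le: "psi (2 * m) - psi m \<le> 2 * real m * ln 2"
proof -
  have "ln (fact m :: real) = (\<Sum>d=1..m. mangoldt d * real (m div d))"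
    by (rule ln_fact_eq_sum_mangoldt)
  also have "\<dots> = (\<Sum>d=1..2*m. mangoldt d * real (m div d))"
    by (rule sum.mono_neutral_left) auto
  finally have "ln (fact (2*m) :: real) - 2 * ln (fact m :: real) =
     (\<Sum>d=1..2*m. mangoldt d * (real (2*m div d) - 2 * real (m div d)))"
    unfolding ln_fact_eq_sum_mangoldt[of "2*m"]
    by (simp add: sum_distrib_left sum_subtractf algebra_simps)
  also have "\<dots> \<ge> (\<Sum>d=m+1..2*m. mangoldt d * (real (2*m div d) - 2 * real (m div d)))"
  proof (rule sum_mono2)
    fix d assume "d \<in> {1..2*m} - {m+1..2*m}"
    have "2 * (m div d) \<le> 2 * m div d" by (metis div_mult2_eq div_times_less_eq_dividend le_div_geq
          less_eq_div_iff_mult_less_eq mult.commute mult.left_commute mult_0_right mult_le_mono2 not_gr_zero div_by_0 order_refl)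
    then have "2 * real (m div d) \<le> real (2 * m div d)" by (metis of_nat_le_iff of_nat_mult of_nat_numeral)
    then show "0 \<le> mangoldt d * (real (2*m div d) - 2 * real (m div d))"
      by (intro mult_nonneg_nonneg mangoldt_nonneg) auto
  qed auto
  also have "(\<Sum>d=m+1..2*m. mangoldt d * (real (2*m div d) - 2 * real (m div d))) = (\<Sum>d=m+1..2*m. mangoldt d)"
  proof (rule sum.cong)
    fix d assume d: "d \<in> {m+1..2*m}"
    then have "m div d = 0" "2 * m div d = 1"
      by (auto simp: div_nat_eqI)
    then show "mangoldt d * (real (2*m div d) - 2 * real (m div d)) = mangoldt d" by simp
  qed auto
  also have "\<dots> = psi (2 * m) - psi m"
  proof -
    have "psi (2*m) = psi m + (\<Sum>d=m+1..2*m. mangoldt d)"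
      using sum.ub_add_nat[of 1 m "mangoldt :: nat \<Rightarrow> real" m] by (simp add: psi_def mult_2)
    then show ?thesis by simp
  qed
  finally have 1: "psi (2 * m) - psi m \<le> ln (fact (2*m)) - 2 * ln (fact m)" .
  have "(fact (2*m) :: real) = (2*m choose m) * fact m * fact m"
    using binomial_fact_lemma[of m "2*m"] by (metis (no_types, lifting) add_diff_cancel_right' le_add2
        mult.assoc mult.commute mult_2 of_nat_fact of_nat_mult)
  then have "ln (fact (2*m) :: real) - 2 * ln (fact m) = ln (real (2*m choose m))"
    by (simp add: ln_mult)
  also have "\<dots> \<le> ln (2 ^ (2*m))"
  proof -
    have "real (2*m choose m) \<le> real (2 ^ (2*m))"
      using binomial_le_pow2[of "2*m" m] by (simp only: of_nat_le_iff)
    moreover have "real (2*m choose m) > 0" by simp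
    ultimately show ?thesis by (intro ln_mono) (simp_all only: of_nat_power of_nat_numeral)
  qed
  also have "\<dots> = 2 * real m * ln 2" by (simp add: ln_realpow)
  finally show ?thesis using 1 by simp
qed

lemma psi_le: "psi N \<le> 6 * real N"
proof (induction N rule: less_induct)
  case (less N)
  consider "N = 0" | "N = 1" | "N \<ge> 2" by linarith
  then show ?case
  proof cases
    case 3
    \<comment> \<open>Rounding up uses the slack in the constant: the induction gives 6 m + 2 m = 8
      m \<le> 4 N + 4, which is at most 6 N for N \<ge> 2.\<close>
    define m where "m = (N + 1) div 2"
    have m: "m < N" "N \<le> 2 * m" "2 * m \<le> N + 1" using 3 by (auto simp: m_def)
    have "psi N \<le> psi (2 * m)" using m by (intro psi_mono)
    also have "\<dots> \<le> psi m + 2 * real m * ln 2" using psi_double_diff_le[of m] by simp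
    also have "\<dots> \<le> 6 * real m + 2 * real m * 1"
      using less.IH[OF m(1)] ln_2_less_1 by (intro add_mono mult_left_mono) auto
    also have "\<dots> \<le> 6 * real N" using m 3 by linarith
    finally show ?thesis .
  qed (auto simp: psi_def)
qed

text \<open>N times the sum exceeds \<open>ln (fact N)\<close> by a sum of \<open>mangoldt k\<close>
  times the fractional part of N / k, which lies between 0 and \<open>psi N\<close> \<le> 6 N.
  Stirling's bounds then supply \<open>ln N\<close>, and 8 leaves room for their error.\<close>

lemma mertens_mangoldt:
  assumes "N \<ge> 1"
  shows "\<bar>(\<Sum>k=1..N. mangoldt k / real k) - ln N\<bar> \<le> 8"
proof -
  define S where "S = (\<Sum>k=1..N. mangoldt k / real k)"
  have "real N * S - ln (fact N) = (\<Sum>k=1..N. mangoldt k * (real N / real k - real (N div k)))"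
    by (simp add: S_def ln_fact_eq_sum_mangoldt sum_distrib_left sum_subtractf algebra_simps)
  moreover have "\<dots> \<ge> 0"
    by (intro sum_nonneg mult_nonneg_nonneg mangoldt_nonneg) (simp add: of_nat_div_le_of_nat)
  moreover have "(\<Sum>k=1..N. mangoldt k * (real N / real k - real (N div k))) \<le> (\<Sum>k=1..N. mangoldt k * 1)"
  proof (intro sum_mono mult_left_mono mangoldt_nonneg)
    fix k assume "k \<in> {1..N}"
    moreover have "real N = real (N div k) * real k + real (N mod k)"
      by (simp flip: of_nat_mult of_nat_add)
    moreover have "real (N mod k) \<le> real k" using \<open>k \<in> {1..N}\<close> by simp
    ultimately show "real N / real k - real (N div k) \<le> 1" by (simp add: field_simps)
  qed
  moreover have "\<dots> \<le> 6 * real N" using psi_le by (simp add: psi_def)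
  ultimately have *: "0 \<le> real N * S - ln (fact N)" "real N * S - ln (fact N) \<le> 6 * real N" by linarith+
  have "ln (real N) \<le> real N - 1" using assms by (intro ln_le_minus_one) auto
  then have "real N * S - real N * ln N \<ge> - real N * 8" "real N * S - real N * ln N \<le> real N * 8"
    using * ln_fact_bounds[OF assms] assms by linarith+
  then have "real N * (S - ln N) \<ge> real N * (-8)" "real N * (S - ln N) \<le> real N * 8"
    by (simp_all add: algebra_simps)
  then show ?thesis using assms unfolding S_def[symmetric] by (simp only: mult_le_cancel_left_pos abs_le_iff)
      (auto simp: mult_le_cancel_left)
qed

section \<open>Moebius inversion and Selberg's formula\<close>

definition moebius_mu :: "nat \<Rightarrow> real" where
  "moebius_mu n = (if squarefree n then (-1) ^ card (prime_factors n) else 0)"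

lemma abs_moebius_mu_le: "\<bar>moebius_mu n\<bar> \<le> 1"
  by (simp add: moebius_mu_def power_abs)

text \<open>For a prime p dividing n, the squarefree divisors of n are the d not divisible by p
  together with their multiples p d, on which \<open>moebius_mu\<close> takes the opposite
  values.\<close>

lemma sum_moebius_divisors:
  assumes "n > 0"
  shows "(\<Sum>d | d dvd n. moebius_mu d) = (if n = 1 then 1 else 0)"
proof (cases "n = 1")
  case True
  then show ?thesis by (simp add: moebius_mu_def)
next
  case False
  then obtain p where p: "prime p" "p dvd n" using prime_factor_nat by blast
  define D where "D = {d. d dvd n \<and> squarefree d \<and> \<not> p dvd d}"
  have fin: "finite {d. d dvd n}" using assms by simp
  have "finite D" using assms by (auto simp: D_def)
  have sq: "squarefree (p * d)" if "d \<in> D" for d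
    using that p by (auto simp: D_def squarefree_mult_coprime squarefree_prime prime_imp_coprime)
  have dv: "p * d dvd n" if "d \<in> D" for d
    using that p by (auto simp: D_def intro!: divides_mult prime_imp_coprime)
  have inj: "inj_on ((*) p) D" using p by (auto simp: inj_on_def)
  have "{d. d dvd n \<and> squarefree d} = D \<union> (*) p ` D"
  proof (intro equalityI subsetI)
    fix d assume d: "d \<in> {d. d dvd n \<and> squarefree d}"
    show "d \<in> D \<union> (*) p ` D"
    proof (cases "p dvd d")
      case True
      then obtain e where e: "d = p * e" by auto
      have "\<not> p dvd e"
      proof
        assume "p dvd e"
        then have "p ^ 2 dvd d" by (auto simp: e power2_eq_square)
        then show False using d p by (auto simp: squarefree_def)
      qed
      then have "e \<in> D" using d e by (auto simp: D_def intro: dvd_mult_right squarefree_mono[of e "p * e"])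
      then show ?thesis using e by blast
    qed (use d in \<open>auto simp: D_def\<close>)
  qed (use sq dv in \<open>auto simp: D_def\<close>)
  then have "(\<Sum>d | d dvd n. moebius_mu d) = (\<Sum>d\<in>D \<union> (*) p ` D. moebius_mu d)"
    using fin by (intro sum.mono_neutral_cong_right) (auto simp: moebius_mu_def)
  also have "\<dots> = (\<Sum>d\<in>D. moebius_mu d) + (\<Sum>d\<in>(*) p ` D. moebius_mu d)"
    using \<open>finite D\<close> by (intro sum.union_disjoint) (auto simp: D_def)
  also have "(\<Sum>d\<in>(*) p ` D. moebius_mu d) = (\<Sum>d\<in>D. moebius_mu (p * d))"
    using inj by (simp add: sum.reindex)
  also have "\<dots> = (\<Sum>d\<in>D. - moebius_mu d)"
  proof (intro sum.cong refl)
    fix d assume d: "d \<in> D"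
    have "d \<noteq> 0" using d assms by (auto simp: D_def)
    have pf: "prime_factors (p * d) = insert p (prime_factors d)"
      using p \<open>d \<noteq> 0\<close> by (subst prime_factors_product) (auto simp: prime_factorization_prime)
    have "p \<notin> prime_factors d" using d by (auto simp: D_def)
    then show "moebius_mu (p * d) = - moebius_mu d"
      using sq[OF d] d by (simp add: moebius_mu_def pf D_def)
  qed
  finally show ?thesis using False by (simp add: sum_negf)
qed

text \<open>Moebius inversion: once the logarithm is expanded as a sum of \<open>mangoldt e\<close>
  and the sums are exchanged, the sum over d survives only for e = m.\<close>

lemma sum_moebius_ln_divisors:
  assumes "m > 0"
  shows "(\<Sum>d | d dvd m. moebius_mu d * ln (real (m div d))) = mangoldt m"
proof -
  have "(\<Sum>d | d dvd m. moebius_mu d * ln (real (m div d))) =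
      (\<Sum>d | d dvd m. \<Sum>e | e dvd m div d. moebius_mu d * mangoldt e)"
  proof (intro sum.cong refl)
    fix d assume "d \<in> {d. d dvd m}"
    then have "m div d \<noteq> 0" using assms by (auto elim!: dvdE)
    then show "moebius_mu d * ln (real (m div d)) = (\<Sum>e | e dvd m div d. moebius_mu d * mangoldt e)"
      using mangoldt_sum[of "m div d", where ?'a = real] by (simp add: sum_distrib_left[symmetric])
  qed
  also have "\<dots> = (\<Sum>(d,e)\<in>(SIGMA d:{d. d dvd m}. {e. e dvd m div d}). moebius_mu d * mangoldt e)"
    using assms by (subst sum.Sigma) (auto elim!: dvdE)
  also have "\<dots> = (\<Sum>(e,d)\<in>(SIGMA e:{e. e dvd m}. {d. d dvd m div e}). moebius_mu d * mangoldt e)"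
    by (rule sum.reindex_bij_witness[where i = prod.swap and j = prod.swap])
       (use assms in \<open>auto simp: dvd_div_iff_mult mult.commute elim!: dvdE\<close>)
  also have "\<dots> = (\<Sum>e | e dvd m. \<Sum>d | d dvd m div e. moebius_mu d * mangoldt e)"
    using assms by (subst sum.Sigma) (auto elim!: dvdE)
  also have "\<dots> = (\<Sum>e | e dvd m. if e = m then mangoldt m else 0)"
  proof (intro sum.cong refl)
    fix e assume "e \<in> {e. e dvd m}"
    then obtain k where k: "m = e * k" by auto
    then have "(\<Sum>d | d dvd m div e. moebius_mu d) = (if k = 1 then 1 else 0)"
      using assms by (subst sum_moebius_divisors) (auto intro!: Nat.gr0I)
    then show "(\<Sum>d | d dvd m div e. moebius_mu d * mangoldt e) = (if e = m then mangoldt m else 0)"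
      using k assms by (auto simp: sum_distrib_right[symmetric])
  qed
  also have "\<dots> = mangoldt m" using assms by (simp add: sum.delta)
  finally show ?thesis .
qed

lemma harm_bounds:
  assumes "n \<ge> 1"
  shows "ln (real n) + euler_mascheroni \<le> harm n" "harm n \<le> ln (real n) + euler_mascheroni + 1 / real n"
proof -
  have 1: "1 / (2 * real n) \<le> 1 / (real n + 1)" using assms by (simp add: field_simps)
  have 2: "0 \<le> inverse (2 * (real n + 1))" by simp
  note b = euler_mascheroni_bounds[OF assms] ln_Suc_diff_bounds[OF assms]
  have "harm n - ln (real n + 1) + inverse (2 * (real n + 1)) \<le> euler_mascheroni"
       "euler_mascheroni \<le> harm n - ln (real n + 1) + 1 / (2 * real n)"
    using b(1) by (auto simp: inverse_eq_divide add_ac)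
  then show "ln (real n) + euler_mascheroni \<le> harm n" "harm n \<le> ln (real n) + euler_mascheroni + 1 / real n"
    using b(2,3) 1 2 by linarith+
qed

text \<open>The constant \<open>euler_mascheroni + 1\<close> is forced. The sum of
  \<open>psi (n div k)\<close> is \<open>ln (fact n)\<close>, about n ln n - n, and y times the
  harmonic sum is about y ln y plus y times Euler's constant. The added constant cancels exactly the
  linear terms and leaves a logarithmic error.\<close>

lemma sum_selberg_weight_bound:
  fixes y :: real
  assumes "y \<ge> 1" "n = nat \<lfloor>y\<rfloor>"
  shows "\<bar>\<Sum>k=1..n. (psi (n div k) - y / real k + euler_mascheroni + 1)\<bar> \<le> 3 + ln y"
proof -
  define g :: real where "g = euler_mascheroni"
  have g: "0 \<le> g" "g \<le> 1" using euler_mascheroni_pos euler_mascheroni_less_13_over_22 by (auto simp: g_def)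
  have n: "n \<ge> 1" "real n \<le> y" "y < real n + 1" using assms by linarith+
  define L where "L = ln (real n)"
  have L: "0 \<le> L" "L \<le> ln y" using n by (auto simp: L_def)
  have "(\<Sum>k=1..n. (psi (n div k) - y / real k + g + 1)) = ln (fact n) - y * harm n + (g + 1) * n"
    by (simp add: ln_fact_eq_sum_psi harm_def sum.distrib sum_subtractf sum_distrib_left
        inverse_eq_divide algebra_simps)
  moreover have "ln (fact n) - y * harm n + (g + 1) * n \<le> 3 + ln y"
  proof -
    have "y * harm n \<ge> y * (L + g)"
      using n harm_bounds(1)[OF n(1)] unfolding L_def g_def by (intro mult_left_mono) auto
    moreover have "(real n - y) * (L + g) \<le> 0" using n L g by (intro mult_nonpos_nonneg) auto
    ultimately show ?thesis using ln_fact_bounds(2)[OF n(1)] L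
      unfolding L_def[symmetric] by (simp add: algebra_simps)
  qed
  moreover have "ln (fact n) - y * harm n + (g + 1) * n \<ge> - (3 + ln y)"
  proof -
    have "y * harm n \<le> y * (L + g + 1 / real n)"
      using n harm_bounds(2)[OF n(1)] unfolding L_def g_def by (intro mult_left_mono) auto
    moreover have "(y - real n) * (L + g) \<le> 1 * (L + g)" using n L g by (intro mult_right_mono) auto
    moreover have "y * (1 / real n) \<le> 2" using n by (simp add: field_simps)
    ultimately show ?thesis using ln_fact_bounds(1)[OF n(1)] L g
      unfolding L_def[symmetric] by (simp add: algebra_simps)
  qed
  ultimately show ?thesis unfolding g_def by linarith
qed

lemma sum_inverse_sqrt_le: "(\<Sum>d=1..N. 1 / sqrt (real d)) \<le> 2 * sqrt (real N)"
proof (induction N)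
  case (Suc N)
  define a b where "a = sqrt (real N)" and "b = sqrt (real (Suc N))"
  have ab: "a \<ge> 0" "b > 0" "b^2 = a^2 + 1" by (auto simp: a_def b_def)
  have "2 * a * b \<le> a^2 + b^2" using sum_squares_bound[of a b] by simp
  then have "1 / b \<le> 2 * b - 2 * a" using ab by (simp add: field_simps power2_eq_square)
  then show ?case using Suc by (simp add: a_def b_def)
qed auto

lemma ln_mult_le_sqrt:
  assumes "t \<ge> (1::real)"
  shows "ln t * (3 + ln t) \<le> 28 * sqrt t"
proof -
  \<comment> \<open>With the fourth root s \<ge> 1, \<open>ln t = 4 * ln s\<close> is at most 4 s
    and 3 is at most 3 s, so the product is at most 4 s times 7 s.\<close>
  define s where "s = sqrt (sqrt t)"
  have s: "s \<ge> 1" "s ^ 2 = sqrt t" "t = s ^ 4" using assms 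
  proof -
    have "s ^ 2 = sqrt t" "sqrt t ^ 2 = t" using assms by (auto simp: s_def)
    then show "s ^ 2 = sqrt t" "t = s ^ 4"
      using power_mult[of s 2 2] by simp_all
  qed (use assms in \<open>simp add: s_def\<close>)
  have "ln t = 4 * ln s" using s by (simp add: ln_realpow)
  moreover have "ln s \<le> s" using s ln_le_minus_one[of s] by linarith
  ultimately have l: "0 \<le> ln t" "ln t \<le> 4 * s" using assms s(1) by auto
  have "ln t * (3 + ln t) \<le> (4 * s) * (3 * s + 4 * s)"
    using l s by (intro mult_mono) auto
  then show ?thesis using s by (simp add: power2_eq_square)
qed

text \<open>The method of Tatuzawa and Iseki. \<open>F m\<close> is the error of
  \<open>psi (N div m)\<close> against its corrected main term. Summing it with the coefficients
  \<open>moebius_mu d * ln (N / d)\<close> over d dividing m gives \<open>ln N * F 1\<close> plus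
  the sum of \<open>mangoldt m * F m\<close>, which contains Selberg's expression. Summing over the
  multiples of d first gives inner sums of size at most 3 + ln (N / d); these are dominated by a
  square root of N / d, so the total is O(N) with no logarithm lost.\<close>

theorem selberg_formula:
  "\<exists>C. \<forall>N\<ge>1. \<bar>psi N * ln (real N) + (\<Sum>m=1..N. mangoldt m * psi (N div m)) - 2 * real N * ln (real N)\<bar> \<le> C * real N"
proof (intro exI allI impI)
  fix N :: nat assume N: "N \<ge> 1"
  define g :: real where "g = euler_mascheroni"
  have g: "0 \<le> g" "g \<le> 1" using euler_mascheroni_pos euler_mascheroni_less_13_over_22 by (auto simp: g_def)
  define F where "F m = psi (N div m) - real N / real m + g + 1" for m
  define LHS where "LHS = (\<Sum>m=1..N. \<Sum>d | d dvd m. moebius_mu d * ln (real N / real d) * F m)"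
  have "(\<Sum>d | d dvd m. moebius_mu d * ln (real N / real d)) = (if m = 1 then ln (real N) else 0) + mangoldt m"
    if "m \<in> {1..N}" for m
  proof -
    have "(\<Sum>d | d dvd m. moebius_mu d * ln (real N / real d)) =
       (\<Sum>d | d dvd m. moebius_mu d * ln (real N / real m) + moebius_mu d * ln (real (m div d)))"
    proof (intro sum.cong refl)
      fix d assume "d \<in> {d. d dvd m}"
      then obtain k where k: "m = d * k" by auto
      then show "moebius_mu d * ln (real N / real d) = moebius_mu d * ln (real N / real m) + moebius_mu d * ln (real (m div d))"
        using that N by (auto simp: ln_div ln_mult algebra_simps)
    qed
    also have "\<dots> = (\<Sum>d | d dvd m. moebius_mu d) * ln (real N / real m) + mangoldt m"
      using that by (simp add: sum.distrib sum_distrib_right sum_moebius_ln_divisors)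
    finally show ?thesis using that by (simp add: sum_moebius_divisors)
  qed
  then have "LHS = (\<Sum>m=1..N. ((if m = 1 then ln (real N) else 0) + mangoldt m) * F m)"
    unfolding LHS_def by (intro sum.cong refl) (simp add: sum_distrib_right[symmetric])
  also have "\<dots> = ln (real N) * F 1 + (\<Sum>m=1..N. mangoldt m * F m)"
    using N by (simp add: distrib_right sum.distrib if_distrib[of "\<lambda>x. x * _"] sum.delta cong: if_cong)
  also have "(\<Sum>m=1..N. mangoldt m * F m) =
     (\<Sum>m=1..N. mangoldt m * psi (N div m)) - real N * (\<Sum>m=1..N. mangoldt m / real m) + (g + 1) * psi N"
    by (simp add: F_def psi_def algebra_simps sum.distrib sum_subtractf sum_distrib_left)
  finally have LHS_eq: "LHS = ln (real N) * F 1 + (\<Sum>m=1..N. mangoldt m * psi (N div m))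
      - real N * (\<Sum>m=1..N. mangoldt m / real m) + (g + 1) * psi N" by simp

  have "LHS = (\<Sum>m=1..N. \<Sum>d | d dvd m. moebius_mu d * ln (real N / real d) * F (d * (m div d)))"
    unfolding LHS_def by (intro sum.cong refl) auto
  also have "\<dots> = (\<Sum>d=1..N. \<Sum>k=1..N div d. moebius_mu d * ln (real N / real d) * F (d * k))"
    by (rule sum_divisors_swap)
  also have "\<bar>\<dots>\<bar> \<le> (\<Sum>d=1..N. 28 * (sqrt (real N) * (1 / sqrt (real d))))"
  proof (rule order_trans[OF sum_abs], rule sum_mono)
    fix d assume d: "d \<in> {1..N}"
    define y where "y = real N / real d"
    have y: "y \<ge> 1" "N div d = nat \<lfloor>y\<rfloor>" using d by (auto simp: y_def floor_divide_of_nat_eq)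
    have ly: "ln y \<ge> 0" using y by simp
    have "(\<Sum>k=1..N div d. F (d * k)) = (\<Sum>k=1..N div d. (psi (N div d div k) - y / real k + g + 1))"
      by (simp add: F_def y_def div_mult2_eq)
    then have "\<bar>\<Sum>k=1..N div d. F (d * k)\<bar> \<le> 3 + ln y"
      using sum_selberg_weight_bound[OF y] by (simp add: g_def)
    then have "\<bar>moebius_mu d * ln y * (\<Sum>k=1..N div d. F (d * k))\<bar> \<le> 1 * ln y * (3 + ln y)"
      unfolding abs_mult using ly abs_moebius_mu_le by (intro mult_mono) auto
    also have "\<dots> \<le> 28 * sqrt y" using ln_mult_le_sqrt[OF y(1)] by simp
    finally show "\<bar>\<Sum>k=1..N div d. moebius_mu d * ln (real N / real d) * F (d * k)\<bar>
        \<le> 28 * (sqrt (real N) * (1 / sqrt (real d)))"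
      by (simp add: sum_distrib_left[symmetric] y_def real_sqrt_divide)
  qed
  also have "\<dots> \<le> 28 * (sqrt (real N) * (2 * sqrt (real N)))"
    unfolding sum_distrib_left[symmetric] by (intro mult_left_mono sum_inverse_sqrt_le) auto
  finally have "\<bar>LHS\<bar> \<le> 56 * real N" by simp
  moreover have "\<bar>real N * (\<Sum>m=1..N. mangoldt m / real m) - real N * ln (real N)\<bar> \<le> 8 * real N"
  proof -
    have "\<bar>real N * ((\<Sum>m=1..N. mangoldt m / real m) - ln (real N))\<bar> \<le> real N * 8"
      using mertens_mangoldt[OF N] by (simp only: abs_mult abs_of_nat) (rule mult_left_mono, auto)
    then show ?thesis by (simp add: algebra_simps)
  qed
  moreover have "0 \<le> (g + 1) * psi N" "(g + 1) * psi N \<le> 2 * (6 * real N)"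
    using g psi_le[of N] psi_nonneg[of N] mult_mono[of "g + 1" 2 "psi N" "6 * real N"] by auto
  moreover have "0 \<le> (g + 1) * ln (real N)" "(g + 1) * ln (real N) \<le> 2 * real N"
    using g N ln_le_minus_one[of "real N"] mult_mono[of "g + 1" 2 "ln (real N)" "real N"] by auto
  moreover have "ln (real N) * F 1 = psi N * ln (real N) - real N * ln (real N) + (g + 1) * ln (real N)"
    by (simp add: F_def algebra_simps)
  ultimately show "\<bar>psi N * ln (real N) + (\<Sum>m=1..N. mangoldt m * psi (N div m)) - 2 * real N * ln (real N)\<bar> \<le> 100 * real N"
    unfolding LHS_eq by linarith
qed

section \<open>Products of at most two primes in short windows\<close>

text \<open>Any exponent strictly between 1/2 and 1 would serve: above 1/2 so that proper prime
  powers, whose leading part is the squares of primes, give a convergent sum, and below 1 so that a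
  factor \<open>N powr (3/4)\<close> still absorbs a logarithm. For a fixed p the powers contribute
  at most ln p times a constant times p^(-3/2), and \<open>ln p\<close> is at most 4
  p^(1/4).\<close>

lemma sum_mangoldt_nonprime_powr_bounded:
  "\<exists>C\<ge>0. \<forall>N. (\<Sum>n | n \<in> {1..N} \<and> \<not> prime n. mangoldt n * real n powr (-3/4)) \<le> C"
proof -
  define r0 :: real where "r0 = 2 powr (-3/4)"
  have r0: "0 < r0" "r0 < 1" unfolding r0_def by (auto simp: powr_less_one)
  have smb: "summable (\<lambda>n. real n powr (-5/4))" by (simp add: summable_real_powr_iff)
  define C where "C = 4 / (1 - r0) * (\<Sum>n. real n powr (-5/4))"
  have "C \<ge> 0" unfolding C_def using r0 by (intro mult_nonneg_nonneg suminf_nonneg smb) auto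
  moreover have "(\<Sum>n | n \<in> {1..N} \<and> \<not> prime n. mangoldt n * real n powr (-3/4)) \<le> C" for N
  proof -
    define P where "P = {p\<in>{1..N}. prime p}"
    define h where "h = (\<lambda>n. mangoldt n * real n powr (-3/4))"
    have h0: "h n \<ge> 0" for n by (simp add: h_def mangoldt_nonneg)
    have "(\<Sum>n | n \<in> {1..N} \<and> \<not> prime n. h n) \<le> (\<Sum>n\<in>(\<lambda>(p,k). p ^ k) ` (P \<times> {2..N}). h n)"
    proof -
      have "(\<Sum>n | n \<in> {1..N} \<and> \<not> prime n. h n) = (\<Sum>n | n \<in> {1..N} \<and> \<not> prime n \<and> primepow n. h n)"
        by (rule sum.mono_neutral_right) (auto simp: h_def mangoldt_def)
      also have "\<dots> \<le> (\<Sum>n\<in>(\<lambda>(p,k). p ^ k) ` (P \<times> {2..N}). h n)"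
      proof (rule sum_mono2)
        show "{n \<in> {1..N}. \<not> prime n \<and> primepow n} \<subseteq> (\<lambda>(p,k). p ^ k) ` (P \<times> {2..N})"
        proof
          fix n assume n: "n \<in> {n \<in> {1..N}. \<not> prime n \<and> primepow n}"
          then obtain p k where pk: "prime p" "k > 0" "n = p ^ k"
            by (auto simp: primepow_def)
          have "k \<noteq> 1" using n pk by auto
          then have k2: "k \<ge> 2" using pk by simp
          have p1: "p > 1" using pk prime_gt_1_nat by blast
          have "p \<le> n" using pk p1 by (metis dvd_imp_le dvd_power zero_less_power less_trans zero_less_one)
          have "k < n" using pk(3) p1 by (simp add: power_gt_expt)
          then show "n \<in> (\<lambda>(p,k). p ^ k) ` (P \<times> {2..N})"
            using n pk k2 \<open>p \<le> n\<close> p1 by (intro image_eqI[of _ _ "(p, k)"]) (auto simp: P_def)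
        qed
      qed (auto simp: h0 P_def)
      finally show ?thesis .
    qed
    also have "\<dots> \<le> (\<Sum>(p,k)\<in>P \<times> {2..N}. h (p ^ k))"
      using sum_image_le[of "P \<times> {2..N}" h "\<lambda>(p,k). p ^ k"] h0 by (auto simp: P_def o_def case_prod_unfold)
    also have "\<dots> = (\<Sum>p\<in>P. \<Sum>k=2..N. h (p ^ k))"
      by (subst sum.Sigma[symmetric]) (auto simp: P_def)
    also have "\<dots> \<le> (\<Sum>p\<in>P. 4 / (1 - r0) * real p powr (-5/4))"
    proof (rule sum_mono)
      fix p assume "p \<in> P"
      then have p: "prime p" "p \<ge> 2" by (auto simp: P_def prime_ge_2_nat)
      define r where "r = real p powr (-3/4)"
      have r: "0 < r" "r \<le> r0" using p unfolding r_def r0_def by (auto intro!: powr_mono2')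
      have "(\<Sum>k=2..N. h (p ^ k)) = (\<Sum>k=2..N. ln (real p) * r ^ k)"
        using p by (intro sum.cong refl)
          (auto simp: h_def mangoldt_primepow r_def powr_realpow[symmetric] powr_powr mult.commute)
      also have "\<dots> = ln (real p) * r ^ 2 * (\<Sum>k<N-1. r ^ k)"
      proof (cases "N \<ge> 2")
        case True
        have "(\<Sum>k=2..N. r ^ k) = (\<Sum>k<N-1. r ^ (k + 2))"
          by (rule sum.reindex_bij_witness[of _ "\<lambda>k. k + 2" "\<lambda>k. k - 2"]) (use True in \<open>auto simp del: add_2_eq_Suc' simp: le_add_diff_inverse2\<close>)
        then show ?thesis by (simp add: power2_eq_square sum_distrib_left[symmetric] power_add sum_distrib_right[symmetric] mult_ac)
      qed auto
      also have "(\<Sum>k<N-1. r ^ k) \<le> 1 / (1 - r0)"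
      proof -
        have "(\<Sum>k<N-1. r ^ k) \<le> (\<Sum>k<N-1. r0 ^ k)" using r by (intro sum_mono power_mono) auto
        also have "\<dots> \<le> (\<Sum>k. r0 ^ k)" using r0 by (intro sum_le_suminf summable_geometric) auto
        also have "\<dots> = 1 / (1 - r0)" using r0 by (intro suminf_geometric) auto
        finally show ?thesis .
      qed
      then have "ln (real p) * r ^ 2 * (\<Sum>k<N-1. r ^ k) \<le> ln (real p) * r ^ 2 * (1 / (1 - r0))"
        using p by (intro mult_left_mono) auto
      also have "ln (real p) \<le> 4 * real p powr (1/4)"
        using ln_powr_bound[of "real p" "1/4"] p by simp
      then have "ln (real p) * r ^ 2 * (1 / (1 - r0)) \<le> (4 * real p powr (1/4)) * r ^ 2 * (1 / (1 - r0))"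
        using r0 by (intro mult_right_mono) auto
      also have "\<dots> = 4 / (1 - r0) * (real p powr (1/4) * real p powr (-3/2))"
        using p by (simp add: r_def powr_realpow[symmetric] powr_powr powr_power)
      also have "real p powr (1/4) * real p powr (-3/2) = real p powr (-5/4)"
        by (simp add: powr_add[symmetric])
      finally show "(\<Sum>k=2..N. h (p ^ k)) \<le> 4 / (1 - r0) * real p powr (-5/4)" by simp
    qed
    also have "\<dots> \<le> C"
      unfolding C_def sum_distrib_left[symmetric] using r0
      by (intro mult_left_mono sum_le_suminf smb) (auto simp: P_def)
    finally show ?thesis by (simp add: h_def)
  qed
  ultimately show ?thesis by blast
qed

text \<open>Rankin's trick: for n \<le> N the factor (N / n)^(3/4) is at least 1, and 1 / n is at
  most n^(-3/4). Both sums thus reduce to the convergent one.\<close>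

lemma sum_mangoldt_nonprime_bounds:
  "\<exists>C\<ge>0. \<forall>N\<ge>1. (\<Sum>n | n \<in> {1..N} \<and> \<not> prime n. mangoldt n) * ln (real N) \<le> C * real N \<and>
      (\<Sum>n | n \<in> {1..N} \<and> \<not> prime n. mangoldt n * psi (N div n)) \<le> C * real N"
proof -
  obtain C where C: "C \<ge> 0" "\<And>N. (\<Sum>n | n \<in> {1..N} \<and> \<not> prime n. mangoldt n * real n powr (-3/4)) \<le> C"
    using sum_mangoldt_nonprime_powr_bounded by blast
  have "(\<Sum>n | n \<in> {1..N} \<and> \<not> prime n. mangoldt n) * ln (real N) \<le> (6 * C) * real N \<and>
      (\<Sum>n | n \<in> {1..N} \<and> \<not> prime n. mangoldt n * psi (N div n)) \<le> (6 * C) * real N" if N: "N \<ge> 1" for N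
  proof
    let ?A = "{n. n \<in> {1..N} \<and> \<not> prime n}"
    have "(\<Sum>n\<in>?A. mangoldt n) \<le> (\<Sum>n\<in>?A. real N powr (3/4) * (mangoldt n * real n powr (-3/4)))"
    proof (rule sum_mono)
      fix n assume n: "n \<in> ?A"
      have "mangoldt n * 1 \<le> mangoldt n * (real N powr (3/4) * real n powr (-3/4))"
      proof (intro mult_left_mono mangoldt_nonneg)
        have "real n powr (3/4) * real n powr (-3/4) = 1" using n by (simp flip: powr_add)
        moreover have "real n powr (3/4) * real n powr (-3/4) \<le> real N powr (3/4) * real n powr (-3/4)"
          using n by (intro mult_right_mono powr_mono2) auto
        ultimately show "1 \<le> real N powr (3/4) * real n powr (-3/4)" by simp
      qed
      then show "mangoldt n \<le> real N powr (3/4) * (mangoldt n * real n powr (-3/4))" by (simp add: mult_ac)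
    qed
    also have "\<dots> \<le> real N powr (3/4) * C"
      unfolding sum_distrib_left[symmetric] by (intro mult_left_mono C) auto
    finally have "(\<Sum>n\<in>?A. mangoldt n) * ln (real N) \<le> real N powr (3/4) * C * (4 * real N powr (1/4))"
      using ln_powr_bound[of "real N" "1/4"] N C(1) by (intro mult_mono) auto
    also have "\<dots> = 4 * C * (real N powr (3/4) * real N powr (1/4))" by simp
    also have "real N powr (3/4) * real N powr (1/4) = real N" using N by (simp flip: powr_add)
    also have "4 * C * real N \<le> 6 * C * real N" using C(1) by (intro mult_right_mono) auto
    finally show "(\<Sum>n\<in>?A. mangoldt n) * ln (real N) \<le> (6 * C) * real N" .
    have "(\<Sum>n\<in>?A. mangoldt n * psi (N div n)) \<le> (\<Sum>n\<in>?A. 6 * real N * (mangoldt n * real n powr (-3/4)))"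
    proof (rule sum_mono)
      fix n assume n: "n \<in> ?A"
      have "psi (N div n) \<le> 6 * real (N div n)" by (rule psi_le)
      also have "\<dots> \<le> 6 * (real N / real n)"
        using of_nat_div_le_of_nat[of N n, where ?'a = real] by simp
      also have "real N / real n = real N * real n powr (-1)" using n by (simp add: powr_minus_divide)
      also have "real n powr (-1) \<le> real n powr (-3/4)" using n by (intro powr_mono) auto
      finally have "psi (N div n) \<le> 6 * (real N * real n powr (-3/4))" by (simp add: mult_left_mono)
      then have "mangoldt n * psi (N div n) \<le> mangoldt n * (6 * (real N * real n powr (-3/4)))"
        by (intro mult_left_mono mangoldt_nonneg)
      then show "mangoldt n * psi (N div n) \<le> 6 * real N * (mangoldt n * real n powr (-3/4))"
        by (simp add: mult_ac)
    qed
    also have "\<dots> \<le> 6 * real N * C"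
      unfolding sum_distrib_left[symmetric] by (intro mult_left_mono C) auto
    finally show "(\<Sum>n\<in>?A. mangoldt n * psi (N div n)) \<le> (6 * C) * real N" by (simp add: mult_ac)
  qed
  then show ?thesis using C(1) by (intro exI[of _ "6 * C"]) auto
qed

section \<open>Selberg's formula on short windows, restricted to primes and products of two
  primes\<close>

lemma ln_le_iff_le_exp: "x > 0 \<Longrightarrow> ln x \<le> y \<longleftrightarrow> x \<le> exp (y::real)"
  by (metis exp_le_cancel_iff exp_ln)

lemma less_ln_iff_exp_less: "x > 0 \<Longrightarrow> y < ln x \<longleftrightarrow> exp (y::real) < x"
  by (metis exp_less_cancel_iff exp_ln)

definition hyperbola :: "nat \<Rightarrow> (nat \<times> nat) set" where
  "hyperbola N = {(a,b). 1 \<le> a \<and> 1 \<le> b \<and> a * b \<le> N}"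

lemma hyperbola_eq_Sigma: "hyperbola N = (SIGMA a:{1..N}. {1..N div a})"
proof (intro equalityI subsetI)
  fix x assume "x \<in> hyperbola N"
  then obtain a b where x: "x = (a,b)" "1 \<le> a" "1 \<le> b" "a * b \<le> N" by (auto simp: hyperbola_def)
  moreover have "a \<le> N" using x order.trans[of a "a * b" N] by simp
  moreover have "b \<le> N div a" using x by (simp add: less_eq_div_iff_mult_less_eq mult.commute)
  ultimately show "x \<in> (SIGMA a:{1..N}. {1..N div a})" by auto
next
  fix x assume "x \<in> (SIGMA a:{1..N}. {1..N div a})"
  then obtain a b where x: "x = (a,b)" "1 \<le> a" "1 \<le> b" "b \<le> N div a" by auto
  then show "x \<in> hyperbola N" by (auto simp: hyperbola_def less_eq_div_iff_mult_less_eq mult.commute)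
qed

lemma finite_hyperbola [simp]: "finite (hyperbola N)"
  by (simp add: hyperbola_eq_Sigma)

lemma sum_hyperbola: "(\<Sum>(a,b)\<in>hyperbola N. f a b) = (\<Sum>a=1..N. \<Sum>b=1..N div a. f a b)"
  unfolding hyperbola_eq_Sigma by (subst sum.Sigma) auto

text \<open>Selberg's formula at \<open>N'\<close> minus the formula at \<open>N\<close>, after
  discarding proper prime powers at a cost O(N'). Using the factor \<open>ln N'\<close> at both ends
  leaves \<open>psi N\<close> times \<open>ln N' - ln N\<close>, the second part of the error term.
  Pairs are ordered, so (p, q) and (q, p) both count.\<close>

lemma selberg_prime_window:
  "\<exists>C\<ge>0. \<forall>N\<ge>1. \<forall>N'\<ge>N.
     ln (real N') * (\<Sum>p | prime p \<and> N < p \<and> p \<le> N'. ln (real p)) +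
     (\<Sum>(p,q) | prime p \<and> prime q \<and> N < p * q \<and> p * q \<le> N'. ln (real p) * ln (real q))
     \<ge> 2 * (real N' - real N) * ln (real N) - C * real N' * (1 + (ln (real N') - ln (real N)))"
proof -
  obtain C1 where C1: "\<And>N. N \<ge> 1 \<Longrightarrow> \<bar>psi N * ln (real N) + (\<Sum>m=1..N. mangoldt m * psi (N div m))
      - 2 * real N * ln (real N)\<bar> \<le> C1 * real N"
    using selberg_formula by blast
  obtain C2 where C2: "C2 \<ge> 0"
    "\<And>N. N \<ge> 1 \<Longrightarrow> (\<Sum>n | n \<in> {1..N} \<and> \<not> prime n. mangoldt n) * ln (real N) \<le> C2 * real N"
    "\<And>N. N \<ge> 1 \<Longrightarrow> (\<Sum>n | n \<in> {1..N} \<and> \<not> prime n. mangoldt n * psi (N div n)) \<le> C2 * real N"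
    using sum_mangoldt_nonprime_bounds by blast
  define C where "C = 2 * \<bar>C1\<bar> + 3 * C2 + 6"
  have "2 * (real N' - real N) * ln (real N) - C * real N' * (1 + (ln (real N') - ln (real N))) \<le>
     ln (real N') * (\<Sum>p | prime p \<and> N < p \<and> p \<le> N'. ln (real p)) +
     (\<Sum>(p,q) | prime p \<and> prime q \<and> N < p * q \<and> p * q \<le> N'. ln (real p) * ln (real q))"
    if N: "N \<ge> 1" "N' \<ge> N" for N N'
  proof -
    define P where "P = (\<lambda>N. \<Sum>m=1..N. mangoldt m * psi (N div m))"
    define A where "A = (\<Sum>p | prime p \<and> N < p \<and> p \<le> N'. ln (real p))"
    define B where "B = (\<Sum>(p,q) | prime p \<and> prime q \<and> N < p * q \<and> p * q \<le> N'. ln (real p) * ln (real q))"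
    define E where "E = (\<Sum>n | n \<in> {1..N'} \<and> \<not> prime n. mangoldt n :: real)"
    define E2 where "E2 = (\<Sum>n | n \<in> {1..N'} \<and> \<not> prime n. mangoldt n * psi (N' div n))"
    have N': "N' \<ge> 1" using N by simp
    have "psi N' - psi N = (\<Sum>n\<in>{N+1..N'}. mangoldt n)"
      using sum.ub_add_nat[of 1 N "mangoldt :: nat \<Rightarrow> real" "N' - N"] N by (simp add: psi_def)
    also have "\<dots> = (\<Sum>n | n \<in> {N+1..N'} \<and> prime n. mangoldt n) + (\<Sum>n | n \<in> {N+1..N'} \<and> \<not> prime n. mangoldt n)"
      by (subst sum.union_disjoint[symmetric]) (auto intro!: sum.cong)
    also have "(\<Sum>n | n \<in> {N+1..N'} \<and> prime n. mangoldt n) = A"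
      unfolding A_def by (intro sum.cong) (auto simp: Suc_le_eq)
    also have "(\<Sum>n | n \<in> {N+1..N'} \<and> \<not> prime n. mangoldt n :: real) \<le> E"
      unfolding E_def by (intro sum_mono2) (auto simp: mangoldt_nonneg)
    finally have 1: "psi N' - psi N \<le> A + E" by simp
    have P: "P M = (\<Sum>(a,b)\<in>hyperbola M. mangoldt a * mangoldt b)" for M
      by (simp add: sum_hyperbola P_def psi_def sum_distrib_left)
    have sub: "hyperbola N \<subseteq> hyperbola N'" using N by (auto simp: hyperbola_def)
    define G where "G = (\<lambda>(a,b). mangoldt a * mangoldt b :: real)"
    have G0: "G x \<ge> 0" for x by (auto simp: G_def mangoldt_nonneg split: prod.splits)
    have "P N' - P N = (\<Sum>x\<in>hyperbola N' - hyperbola N. G x)"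
      unfolding P G_def using sub by (simp add: sum_diff)
    also have "\<dots> \<le> (\<Sum>x\<in>{(p,q). prime p \<and> prime q \<and> N < p * q \<and> p * q \<le> N'} \<union>
         (({x\<in>hyperbola N'. \<not> prime (fst x)}) \<union> {x\<in>hyperbola N'. \<not> prime (snd x)}). G x)"
    proof (rule sum_mono2)
      have "{(p,q). prime p \<and> prime q \<and> N < p * q \<and> p * q \<le> N'} \<subseteq> hyperbola N'"
        by (auto simp: hyperbola_def Suc_le_eq prime_gt_0_nat)
      then show "finite ({(p,q). prime p \<and> prime q \<and> N < p * q \<and> p * q \<le> N'} \<union>
         (({x\<in>hyperbola N'. \<not> prime (fst x)}) \<union> {x\<in>hyperbola N'. \<not> prime (snd x)}))"
        by (intro finite_subset[OF _ finite_hyperbola[of N']]) auto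
    qed (auto simp: hyperbola_def G0)
    also have "\<dots> \<le> B + (E2 + E2)"
    proof -
      have fin: "finite {(p,q). prime p \<and> prime q \<and> N < p * q \<and> p * q \<le> N'}"
        by (rule finite_subset[OF _ finite_hyperbola[of N']]) (auto simp: hyperbola_def Suc_le_eq prime_gt_0_nat)
      have b: "(\<Sum>x\<in>{(p,q). prime p \<and> prime q \<and> N < p * q \<and> p * q \<le> N'}. G x) = B"
        unfolding B_def G_def by (intro sum.cong refl) auto
      have e: "(\<Sum>x\<in>{x\<in>hyperbola N'. \<not> prime (fst x)}. G x) = E2"
      proof -
        have "{x\<in>hyperbola N'. \<not> prime (fst x)} = (SIGMA a:{n. n \<in> {1..N'} \<and> \<not> prime n}. {1..N' div a})"
          unfolding hyperbola_eq_Sigma by auto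
        then show ?thesis unfolding E2_def G_def psi_def
          by (simp add: sum.Sigma[symmetric] sum_distrib_left)
      qed
      have e': "(\<Sum>x\<in>{x\<in>hyperbola N'. \<not> prime (snd x)}. G x) = E2"
        unfolding e[symmetric]
        by (rule sum.reindex_bij_witness[where i = prod.swap and j = prod.swap])
           (auto simp: hyperbola_def G_def mult.commute)
      have u: "sum G (X \<union> Y) \<le> sum G X + sum G Y" if "finite X" "finite Y" for X Y
        using sum.union_inter[OF that, of G] sum_nonneg[of "X \<inter> Y" G] G0 by auto
      show ?thesis using u[OF fin, of "{x\<in>hyperbola N'. \<not> prime (fst x)} \<union> {x\<in>hyperbola N'. \<not> prime (snd x)}"]
          u[of "{x\<in>hyperbola N'. \<not> prime (fst x)}" "{x\<in>hyperbola N'. \<not> prime (snd x)}"] b e e' by simp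
    qed
    finally have 2: "P N' - P N \<le> B + 2 * E2" by simp
    have l: "0 \<le> ln (real N)" "ln (real N) \<le> ln (real N')" using N by auto
    define D where "D = ln (real N') - ln (real N)"
    have D: "D \<ge> 0" using l by (simp add: D_def)
    have "2 * real N' * ln (real N') - C1 * real N' \<le> psi N' * ln (real N') + P N'"
      using C1[OF N'] unfolding P_def by linarith
    moreover have "psi N * ln (real N) + P N \<le> 2 * real N * ln (real N) + C1 * real N"
      using C1[OF N(1)] unfolding P_def by linarith
    moreover have "(psi N' - psi N) * ln (real N') \<le> (A + E) * ln (real N')"
      using 1 l by (intro mult_right_mono) auto
    moreover have "E * ln (real N') \<le> C2 * real N'" "E2 \<le> C2 * real N'"
      using C2(2,3)[OF N'] by (auto simp: E_def E2_def)
    moreover have "psi N * D \<le> 6 * real N' * D"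
      using psi_le[of N] N D by (intro mult_right_mono) auto
    moreover have "2 * real N' * ln (real N') \<ge> 2 * real N' * ln (real N)"
      using l by (intro mult_left_mono) auto
    moreover have "C1 * real N \<le> \<bar>C1\<bar> * real N'" "C1 * real N' \<le> \<bar>C1\<bar> * real N'"
      using N by (auto intro!: mult_mono)
    moreover have "C * real N' * (1 + D) \<ge> (2 * \<bar>C1\<bar> + 3 * C2) * real N' + 6 * real N' * D"
    proof -
      have "C * real N' * (1 + D) = (2 * \<bar>C1\<bar> + 3 * C2) * real N' + 6 * real N' * D + 6 * real N' + (2 * \<bar>C1\<bar> + 3 * C2) * real N' * D"
        by (simp add: C_def algebra_simps)
      moreover have "(2 * \<bar>C1\<bar> + 3 * C2) * real N' * D \<ge> 0" using C2(1) D by (intro mult_nonneg_nonneg add_nonneg_nonneg) auto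
      ultimately show ?thesis by simp
    qed
    ultimately have "2 * (real N' - real N) * ln (real N) - C * real N' * (1 + D) \<le> ln (real N') * A + B"
      using 2 unfolding D_def by (simp add: algebra_simps)
    then show ?thesis unfolding A_def B_def D_def .
  qed
  moreover have "C \<ge> 0" using C2 by (simp add: C_def)
  ultimately show ?thesis by blast
qed

text \<open>The pair \<open>(p, 1)\<close> stands for the prime \<open>p\<close>, the pair \<open>(p, q)\<close> for the product \<open>p q\<close>.\<close>

definition prime_pairs :: "(nat \<times> nat) set" where
  "prime_pairs = {(p,q). prime p \<and> (q = 1 \<or> prime q)}"

text \<open>The weights are those of Selberg's formula. They make \<open>theta (p, q) / q\<close> summable over \<open>q\<close> with a bound
  independent of \<open>p\<close>, so pairs sharing a prime contribute little to the variance below.\<close>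

definition theta :: "nat \<times> nat \<Rightarrow> real" where
  "theta = (\<lambda>(p,q). if q = 1 then 1 else ln (real p) * ln (real q) / (ln (real p) + ln (real q))\<^sup>2)"

abbreviation pprod :: "nat \<times> nat \<Rightarrow> nat" where
  "pprod i \<equiv> fst i * snd i"

text \<open>Windows are half-open on the logarithmic scale, so different j give disjoint
  windows.\<close>

definition window :: "real \<Rightarrow> nat \<Rightarrow> (nat \<times> nat) set" where
  "window d j = {i \<in> prime_pairs. d * j < ln (real (pprod i)) \<and> ln (real (pprod i)) \<le> d * (j + 1)}"

lemma prime_pairs_pos: "i \<in> prime_pairs \<Longrightarrow> fst i \<ge> 1 \<and> snd i \<ge> 1"
  by (auto simp: prime_pairs_def Suc_le_eq prime_gt_0_nat)

lemma theta_nonneg: "i \<in> prime_pairs \<Longrightarrow> theta i \<ge> 0"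
  by (auto simp: prime_pairs_def theta_def Suc_le_eq prime_gt_0_nat)

lemma theta_le_1:
  assumes "i \<in> prime_pairs"
  shows "theta i \<le> 1"
proof -
  obtain p q where i: "i = (p,q)" by fastforce
  have "ln (real p) \<ge> 0" "ln (real q) \<ge> 0"
    using prime_pairs_pos[OF assms] by (auto simp: i)
  then have "ln (real p) * ln (real q) \<le> (ln (real p) + ln (real q))\<^sup>2"
    by (simp add: power2_eq_square algebra_simps)
  then show ?thesis by (auto simp: theta_def i divide_le_eq_1)
qed

lemma finite_window [simp]: "finite (window d j)"
proof (rule finite_subset)
  show "window d j \<subseteq> hyperbola (nat \<lfloor>exp (d * (j + 1))\<rfloor>)"
  proof
    fix i assume i: "i \<in> window d j"
    then have pos: "fst i \<ge> 1" "snd i \<ge> 1" using prime_pairs_pos by (auto simp: window_def)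
    then have "real (pprod i) > 0" by (simp add: Suc_le_eq)
    then have "real (pprod i) = exp (ln (real (pprod i)))" by simp
    also have "\<dots> \<le> exp (d * (j + 1))" using i unfolding exp_le_cancel_iff by (auto simp: window_def)
    finally have "pprod i \<le> nat \<lfloor>exp (d * (j + 1))\<rfloor>" by (simp add: le_nat_floor)
    then show "i \<in> hyperbola (nat \<lfloor>exp (d * (j + 1))\<rfloor>)"
      using pos by (auto simp: hyperbola_def case_prod_unfold)
  qed
qed simp

text \<open>On the window starting at X = \<open>exp (d * j)\<close> Selberg's lower bound is of
  order d^2 j X against an error O(X), so it wins for large j. Every product n in the window
  satisfies n \<le> 3 X and ln n \<le> d (j + 1), so Selberg's weights divided by 3 X d^2 (j + 1)^2
  are at most \<open>theta i / n\<close>. The d^2 cancels, and the resulting bound of order 1 / j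
  has a divergent sum.\<close>

lemma window_mass:
  assumes d: "0 < d" "d \<le> 1"
  shows "\<exists>j0\<ge>1. \<forall>j\<ge>j0. (\<Sum>i\<in>window d j. theta i / real (pprod i)) \<ge> 1 / (12 * real j)"
proof -
  obtain C where C: "C \<ge> 0" "\<And>N N'. N \<ge> 1 \<Longrightarrow> N' \<ge> N \<Longrightarrow>
     2 * (real N' - real N) * ln (real N) - C * real N' * (1 + (ln (real N') - ln (real N))) \<le>
     ln (real N') * (\<Sum>p | prime p \<and> N < p \<and> p \<le> N'. ln (real p)) +
     (\<Sum>(p,q) | prime p \<and> prime q \<and> N < p * q \<and> p * q \<le> N'. ln (real p) * ln (real q))"
    using selberg_prime_window by blast
  \<comment> \<open>The choice gives 2 d + 2 + 9 C \<le> d^2 j. Half of Selberg's main term 2 d^2 j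
    X then pays for all losses.\<close>
  define j0 where "j0 = max 1 (nat \<lceil>(2 * d + 2 + 9 * C) / d\<^sup>2\<rceil>)"
  have "(\<Sum>i\<in>window d j. theta i / real (pprod i)) \<ge> 1 / (12 * real j)" if j: "j \<ge> j0" for j
  proof -
    have j1: "j \<ge> 1" using j by (simp add: j0_def)
    have "(2 * d + 2 + 9 * C) / d\<^sup>2 \<le> real j" using j by (simp add: j0_def)
    then have jj: "2 * d + 2 + 9 * C \<le> d\<^sup>2 * real j" using d by (simp add: field_simps)
    define X where "X = exp (d * real j)"
    define Y where "Y = exp (d * (real j + 1))"
    have "X \<ge> 1 + d * real j" using exp_ge_add_one_self[of "d * real j"] by (simp add: X_def)
    moreover have "d * real j \<ge> 0" using d by simp
    ultimately have X: "X \<ge> 1" "X \<ge> d * real j" by linarith+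
    have "Y = X * exp d" by (simp add: X_def Y_def exp_add[symmetric] algebra_simps)
    moreover have "1 + d \<le> exp d" by (rule exp_ge_add_one_self)
    moreover have "exp d \<le> 3" using d exp_le[of ] by (meson exp_le_cancel_iff order_trans)
    ultimately have Y: "Y \<ge> X * (1 + d)" "Y \<le> 3 * X"
      using X by (auto intro!: mult_left_mono)
    have "X \<le> Y" using d by (auto simp: X_def Y_def)
    define N where "N = nat \<lfloor>X\<rfloor>"
    define N' where "N' = nat \<lfloor>Y\<rfloor>"
    have N: "N \<ge> 1" "real N \<le> X" "X < real N + 1" using X unfolding N_def by linarith+
    have N': "N' \<ge> N" "real N' \<le> Y" "Y < real N' + 1" using X \<open>X \<le> Y\<close> unfolding N_def N'_def by linarith+
    define U where "U = d * (real j + 1)"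
    have U: "U > 0" using d by (simp add: U_def)
    have lN: "ln (real N) \<ge> d * j - 1"
    proof -
      have "real N \<ge> 1" using N(1) by simp
      then have "X / 2 \<le> real N" using N(3) by linarith
      then have "ln (X / 2) \<le> ln (real N)" using X by (intro ln_mono) auto
      moreover have "ln (X / 2) = d * j - ln 2" by (simp add: X_def ln_div)
      ultimately show ?thesis using ln_2_less_1 by linarith
    qed
    have lN': "ln (real N') \<le> U" "ln (real N') \<ge> 0"
    proof -
      have "ln (real N') \<le> ln Y" using N' N by (subst ln_le_cancel_iff) auto
      then show "ln (real N') \<le> U" by (simp add: Y_def U_def)
    qed (use N N' in auto)
    define A where "A = (\<Sum>p | prime p \<and> N < p \<and> p \<le> N'. ln (real p))"
    define B where "B = (\<Sum>(p,q) | prime p \<and> prime q \<and> N < p * q \<and> p * q \<le> N'. ln (real p) * ln (real q))"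
    have wA: "N < n \<and> n \<le> N' \<longleftrightarrow> d * j < ln (real n) \<and> ln (real n) \<le> d * (j + 1)" if "n \<ge> 1" for n
    proof -
      have "N < n \<longleftrightarrow> X < real n" using X by (simp add: N_def nat_less_iff floor_less_iff)
      also have "\<dots> \<longleftrightarrow> d * j < ln (real n)" using that by (simp add: X_def less_ln_iff_exp_less)
      finally have 1: "N < n \<longleftrightarrow> d * j < ln (real n)" .
      have "n \<le> N' \<longleftrightarrow> real n \<le> Y" using X Y \<open>X \<le> Y\<close> by (simp add: N'_def le_nat_iff le_floor_iff)
      also have "\<dots> \<longleftrightarrow> ln (real n) \<le> d * (j + 1)" using that by (simp add: Y_def ln_le_iff_le_exp add.commute)
      finally show ?thesis using 1 by simp
    qed
    have d2: "d\<^sup>2 * j * X \<le> ln (real N') * A + B"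
    proof -
      have "ln (real N') - ln (real N) \<le> 2" using lN lN' d by (simp add: U_def algebra_simps)
      then have "C * real N' * (1 + (ln (real N') - ln (real N))) \<le> C * (3 * X) * 3"
        using C(1) N N' Y X by (intro mult_mono) auto
      moreover have "2 * (real N' - real N) * ln (real N) \<ge> 2 * (d * X - 1) * (d * j - 1)"
      proof -
        have nn: "real N' - real N \<ge> d * X - 1" using Y N N' by (simp add: algebra_simps)
        have "real N' - real N \<ge> 0" "ln (real N) \<ge> 0" using N N' by auto
        moreover have dj: "d * j - 1 \<ge> 0"
        proof -
          have "d * (d * j) = d\<^sup>2 * real j" by (simp add: power2_eq_square)
          then have "d * 1 \<le> d * (d * j)" using jj d C(1) by linarith
          then show ?thesis using d by (metis diff_ge_0_iff_ge mult_le_cancel_left_pos)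
        qed
        ultimately have "(d * X - 1) * (d * j - 1) \<le> (real N' - real N) * (d * j - 1)"
           "(real N' - real N) * (d * j - 1) \<le> (real N' - real N) * ln (real N)"
          using nn lN by (auto intro: mult_right_mono mult_left_mono)
        then show ?thesis by linarith
      qed
      moreover have "2 * (d * X - 1) * (d * j - 1) - 9 * C * X \<ge> d\<^sup>2 * j * X"
      proof -
        have "X * (2 * d + 2 + 9 * C) \<le> X * (d\<^sup>2 * real j)" using jj X by (intro mult_left_mono) auto
        then show ?thesis using X by (simp add: algebra_simps power2_eq_square)
      qed
      ultimately show ?thesis using C(2)[OF N(1) N'(1)] unfolding A_def B_def by (simp add: algebra_simps)
    qed
    define w where "w = (\<lambda>i. theta i / real (pprod i))"
    define S1 where "S1 = (\<lambda>p. (p, 1::nat)) ` {p. prime p \<and> N < p \<and> p \<le> N'}"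
    define S2 where "S2 = {(p,q). prime p \<and> prime q \<and> N < p * q \<and> p * q \<le> N'}"
    have "S1 \<union> S2 \<subseteq> window d j"
    proof
      fix i assume "i \<in> S1 \<union> S2"
      then have i: "i \<in> prime_pairs" "N < pprod i \<and> pprod i \<le> N'"
        by (auto simp: S1_def S2_def prime_pairs_def)
      then have "pprod i \<ge> 1" by linarith
      then show "i \<in> window d j" using i wA[of "pprod i"] by (simp add: window_def)
    qed
    then have fin: "finite S1" "finite S2" using finite_window finite_subset by blast+
    have "sum w S1 \<ge> ln (real N') * A / (U\<^sup>2 * (3 * X))"
    proof -
      have "sum w S1 = (\<Sum>p | prime p \<and> N < p \<and> p \<le> N'. 1 / real p)"
        unfolding S1_def by (subst sum.reindex) (auto simp: inj_on_def w_def theta_def)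
      also have "\<dots> \<ge> (\<Sum>p | prime p \<and> N < p \<and> p \<le> N'. ln (real N') * ln (real p) / (U\<^sup>2 * (3 * X)))"
      proof (rule sum_mono)
        fix p assume p: "p \<in> {p. prime p \<and> N < p \<and> p \<le> N'}"
        then have p1: "p \<ge> 1" by (simp add: Suc_le_eq prime_gt_0_nat)
        have lp: "ln (real p) \<le> U" "ln (real p) \<ge> 0" using wA[OF p1] p p1 by (auto simp: U_def add.commute)
        then have "ln (real N') * ln (real p) \<le> U * U" using lN' U by (intro mult_mono) auto
        moreover have "real p \<le> 3 * X" using p N' Y by auto
        ultimately have "ln (real N') * ln (real p) * real p \<le> U * U * (3 * X)"
          using X U lp lN' by (intro mult_mono) auto
        then show "ln (real N') * ln (real p) / (U\<^sup>2 * (3 * X)) \<le> 1 / real p"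
          using p1 U X by (simp add: field_simps power2_eq_square)
      qed
      finally show ?thesis by (simp add: A_def sum_distrib_left sum_divide_distrib)
    qed
    moreover have "sum w S2 \<ge> B / (U\<^sup>2 * (3 * X))"
    proof -
      have "B / (U\<^sup>2 * (3 * X)) = (\<Sum>(p,q)\<in>S2. ln (real p) * ln (real q) / (U\<^sup>2 * (3 * X)))"
        unfolding B_def S2_def by (simp add: sum_divide_distrib case_prod_unfold)
      also have "\<dots> \<le> sum w S2"
      proof (rule sum_mono)
        fix i assume i: "i \<in> S2"
        then obtain p q where i': "i = (p,q)" "prime p" "prime q" "N < p * q" "p * q \<le> N'" by (auto simp: S2_def)
        have pq: "p \<ge> 2" "q \<ge> 2" using i' prime_ge_2_nat by auto
        then have pq1: "p * q \<ge> 1" by (simp add: Suc_le_eq)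
        define a where "a = ln (real p)"
        define b where "b = ln (real q)"
        have ab: "a > 0" "b > 0" using pq by (auto simp: a_def b_def)
        have "a + b \<le> U" using wA[OF pq1] i' pq by (auto simp: U_def a_def b_def ln_mult add.commute)
        then have "(a + b)\<^sup>2 \<le> U\<^sup>2" using ab by (intro power_mono) auto
        moreover have "real (p * q) \<le> 3 * X" using i' N' Y by linarith
        ultimately have "(a + b)\<^sup>2 * real (p * q) \<le> U\<^sup>2 * (3 * X)" by (intro mult_mono) auto
        moreover have "(a + b)\<^sup>2 * real (p * q) > 0" using ab pq by simp
        ultimately have "a * b / (U\<^sup>2 * (3 * X)) \<le> a * b / ((a + b)\<^sup>2 * real (p * q))"
          using ab by (intro frac_le) auto
        then show "(case i of (p,q) \<Rightarrow> ln (real p) * ln (real q) / (U\<^sup>2 * (3 * X))) \<le> w i"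
          using pq by (simp add: i' w_def theta_def a_def b_def)
      qed
      finally show ?thesis .
    qed
    moreover have "sum w (S1 \<union> S2) = sum w S1 + sum w S2"
      using fin by (intro sum.union_disjoint) (auto simp: S1_def S2_def)
    moreover have "sum w (S1 \<union> S2) \<le> sum w (window d j)"
      using \<open>S1 \<union> S2 \<subseteq> window d j\<close> by (intro sum_mono2 finite_window) (auto simp: w_def window_def theta_nonneg)
    ultimately have "sum w (window d j) \<ge> (ln (real N') * A + B) / (U\<^sup>2 * (3 * X))"
      by (simp add: add_divide_distrib)
    also have "(ln (real N') * A + B) / (U\<^sup>2 * (3 * X)) \<ge> (d\<^sup>2 * j * X) / (U\<^sup>2 * (3 * X))"
      using d2 X U by (intro divide_right_mono) auto
    also have "(d\<^sup>2 * j * X) / (U\<^sup>2 * (3 * X)) = j / (3 * (real j + 1)\<^sup>2)"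
    proof -
      have e: "U\<^sup>2 * (3 * X) = (d\<^sup>2 * X) * (3 * (real j + 1)\<^sup>2)"
        by (simp add: U_def power_mult_distrib)
      have e2: "d\<^sup>2 * j * X = (d\<^sup>2 * X) * real j" by simp
      show ?thesis using d X unfolding e e2 by (subst mult_divide_mult_cancel_left) auto
    qed
    also have "j / (3 * (real j + 1)\<^sup>2) \<ge> 1 / (12 * real j)"
    proof -
      have "(real j + 1)\<^sup>2 \<le> (2 * real j)\<^sup>2" using j1 by (intro power_mono) auto
      then show ?thesis using j1 by (simp add: field_simps power2_eq_square)
    qed
    finally show ?thesis by (simp add: w_def)
  qed
  then show ?thesis by (intro exI[of _ j0]) (auto simp: j0_def)
qed

text \<open>Mertens' estimate at the two ends of the block from exp k to exp (k + 1). The errors are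
  8 at each end, the rounded endpoints differ by at most 2 in logarithm, and the left endpoint
  itself adds at most 1.\<close>

lemma mertens_block:
  assumes "finite Q" "\<And>p. p \<in> Q \<Longrightarrow> prime p \<and> nat \<lfloor>ln (real p)\<rfloor> = k"
  shows "(\<Sum>p\<in>Q. ln (real p) / real p) \<le> 20"
proof -
  define M where "M = nat \<lfloor>exp (real k)\<rfloor>"
  define N where "N = nat \<lfloor>exp (real k + 1)\<rfloor>"
  have e: "exp (real k) \<ge> 1" "exp (real k) \<le> exp (real k + 1)" by auto
  have M: "M \<ge> 1" "exp (real k) < real M + 1" using e unfolding M_def by linarith+
  have N: "M \<le> N" "real N \<le> exp (real k + 1)" using e unfolding M_def N_def by linarith+
  define S where "S = (\<lambda>N. \<Sum>n=1..N. mangoldt n / real n :: real)"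
  have "Q \<subseteq> {M..N}"
  proof
    fix p assume p: "p \<in> Q"
    have p1: "real p \<ge> 1" using assms(2)[OF p] by (simp add: Suc_le_eq prime_gt_0_nat)
    have "ln (real p) \<ge> 0" using p1 by simp
    then have "real k \<le> ln (real p)" "ln (real p) \<le> real k + 1" using assms(2)[OF p] by linarith+
    then have "exp (real k) \<le> real p" "real p \<le> exp (real k + 1)"
      using p1 by (auto simp: ln_ge_iff ln_le_iff_le_exp)
    then show "p \<in> {M..N}" by (auto simp: M_def N_def le_nat_floor) linarith
  qed
  then have "(\<Sum>p\<in>Q. ln (real p) / real p) \<le> (\<Sum>n=M..N. mangoldt n / real n)"
    using assms by (intro order_trans[OF eq_refl[OF sum.cong[OF refl]] sum_mono2]) (auto simp: mangoldt_nonneg)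
  moreover have "(\<Sum>n=M..N. mangoldt n / real n) = S N - S M + mangoldt M / real M"
  proof -
    have "S N = S M + (\<Sum>n=M+1..N. mangoldt n / real n)"
      using sum.ub_add_nat[of 1 M "\<lambda>n. mangoldt n / real n :: real" "N - M"] N by (simp add: S_def)
    moreover have "(\<Sum>n=M..N. mangoldt n / real n :: real) = mangoldt M / real M + (\<Sum>n=M+1..N. mangoldt n / real n)"
      using N by (simp add: sum.atLeast_Suc_atMost)
    ultimately show ?thesis by simp
  qed
  moreover have "mangoldt M / real M \<le> 1"
    using mangoldt_le[of M] ln_le_minus_one[of "real M"] M by (simp add: field_simps)
  moreover have "S N - S M \<le> 16 + (ln (real N) - ln (real M))"
    using mertens_mangoldt[of N] mertens_mangoldt[of M] M N by (simp add: S_def abs_le_iff)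
  moreover have "ln (real N) \<le> real k + 1"
    using M N by (subst ln_le_iff_le_exp) auto
  moreover have "ln (real M) \<ge> real k - 1"
  proof -
    have "real M \<ge> 1" using M(1) by simp
    then have "exp (real k) / 2 \<le> real M" using M(2) by linarith
    then have "ln (exp (real k) / 2) \<le> ln (real M)" using M by (subst ln_le_cancel_iff) auto
    then show ?thesis using ln_2_less_1 by (simp add: ln_div)
  qed
  ultimately show ?thesis by linarith
qed

lemma sum_inverse_square_shift_le:
  assumes "L > (0::real)"
  shows "(\<Sum>k\<le>K. 1 / (L + real k)\<^sup>2) \<le> 1 / L\<^sup>2 + 1 / L"
proof -
  have "(\<Sum>k\<le>K. 1 / (L + real k)\<^sup>2) \<le> 1 / L\<^sup>2 + 1 / L - 1 / (L + real K)"
  proof (induction K)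
    case (Suc K)
    have p: "L + real K > 0" using assms by simp
    have "1 / (L + real (Suc K))\<^sup>2 \<le> 1 / ((L + real K) * (L + real (Suc K)))"
      using p by (intro divide_left_mono) (auto simp: power2_eq_square intro!: mult_right_mono)
    also have "\<dots> = 1 / (L + real K) - 1 / (L + real (Suc K))"
      using p by (simp add: field_simps)
    finally show ?case using Suc by simp
  qed auto
  moreover have "1 / (L + real K) \<ge> 0" using assms by simp
  ultimately show ?thesis by linarith
qed

text \<open>With L = \<open>ln p\<close>, a block of primes q with ln q near k contributes at most
  20 L / (L + k)^2, and the sum over k is about 20: the square in the denominator of
  \<open>theta\<close> is what cancels the factor L. The worst case p = 2 accounts for the constant
  60.\<close>

lemma sum_theta_le:
  assumes p: "prime p" and Q: "finite Q" "\<And>q. q \<in> Q \<Longrightarrow> prime q"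
  shows "(\<Sum>q\<in>Q. theta (p, q) / real q) \<le> 60" and "(\<Sum>q\<in>Q. theta (q, p) / real q) \<le> 60"
proof -
  define L where "L = ln (real p)"
  have "ln 2 \<le> L" unfolding L_def using prime_ge_2_nat[OF p] by simp
  then have L: "L \<ge> 1/2" using ln2_ge_two_thirds by linarith
  define K where "K = Max (insert 0 ((\<lambda>q. nat \<lfloor>ln (real q)\<rfloor>) ` Q))"
  have "(\<Sum>q\<in>Q. theta (p, q) / real q) = (\<Sum>q\<in>Q. L * (ln (real q) / real q) / (L + ln (real q))\<^sup>2)"
  proof (rule sum.cong[OF refl])
    fix q assume "q \<in> Q"
    then have "q \<noteq> 1" using Q(2) not_prime_1 by metis
    then show "theta (p, q) / real q = L * (ln (real q) / real q) / (L + ln (real q))\<^sup>2"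
      by (simp add: theta_def L_def field_simps)
  qed
  also have "\<dots> = (\<Sum>k\<le>K. \<Sum>q | q \<in> Q \<and> nat \<lfloor>ln (real q)\<rfloor> = k. L * (ln (real q) / real q) / (L + ln (real q))\<^sup>2)"
    using Q by (subst sum.group) (auto simp: K_def)
  also have "\<dots> \<le> (\<Sum>k\<le>K. L / (L + real k)\<^sup>2 * 20)"
  proof (rule sum_mono)
    fix k
    have "(\<Sum>q | q \<in> Q \<and> nat \<lfloor>ln (real q)\<rfloor> = k. L * (ln (real q) / real q) / (L + ln (real q))\<^sup>2) \<le>
          (\<Sum>q | q \<in> Q \<and> nat \<lfloor>ln (real q)\<rfloor> = k. L / (L + real k)\<^sup>2 * (ln (real q) / real q))"
    proof (rule sum_mono)
      fix q assume q: "q \<in> {q. q \<in> Q \<and> nat \<lfloor>ln (real q)\<rfloor> = k}"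
      have q1: "real q \<ge> 1" using Q q by (simp add: Suc_le_eq prime_gt_0_nat)
      then have l: "ln (real q) \<ge> 0" by simp
      then have "real k \<le> ln (real q)" using q by auto
      then have "(L + real k)\<^sup>2 \<le> (L + ln (real q))\<^sup>2" using L by (intro power_mono) auto
      then have "L * (ln (real q) / real q) / (L + ln (real q))\<^sup>2 \<le> L * (ln (real q) / real q) / (L + real k)\<^sup>2"
        using L l q1 by (intro divide_left_mono) (auto intro!: mult_pos_pos)
      then show "L * (ln (real q) / real q) / (L + ln (real q))\<^sup>2 \<le> L / (L + real k)\<^sup>2 * (ln (real q) / real q)"
        by (simp only: times_divide_eq_left times_divide_eq_right mult_ac)
    qed
    also have "\<dots> \<le> L / (L + real k)\<^sup>2 * 20"
      unfolding sum_distrib_left[symmetric] using L Q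
      by (intro mult_left_mono mertens_block[where k = k]) auto
    finally show "(\<Sum>q | q \<in> Q \<and> nat \<lfloor>ln (real q)\<rfloor> = k. L * (ln (real q) / real q) / (L + ln (real q))\<^sup>2)
       \<le> L / (L + real k)\<^sup>2 * 20" .
  qed
  also have "\<dots> = 20 * L * (\<Sum>k\<le>K. 1 / (L + real k)\<^sup>2)" by (simp add: sum_distrib_left mult.commute)
  also have "\<dots> \<le> 20 * L * (1 / L\<^sup>2 + 1 / L)"
    using L by (intro mult_left_mono sum_inverse_square_shift_le) auto
  also have "\<dots> = 20 * (1 / L) + 20" using L by (simp add: field_simps power2_eq_square)
  also have "1 / L \<le> 2" using L by (simp add: field_simps)
  finally show 1: "(\<Sum>q\<in>Q. theta (p, q) / real q) \<le> 60" by simp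
  have "1 \<notin> Q" using Q(2)[of 1] by auto
  then have "(\<Sum>q\<in>Q. theta (q, p) / real q) = (\<Sum>q\<in>Q. theta (p, q) / real q)"
    using p by (intro sum.cong refl) (auto simp: theta_def add.commute mult.commute)
  then show "(\<Sum>q\<in>Q. theta (q, p) / real q) \<le> 60" using 1 by simp
qed

section \<open>A weighted Turan-Kubilius inequality\<close>

text \<open>The argument is real because averages are compared at points such as
  \<open>x * exp (- s)\<close>. Dividing by x, not by its floor, makes the rescaling in
  \<open>avg_multiples\<close> an exact identity.\<close>

definition avg :: "(nat \<Rightarrow> complex) \<Rightarrow> real \<Rightarrow> complex" where
  "avg f x = (\<Sum>n=1..nat \<lfloor>x\<rfloor>. f n) / of_real x"

lemma sum_multiples:
  fixes f :: "nat \<Rightarrow> 'b::comm_monoid_add"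
  assumes "q \<ge> 1"
  shows "(\<Sum>n | n \<in> {1..N} \<and> q dvd n. f n) = (\<Sum>m=1..N div q. f (q * m))"
proof (rule sum.reindex_bij_witness[of _ "\<lambda>m. q * m" "\<lambda>n. n div q"])
  fix n assume "n \<in> {n. n \<in> {1..N} \<and> q dvd n}"
  then obtain m where m: "n = q * m" "1 \<le> n" "n \<le> N" by auto
  then have "m \<ge> 1" by (cases m) auto
  moreover have "m \<le> N div q" using m assms by (simp add: less_eq_div_iff_mult_less_eq mult.commute)
  ultimately show "n div q \<in> {1..N div q}" using m assms by simp
next
  fix m assume m: "m \<in> {1..N div q}"
  then have "q * m \<le> N" using assms by (simp add: less_eq_div_iff_mult_less_eq mult.commute)
  moreover have "q * m \<ge> 1" using m assms by (simp add: Suc_le_eq)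
  ultimately show "q * m \<in> {n. n \<in> {1..N} \<and> q dvd n}" by simp
qed (use assms in auto)

lemma card_multiples:
  assumes "q \<ge> 1"
  shows "card {n \<in> {1..N}. q dvd n} = N div q"
  using sum_multiples[OF assms, of "\<lambda>_. 1::nat" N] by simp

lemma avg_multiples:
  assumes "q \<ge> 1" "x > 0"
  shows "avg (\<lambda>m. f (q * m)) (x / real q) / of_nat q = (\<Sum>n | n \<in> {1..nat \<lfloor>x\<rfloor>} \<and> q dvd n. f n) / of_real x"
proof -
  have "nat \<lfloor>x / real q\<rfloor> = nat \<lfloor>x\<rfloor> div q"
    using assms by (metis floor_divide_real_eq_div nat_div_as_int floor_of_nat less_imp_le nat_int zero_le_floor of_nat_0_le_iff nat_div_distrib zero_le of_int_of_nat_eq)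
  then show ?thesis using assms unfolding avg_def sum_multiples[OF assms(1)] by (simp add: field_simps)
qed

text \<open>The difference is the mean of \<open>f n * w n\<close>, where \<open>w n\<close> is 1
  minus the sum of the \<open>lam i\<close> with \<open>q i\<close> dividing n. Cauchy-Schwarz
  removes f, so the bound is uniform in f. In the second moment of w the products of
  \<open>lam i / q i\<close> and \<open>lam j / q j\<close> add up to x and cancel against the first
  moment; what remains is E, from pairs with a common factor, and the rounding errors.\<close>

lemma weighted_turan_kubilius:
  fixes lam :: "'i \<Rightarrow> real" and q :: "'i \<Rightarrow> nat"
  assumes fin: "finite I" and q: "\<And>i. i \<in> I \<Longrightarrow> q i \<ge> 1" and lam: "\<And>i. i \<in> I \<Longrightarrow> lam i \<ge> 0"
    and one: "(\<Sum>i\<in>I. lam i / real (q i)) = 1"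
    and f: "\<And>n. n \<ge> 1 \<Longrightarrow> cmod (f n) \<le> 1" and x: "x \<ge> 1"
    and E: "(\<Sum>i\<in>I. \<Sum>j\<in>I. if coprime (q i) (q j) then 0 else lam i * lam j / real (lcm (q i) (q j))) \<le> E"
  shows "cmod (avg f x - (\<Sum>i\<in>I. of_real (lam i / real (q i)) * avg (\<lambda>m. f (q i * m)) (x / real (q i))))
     \<le> sqrt (E + 2 * (\<Sum>i\<in>I. lam i) / x)"
proof -
  define N where "N = nat \<lfloor>x\<rfloor>"
  have N: "real N \<le> x" "x < real N + 1" using x unfolding N_def by linarith+
  define w where "w n = 1 - (\<Sum>i\<in>I. if q i dvd n then lam i else 0)" for n
  define T where "T = avg f x - (\<Sum>i\<in>I. of_real (lam i / real (q i)) * avg (\<lambda>m. f (q i * m)) (x / real (q i)))"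
  have "(\<Sum>i\<in>I. of_real (lam i / real (q i)) * avg (\<lambda>m. f (q i * m)) (x / real (q i))) =
      (\<Sum>i\<in>I. of_real (lam i) * ((\<Sum>n=1..N. if q i dvd n then f n else 0) / of_real x))"
  proof (rule sum.cong[OF refl])
    fix i assume i: "i \<in> I"
    have "(\<Sum>n=1..N. if q i dvd n then f n else 0) = (\<Sum>n | n \<in> {1..N} \<and> q i dvd n. f n)"
      by (subst sum.inter_filter[symmetric]) auto
    then have "avg (\<lambda>m. f (q i * m)) (x / real (q i)) / of_nat (q i) =
        (\<Sum>n=1..N. if q i dvd n then f n else 0) / of_real x"
      using avg_multiples[OF q[OF i], of x f] x by (simp add: N_def)
    then show "of_real (lam i / real (q i)) * avg (\<lambda>m. f (q i * m)) (x / real (q i)) =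
        of_real (lam i) * ((\<Sum>n=1..N. if q i dvd n then f n else 0) / of_real x)"
      by (metis (no_types, lifting) of_real_divide of_real_of_nat_eq times_divide_eq_left times_divide_eq_right)
  qed
  also have "\<dots> = (\<Sum>n=1..N. f n * of_real (\<Sum>i\<in>I. if q i dvd n then lam i else 0)) / of_real x"
    by (simp add: sum_distrib_left sum_divide_distrib if_distrib[of of_real] if_distrib[of "\<lambda>y. _ * y"]
        if_distrib[of "\<lambda>y. y / _"] mult.commute cong: if_cong) (subst sum.swap, rule refl)
  finally have "T = (\<Sum>n=1..N. f n * of_real (w n)) / of_real x"
    by (simp add: T_def avg_def N_def w_def algebra_simps sum_subtractf diff_divide_distrib)
  then have "cmod T * x = cmod (\<Sum>n=1..N. f n * of_real (w n))"
    using x by (simp add: norm_divide)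
  also have "\<dots> \<le> (\<Sum>n=1..N. \<bar>w n\<bar>)"
  proof (rule sum_norm_le)
    fix n assume "n \<in> {1..N}"
    then show "norm (f n * of_real (w n)) \<le> \<bar>w n\<bar>"
      using f[of n] by (simp add: norm_mult mult_left_le_one_le)
  qed
  finally have T: "cmod T * x \<le> (\<Sum>n=1..N. \<bar>w n\<bar>)" .
  have "(\<Sum>n=1..N. \<bar>w n\<bar>)\<^sup>2 \<le> (\<Sum>n=1..N. \<bar>w n\<bar>\<^sup>2) * real (card {1..N})"
    by (rule sum_squared_le_sum_of_squares)
  then have T2: "(\<Sum>n=1..N. \<bar>w n\<bar>)\<^sup>2 \<le> real N * (\<Sum>n=1..N. (w n)\<^sup>2)" by (simp add: mult.commute)
  define La where "La = (\<Sum>i\<in>I. lam i)"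
  have cnt: "(\<Sum>n=1..N. if q dvd n then c else 0) = c * real (N div q)" if "q \<ge> 1" for q and c :: real
  proof -
    have "(\<Sum>n=1..N. if q dvd n then c else 0) = (\<Sum>n | n \<in> {1..N} \<and> q dvd n. c)"
      by (subst sum.inter_filter[symmetric]) auto
    then show ?thesis using card_multiples[OF that, of N] by simp
  qed
  have "(\<Sum>n=1..N. (w n)\<^sup>2) = real N - 2 * (\<Sum>n=1..N. \<Sum>i\<in>I. if q i dvd n then lam i else 0)
      + (\<Sum>n=1..N. (\<Sum>i\<in>I. if q i dvd n then lam i else 0)\<^sup>2)"
    by (simp add: w_def power2_diff sum.distrib sum_subtractf sum_distrib_left)
  also have "(\<Sum>n=1..N. \<Sum>i\<in>I. if q i dvd n then lam i else 0) = (\<Sum>i\<in>I. lam i * real (N div q i))"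
    by (subst sum.swap) (intro sum.cong refl cnt q)
  finally have W1: "(\<Sum>n=1..N. (w n)\<^sup>2) = real N - 2 * (\<Sum>i\<in>I. lam i * real (N div q i))
      + (\<Sum>n=1..N. (\<Sum>i\<in>I. if q i dvd n then lam i else 0)\<^sup>2)" .
  \<comment> \<open>Replacing \<open>N div q i\<close> by x / q i costs at most \<open>lam i\<close>
    for each i, which is the origin of the term 2 La / x.\<close>
  have W2: "(\<Sum>i\<in>I. lam i * real (N div q i)) \<ge> x - La"
  proof -
    have "x - La = (\<Sum>i\<in>I. lam i * (x / real (q i) - 1))"
    proof -
      have "(\<Sum>i\<in>I. lam i * (x / real (q i) - 1)) = x * (\<Sum>i\<in>I. lam i / real (q i)) - La"
        by (simp add: La_def sum_distrib_left sum_subtractf algebra_simps)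
      then show ?thesis using one by simp
    qed
    also have "\<dots> \<le> (\<Sum>i\<in>I. lam i * real (N div q i))"
    proof (intro sum_mono mult_left_mono lam)
      fix i assume i: "i \<in> I"
      have "N < (N div q i + 1) * q i" using q[OF i] by (metis Suc_eq_plus1 div_less_iff_less_mult lessI less_le_trans less_numeral_extra(1))
      then have "N + 1 \<le> (N div q i + 1) * q i" by simp
      then have "real (N + 1) \<le> real ((N div q i + 1) * q i)" by (simp only: of_nat_le_iff)
      then have "x \<le> (real (N div q i) + 1) * real (q i)" using N(2) by (simp add: algebra_simps)
      then show "x / real (q i) - 1 \<le> real (N div q i)" using q[OF i] by (simp add: field_simps)
    qed
    finally show ?thesis .
  qed
  have W3: "(\<Sum>n=1..N. (\<Sum>i\<in>I. if q i dvd n then lam i else 0)\<^sup>2) \<le> x * (1 + E)"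
  proof -
    have "(\<Sum>n=1..N. (\<Sum>i\<in>I. if q i dvd n then lam i else 0)\<^sup>2) =
        (\<Sum>n=1..N. \<Sum>i\<in>I. \<Sum>j\<in>I. if lcm (q i) (q j) dvd n then lam i * lam j else 0)"
      by (simp add: power2_eq_square sum_product) (intro sum.cong refl, auto)
    also have "\<dots> = (\<Sum>i\<in>I. \<Sum>j\<in>I. \<Sum>n=1..N. if lcm (q i) (q j) dvd n then lam i * lam j else 0)"
      by (subst sum.swap) (intro sum.cong refl sum.swap)
    also have "\<dots> = (\<Sum>i\<in>I. \<Sum>j\<in>I. lam i * lam j * real (N div lcm (q i) (q j)))"
    proof (intro sum.cong refl cnt)
      fix i j assume "i \<in> I" "j \<in> I"
      then have "q i \<noteq> 0" "q j \<noteq> 0" using q by (metis not_one_le_zero)+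
      then show "lcm (q i) (q j) \<ge> 1" by (simp add: Suc_le_eq lcm_pos_nat)
    qed
    also have "\<dots> \<le> (\<Sum>i\<in>I. \<Sum>j\<in>I. x * ((lam i / real (q i)) * (lam j / real (q j)) +
        (if coprime (q i) (q j) then 0 else lam i * lam j / real (lcm (q i) (q j)))))"
    proof (intro sum_mono)
      fix i j assume ij: "i \<in> I" "j \<in> I"
      have l0: "lam i * lam j \<ge> 0" using ij lam by simp
      have "real (N div lcm (q i) (q j)) \<le> real N / real (lcm (q i) (q j))"
        by (rule of_nat_div_le_of_nat)
      also have "\<dots> \<le> x / real (lcm (q i) (q j))" using N by (intro divide_right_mono) auto
      finally have "lam i * lam j * real (N div lcm (q i) (q j)) \<le> lam i * lam j * (x / real (lcm (q i) (q j)))"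
        using l0 by (intro mult_left_mono)
      also have "\<dots> \<le> x * ((lam i / real (q i)) * (lam j / real (q j)) +
        (if coprime (q i) (q j) then 0 else lam i * lam j / real (lcm (q i) (q j))))"
      proof (cases "coprime (q i) (q j)")
        case True
        then have "lcm (q i) (q j) = q i * q j" by (simp add: lcm_coprime)
        then show ?thesis using True by (simp add: mult_ac)
      next
        case False
        have "0 \<le> x * ((lam i / real (q i)) * (lam j / real (q j)))"
          using ij lam x by (intro mult_nonneg_nonneg divide_nonneg_nonneg) auto
        then show ?thesis using False by (simp add: distrib_left mult_ac)
      qed
      finally show "lam i * lam j * real (N div lcm (q i) (q j)) \<le> x * ((lam i / real (q i)) * (lam j / real (q j)) +
        (if coprime (q i) (q j) then 0 else lam i * lam j / real (lcm (q i) (q j))))" .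
    qed
    also have "\<dots> = x * ((\<Sum>i\<in>I. lam i / real (q i)) * (\<Sum>j\<in>I. lam j / real (q j)) +
        (\<Sum>i\<in>I. \<Sum>j\<in>I. if coprime (q i) (q j) then 0 else lam i * lam j / real (lcm (q i) (q j))))"
      by (subst sum_product) (simp only: sum_distrib_left sum.distrib distrib_left)
    also have "\<dots> \<le> x * (1 + E)" unfolding one using E x by (intro mult_left_mono) auto
    finally show ?thesis .
  qed
  have "(\<Sum>n=1..N. (w n)\<^sup>2) \<le> real N - 2 * (x - La) + x * (1 + E)"
  proof -
    have "a \<le> n - 2 * l + e" if "a = n - 2 * b + c" "l \<le> b" "c \<le> e" for a b c e l n :: real
      using that by linarith
    from this[OF W1 W2 W3] show ?thesis .
  qed
  also have "\<dots> \<le> x * (E + 2 * La / x)" using N x by (simp add: field_simps)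
  finally have W: "(\<Sum>n=1..N. (w n)\<^sup>2) \<le> x * (E + 2 * La / x)" .
  have W0: "0 \<le> (\<Sum>n=1..N. (w n)\<^sup>2)" by (intro sum_nonneg) auto
  have "(cmod T * x)\<^sup>2 \<le> (\<Sum>n=1..N. \<bar>w n\<bar>)\<^sup>2" using T x by (intro power_mono) auto
  also have "\<dots> \<le> x * (x * (E + 2 * La / x))"
    using T2 W W0 N x by (intro order_trans[OF T2] mult_mono) auto
  finally have "(cmod T)\<^sup>2 \<le> E + 2 * La / x"
    using x by (simp add: power2_eq_square mult_ac)
  then show ?thesis unfolding T_def[symmetric] La_def[symmetric] by (rule real_le_rsqrt)
qed

lemma avg_Lipschitz:
  assumes f: "\<And>n. n \<ge> 1 \<Longrightarrow> cmod (f n) \<le> 1" and x: "0 < x" "x \<le> y"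
  shows "cmod (avg f x - avg f y) \<le> (2 * (y - x) + 1) / y"
proof -
  define M where "M = nat \<lfloor>x\<rfloor>"
  define N where "N = nat \<lfloor>y\<rfloor>"
  have MN: "M \<le> N" "real M \<le> x" "real N - real M \<le> y - x + 1" using x unfolding M_def N_def by linarith+
  define A where "A = (\<Sum>n=1..M. f n)"
  define B where "B = (\<Sum>n=M+1..N. f n)"
  have "(\<Sum>n=1..N. f n) = A + B"
    using sum.ub_add_nat[of 1 M f "N - M"] MN by (simp add: A_def B_def)
  then have "avg f x - avg f y = A * of_real (1 / x - 1 / y) - B / of_real y"
    by (simp add: avg_def A_def M_def N_def algebra_simps add_divide_distrib)
  then have "cmod (avg f x - avg f y) \<le> cmod A * \<bar>1 / x - 1 / y\<bar> + cmod B / y"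
    using x norm_triangle_ineq4[of "A * of_real (1 / x - 1 / y)" "B / of_real y"]
    by (simp only: norm_mult norm_of_real norm_divide)
  moreover have "cmod A \<le> x"
  proof -
    have "cmod A \<le> (\<Sum>n=1..M. 1)" unfolding A_def using f by (intro sum_norm_le) auto
    then show ?thesis using MN by simp
  qed
  moreover have "cmod B \<le> y - x + 1"
  proof -
    have "cmod B \<le> (\<Sum>n=M+1..N. 1)" unfolding B_def using f by (intro sum_norm_le) auto
    then show ?thesis using MN by (simp add: of_nat_diff)
  qed
  moreover have "\<bar>1 / x - 1 / y\<bar> = (y - x) / (x * y)" using x by (simp add: field_simps)
  ultimately have "cmod (avg f x - avg f y) \<le> x * ((y - x) / (x * y)) + (y - x + 1) / y"
    using x by (smt (verit, ccfv_SIG) divide_nonneg_nonneg divide_right_mono mult_nonneg_nonneg mult_right_mono)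
  also have "\<dots> = (2 * (y - x) + 1) / y" using x by (simp add: field_simps)
  finally show ?thesis .
qed

section \<open>Correlations between weighted prime pairs\<close>

lemma theta_1 [simp]: "theta (p, Suc 0) = 1"
  by (simp add: theta_def)

text \<open>The shared prime s factors out of the lcm, and the cofactors u and t are then equal or
  coprime; the two summands cover the two cases.\<close>

lemma lcm_prime_pair_inverse:
  fixes s u t :: nat
  assumes "prime s" "u = 1 \<or> prime u" "prime t"
  shows "1 / real (lcm (s * u) (s * t)) \<le> (1 / real (s * u)) * ((if t = u then 1 else 0) + 1 / real t)"
proof (cases "t = u")
  case True
  then show ?thesis by (simp add: divide_right_mono)
next
  case False
  have "coprime u t" using assms False by (auto simp: primes_coprime)
  then have "lcm (s * u) (s * t) = s * (u * t)" by (simp add: lcm_mult_left lcm_coprime)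
  then show ?thesis using False by simp
qed

text \<open>A pair whose product is divisible by s has the form (s, 1), (s, t) or (t, s). The first
  contributes 1 and each of the two families 61, namely 1 from t = u and 60 from
  \<open>sum_theta_le\<close>. With constant weights in place of \<open>theta\<close> the sum over t
  would be unbounded.\<close>

lemma sum_shared_prime_le:
  assumes I: "finite I" "I \<subseteq> prime_pairs" and s: "prime s" and u: "u = 1 \<or> prime u"
    and lam: "\<And>i. i \<in> I \<Longrightarrow> 0 \<le> lam i \<and> lam i \<le> \<kappa> * theta i" and k: "\<kappa> \<ge> 0"
  shows "(\<Sum>j | j \<in> I \<and> s dvd pprod j. lam j / real (lcm (s * u) (pprod j))) \<le> 123 * \<kappa> / real (s * u)"
proof -
  define Q where "Q = {t \<in> fst ` I \<union> snd ` I. prime t}"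
  have Q: "finite Q" "\<And>t. t \<in> Q \<Longrightarrow> prime t" using I by (auto simp: Q_def)
  define g where "g = (\<lambda>j. \<kappa> * theta j / real (lcm (s * u) (pprod j)))"
  have g0: "g j \<ge> 0" if "j \<in> prime_pairs" for j using k theta_nonneg[OF that] by (simp add: g_def)
  have half: "(\<Sum>t\<in>Q. g (h t)) \<le> 61 * \<kappa> / real (s * u)"
    if h: "\<And>t. t \<in> Q \<Longrightarrow> h t \<in> prime_pairs" "\<And>t. t \<in> Q \<Longrightarrow> pprod (h t) = s * t"
      and th: "(\<Sum>t\<in>Q. theta (h t) / real t) \<le> 60" for h
  proof -
    have "(\<Sum>t\<in>Q. g (h t)) \<le> (\<Sum>t\<in>Q. \<kappa> / real (s * u) * ((if t = u then 1 else 0) + theta (h t) / real t))"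
    proof (rule sum_mono)
      fix t assume t: "t \<in> Q"
      have th: "0 \<le> theta (h t)" "theta (h t) \<le> 1"
        using h(1)[OF t] by (auto intro: theta_nonneg theta_le_1)
      have "g (h t) = \<kappa> * theta (h t) * (1 / real (lcm (s * u) (s * t)))" by (simp only: g_def h(2)[OF t]) simp
      also have "\<dots> \<le> \<kappa> * theta (h t) * ((1 / real (s * u)) * ((if t = u then 1 else 0) + 1 / real t))"
        using th k s u t Q by (intro mult_left_mono lcm_prime_pair_inverse) auto
      also have "\<dots> = \<kappa> / real (s * u) * ((if t = u then theta (h t) else 0) + theta (h t) / real t)"
        by (simp add: distrib_left)
      also have "\<dots> \<le> \<kappa> / real (s * u) * ((if t = u then 1 else 0) + theta (h t) / real t)"
        using th k by (intro mult_left_mono) auto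
      finally show "g (h t) \<le> \<kappa> / real (s * u) * ((if t = u then 1 else 0) + theta (h t) / real t)" .
    qed
    also have "\<dots> = \<kappa> / real (s * u) * ((\<Sum>t\<in>Q. if t = u then 1 else 0) + (\<Sum>t\<in>Q. theta (h t) / real t))"
      by (simp only: sum_distrib_left[symmetric] sum.distrib)
    also have "\<dots> \<le> \<kappa> / real (s * u) * (1 + 60)"
      using th Q(1) k by (intro mult_left_mono add_mono) (auto simp: sum.delta')
    finally show ?thesis by (simp add: mult.commute)
  qed
  define A where "A = (\<lambda>t. (s, t)) ` Q"
  define B where "B = (\<lambda>t. (t, s)) ` Q"
  have AB: "A \<union> B \<subseteq> prime_pairs" using s Q by (auto simp: A_def B_def prime_pairs_def)
  have s1: "(s, 1) \<in> prime_pairs" using s by (auto simp: prime_pairs_def)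
  have sub: "{j. j \<in> I \<and> s dvd pprod j} \<subseteq> {(s,1)} \<union> (A \<union> B)"
  proof
    fix j assume j: "j \<in> {j. j \<in> I \<and> s dvd pprod j}"
    obtain a b where ab: "j = (a, b)" by fastforce
    have p: "prime a" "b = 1 \<or> prime b" using j I by (auto simp: ab prime_pairs_def)
    have mem: "a \<in> fst ` I \<union> snd ` I" "b \<in> fst ` I \<union> snd ` I" using j by (force simp: ab)+
    have "s dvd a \<or> s dvd b" using j s by (simp add: ab prime_dvd_mult_iff)
    then have "s = a \<or> (s = b \<and> prime b)"
      using p s by (metis nat_dvd_1_iff_1 not_prime_1 primes_dvd_imp_eq)
    then show "j \<in> {(s,1)} \<union> (A \<union> B)"
      using p mem by (auto simp: ab A_def B_def Q_def)
  qed
  have "(\<Sum>j | j \<in> I \<and> s dvd pprod j. lam j / real (lcm (s * u) (pprod j))) \<le> (\<Sum>j | j \<in> I \<and> s dvd pprod j. g j)"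
    using lam by (intro sum_mono) (auto simp: g_def intro!: divide_right_mono)
  also have "\<dots> \<le> (\<Sum>j\<in>{(s,1)} \<union> (A \<union> B). g j)"
    using sub AB s1 Q g0 by (intro sum_mono2) (auto simp: A_def B_def)
  also have "\<dots> \<le> g (s, 1) + (sum g A + sum g B)"
  proof -
    have un: "sum g (X \<union> Y) \<le> sum g X + sum g Y" if "finite X" "finite Y" "X \<subseteq> prime_pairs" for X Y
      using sum.union_inter[OF that(1,2), of g] sum_nonneg[of "X \<inter> Y" g] g0 that(3) by force
    have "finite A" "finite B" using Q by (auto simp: A_def B_def)
    then show ?thesis using un[of "{(s,1)}" "A \<union> B"] un[of A B] AB s1 by auto
  qed
  also have "g (s, 1) = \<kappa> / real (s * u)" by (simp add: g_def)
  also have "sum g A \<le> 61 * \<kappa> / real (s * u)"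
    unfolding A_def by (subst sum.reindex) (use half[of "Pair s"] Q s sum_theta_le(1)[OF s Q] in
      \<open>auto simp: inj_on_def prime_pairs_def\<close>)
  also have "sum g B \<le> 61 * \<kappa> / real (s * u)"
    unfolding B_def by (subst sum.reindex) (use half[of "\<lambda>t. (t, s)"] Q s sum_theta_le(2)[OF s Q] in
      \<open>auto simp: inj_on_def prime_pairs_def\<close>)
  finally show ?thesis by (simp add: add_divide_distrib)
qed

text \<open>A pair not coprime to i shares one of the at most two primes of i, each costing 123. The
  bound is proportional to \<kappa>, so spreading a total weight of 1 over many pairs makes the
  correlations small.\<close>

lemma prime_pairs_correlation_le:
  assumes I: "finite I" "I \<subseteq> prime_pairs"
    and lam: "\<And>i. i \<in> I \<Longrightarrow> 0 \<le> lam i \<and> lam i \<le> \<kappa> * theta i" and k: "\<kappa> \<ge> 0"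
    and one: "(\<Sum>i\<in>I. lam i / real (pprod i)) = 1"
  shows "(\<Sum>i\<in>I. \<Sum>j\<in>I. if coprime (pprod i) (pprod j) then 0
            else lam i * lam j / real (lcm (pprod i) (pprod j))) \<le> 246 * \<kappa>"
proof -
  have "(\<Sum>j\<in>I. if coprime (pprod i) (pprod j) then 0 else lam i * lam j / real (lcm (pprod i) (pprod j)))
      \<le> 246 * \<kappa> * (lam i / real (pprod i))" if i: "i \<in> I" for i
  proof -
    obtain p r where pr: "i = (p, r)" by fastforce
    have P: "prime p" "r = 1 \<or> prime r" using i I by (auto simp: pr prime_pairs_def)
    define h where "h = (\<lambda>j. lam j / real (lcm (p * r) (pprod j)))"
    have h0: "h j \<ge> 0" if "j \<in> I" for j using lam[OF that] by (simp add: h_def)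
    define J where "J = {j. j \<in> I \<and> p dvd pprod j}"
    \<comment> \<open>For r = 1 the second prime is absent, and divisibility by r would select all
      of \<open>I\<close>.\<close>
    define J' where "J' = (if r = 1 then {} else {j. j \<in> I \<and> r dvd pprod j})"
    have fin: "finite J" "finite J'" using I by (auto simp: J_def J'_def)
    have JI: "J \<subseteq> I" "J' \<subseteq> I" by (auto simp: J_def J'_def)
    have "(\<Sum>j\<in>I. if coprime (pprod i) (pprod j) then 0 else h j) = (\<Sum>j | j \<in> I \<and> \<not> coprime (p * r) (pprod j). h j)"
      using I by (subst sum.inter_filter) (auto intro!: sum.cong simp: pr)
    also have "\<dots> \<le> (\<Sum>j\<in>J \<union> J'. h j)"
    proof (rule sum_mono2)
      show "{j. j \<in> I \<and> \<not> coprime (p * r) (pprod j)} \<subseteq> J \<union> J'"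
      proof
        fix j assume j: "j \<in> {j. j \<in> I \<and> \<not> coprime (p * r) (pprod j)}"
        then have "gcd (p * r) (pprod j) \<noteq> 1" unfolding coprime_iff_gcd_eq_1 by (elim CollectE conjE)
        then obtain s where s: "prime s" "s dvd gcd (p * r) (pprod j)" using prime_factor_nat by blast
        from s(2) have "s dvd p * r" "s dvd pprod j" by (auto simp only: gcd_greatest_iff)
        from s(1) this(1) have "s dvd p \<or> s dvd r" by (simp only: prime_dvd_mult_iff)
        then have "p dvd pprod j \<or> (r \<noteq> 1 \<and> r dvd pprod j)"
        proof
          assume "s dvd p"
          then have "s = p" using s(1) P(1) primes_dvd_imp_eq by blast
          then show ?thesis using \<open>s dvd pprod j\<close> by simp
        next
          assume "s dvd r"
          moreover have "r \<noteq> 1" using \<open>s dvd r\<close> s(1) by auto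
          ultimately have "s = r" using s(1) P(2) primes_dvd_imp_eq by blast
          then show ?thesis using \<open>s dvd pprod j\<close> \<open>r \<noteq> 1\<close> by simp
        qed
        then show "j \<in> J \<union> J'" using j by (auto simp: J_def J'_def)
      qed
    qed (use fin JI h0 in auto)
    also have "\<dots> \<le> sum h J + sum h J'"
    proof -
      have "0 \<le> sum h (J \<inter> J')" using h0 JI by (intro sum_nonneg) blast
      then show ?thesis using sum.union_inter[OF fin, of h] by linarith
    qed
    also have "sum h J \<le> 123 * \<kappa> / real (p * r)"
      unfolding J_def h_def using sum_shared_prime_le[OF I P lam k] by simp
    also have "sum h J' \<le> 123 * \<kappa> / real (p * r)"
    proof (cases "r = 1")
      case True
      then show ?thesis using k by (simp add: J'_def)
    next
      case False
      then have "prime r" using P by simp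
      then show ?thesis using False P sum_shared_prime_le[OF I \<open>prime r\<close> disjI2[OF P(1)] lam k]
        by (simp add: J'_def h_def mult.commute[of r p])
    qed
    finally have "(\<Sum>j\<in>I. if coprime (pprod i) (pprod j) then 0 else h j) \<le> 246 * \<kappa> / real (pprod i)"
      by (simp add: pr)
    then have "lam i * (\<Sum>j\<in>I. if coprime (pprod i) (pprod j) then 0 else h j) \<le> lam i * (246 * \<kappa> / real (pprod i))"
      using lam[OF i] by (intro mult_left_mono) auto
    moreover have "lam i * (\<Sum>j\<in>I. if coprime (pprod i) (pprod j) then 0 else h j) =
      (\<Sum>j\<in>I. if coprime (pprod i) (pprod j) then 0 else lam i * lam j / real (lcm (pprod i) (pprod j)))"
      unfolding sum_distrib_left by (intro sum.cong refl) (auto simp: h_def pr)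
    ultimately show ?thesis by (simp add: mult_ac)
  qed
  then have "(\<Sum>i\<in>I. \<Sum>j\<in>I. if coprime (pprod i) (pprod j) then 0
            else lam i * lam j / real (lcm (pprod i) (pprod j))) \<le> (\<Sum>i\<in>I. 246 * \<kappa> * (lam i / real (pprod i)))"
    by (intro sum_mono)
  then show ?thesis by (simp only: sum_distrib_left[symmetric] one mult_1_right)
qed

section \<open>Averages of functions of coloured prime factorizations\<close>

text \<open>Phrased through finite subsets because this is how divergence is used: it supplies a
  finite set of primes or windows of large total weight.\<close>

definition diverges :: "('i \<Rightarrow> real) \<Rightarrow> 'i set \<Rightarrow> bool" where
  "diverges w A \<longleftrightarrow> (\<forall>B. \<exists>J\<subseteq>A. finite J \<and> sum w J \<ge> B)"

lemma diverges_pigeonhole: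
  assumes "diverges w A" "finite (f ` A)"
  shows "\<exists>t\<in>f ` A. diverges w {x\<in>A. f x = t}"
proof (rule ccontr)
  assume "\<not> ?thesis"
  then have "\<forall>t\<in>f ` A. \<exists>B. \<forall>J\<subseteq>{x\<in>A. f x = t}. finite J \<longrightarrow> sum w J < B"
    unfolding diverges_def by (meson not_le)
  then obtain B where B: "\<And>t J. t \<in> f ` A \<Longrightarrow> J \<subseteq> {x\<in>A. f x = t} \<Longrightarrow> finite J \<Longrightarrow> sum w J < B t"
    by metis
  obtain J where J: "J \<subseteq> A" "finite J" "sum w J \<ge> (\<Sum>t\<in>f ` A. B t) + 1"
    using assms(1) unfolding diverges_def by blast
  have "sum w J = (\<Sum>t\<in>f ` A. sum w {x\<in>J. f x = t})"
    using J assms(2) by (subst sum.group) auto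
  also have "\<dots> \<le> (\<Sum>t\<in>f ` A. B t)"
  proof (rule sum_mono)
    fix t assume "t \<in> f ` A"
    then show "sum w {x\<in>J. f x = t} \<le> B t" using J by (intro less_imp_le[OF B]) auto
  qed
  finally show False using J by linarith
qed

lemma diverges_reciprocals: "diverges (\<lambda>j. 1 / real j) {n0..}"
  unfolding diverges_def
proof
  fix B :: real
  have "eventually (\<lambda>N. harm N \<ge> B + harm n0 \<and> N \<ge> n0) sequentially"
    using harm_at_top unfolding filterlim_at_top by (intro eventually_conj eventually_ge_at_top) auto
  then obtain N where N: "harm N \<ge> B + harm n0" "N \<ge> n0"
    using eventually_happens'[OF sequentially_bot] by blast
  have "harm N = harm n0 + (\<Sum>j=n0+1..N. 1 / real j)"
    using sum.ub_add_nat[of 1 n0 "\<lambda>j. 1 / real j" "N - n0"] N(2) by (simp add: harm_def inverse_eq_divide)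
  then have "(\<Sum>j=n0+1..N. 1 / real j) \<ge> B" using N by linarith
  then show "\<exists>J\<subseteq>{n0..}. finite J \<and> B \<le> (\<Sum>j\<in>J. 1 / real j)"
    by (intro exI[of _ "{n0+1..N}"]) auto
qed

lemma eventually_at_top_scale:
  assumes "eventually P at_top" "c > 0"
  shows "eventually (\<lambda>x::real. P (x * c)) at_top"
proof -
  obtain N where N: "\<And>x. x \<ge> N \<Longrightarrow> P x" using assms(1) by (auto simp: eventually_at_top_linorder)
  have "P (x * c)" if "x \<ge> N / c" for x using that assms(2) by (intro N) (simp add: field_simps)
  then show ?thesis by (auto simp: eventually_at_top_linorder)
qed

lemma avg_cong: "(\<And>n. n \<ge> 1 \<Longrightarrow> f n = g n) \<Longrightarrow> avg f x = avg g x"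
  by (simp add: avg_def)

lemma avg_exp_shift:
  assumes f: "\<And>n. n \<ge> 1 \<Longrightarrow> cmod (f n) \<le> 1" and y: "y > 0" and h: "0 \<le> h" "h \<le> d"
  shows "cmod (avg f (y * exp (- h)) - avg f y) \<le> 2 * d + 1 / y"
proof -
  have e: "1 - h \<le> exp (- h)" using exp_ge_add_one_self[of "- h"] by simp
  have "cmod (avg f (y * exp (- h)) - avg f y) \<le> (2 * (y - y * exp (- h)) + 1) / y"
    using y h by (intro avg_Lipschitz f) auto
  also have "\<dots> = 2 * (1 - exp (- h)) + 1 / y" using y by (simp add: field_simps)
  also have "\<dots> \<le> 2 * d + 1 / y" using e h by (intro add_right_mono) simp
  finally show ?thesis .
qed

text \<open>\<open>None\<close> marks a single prime. Pairs of equal colour have primes of matching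
  colours in each position, so a function that only sees colours cannot tell their products
  apart.\<close>

definition pcol :: "(nat \<Rightarrow> 'c) \<Rightarrow> nat \<times> nat \<Rightarrow> 'c \<times> 'c option" where
  "pcol col = (\<lambda>(p,q). (col p, if q = 1 then None else Some (col q)))"

locale prime_coloring =
  fixes col :: "nat \<Rightarrow> 'c"
  assumes finite_col: "finite (col ` {p. prime p})"
begin

text \<open>Invariance under exchanging one prime for another of its colour expresses dependence on
  the colour exponents without naming them. The class is closed under dilation and its bound is
  normalised to 1, so that estimates can be uniform over it.\<close>

definition Phi :: "(nat \<Rightarrow> complex) set" where
  "Phi = {f. (\<forall>n\<ge>1. cmod (f n) \<le> 1) \<and>
     (\<forall>p p' m. prime p \<longrightarrow> prime p' \<longrightarrow> col p = col p' \<longrightarrow> m \<ge> 1 \<longrightarrow> f (p * m) = f (p' * m))}"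

lemma Phi_norm: "f \<in> Phi \<Longrightarrow> n \<ge> 1 \<Longrightarrow> cmod (f n) \<le> 1"
  unfolding Phi_def by blast

lemma Phi_col: "f \<in> Phi \<Longrightarrow> prime p \<Longrightarrow> prime p' \<Longrightarrow> col p = col p' \<Longrightarrow> m \<ge> 1 \<Longrightarrow> f (p * m) = f (p' * m)"
  unfolding Phi_def by blast

lemma Phi_dilate:
  assumes "f \<in> Phi" "a \<ge> 1"
  shows "(\<lambda>m. f (a * m)) \<in> Phi"
proof -
  have "f (a * (p * m)) = f (a * (p' * m))"
    if "prime p" "prime p'" "col p = col p'" "m \<ge> 1" for p p' m
    using Phi_col[OF assms(1) that(1-3), of "a * m"] that(4) assms(2)
    by (simp add: mult.left_commute Suc_le_eq)
  moreover have "cmod (f (a * n)) \<le> 1" if "n \<ge> 1" for n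
    using that assms by (intro Phi_norm) (auto simp: Suc_le_eq)
  ultimately show ?thesis unfolding Phi_def by blast
qed

lemma Phi_pcol:
  assumes f: "f \<in> Phi" and i: "i \<in> prime_pairs" "j \<in> prime_pairs" "pcol col i = pcol col j" and m: "m \<ge> 1"
  shows "f (pprod i * m) = f (pprod j * m)"
proof -
  obtain p q where pq: "i = (p,q)" by fastforce
  obtain p' q' where pq': "j = (p',q')" by fastforce
  have P: "prime p" "prime p'" "q = 1 \<or> prime q" "q' = 1 \<or> prime q'"
    using i by (auto simp: pq pq' prime_pairs_def)
  have c: "col p = col p'" using i(3) by (simp add: pcol_def pq pq')
  consider "q = 1" "q' = 1" | "prime q" "prime q'" "col q = col q'"
    using i(3) P by (auto simp: pcol_def pq pq' split: if_splits)
  then show ?thesis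
  proof cases
    case 1
    then show ?thesis using Phi_col[OF f P(1,2) c m] by (simp add: pq pq')
  next
    case 2
    have "q * m \<ge> 1" "p' * m \<ge> 1" using 2 P m by (auto simp: Suc_le_eq prime_gt_0_nat)
    then have "f (p * (q * m)) = f (p' * (q * m))" "f (q * (p' * m)) = f (q' * (p' * m))"
      using Phi_col[OF f P(1,2) c] Phi_col[OF f 2] by blast+
    then show ?thesis by (simp add: pq pq' mult.assoc mult.left_commute)
  qed
qed

abbreviation pair_colors :: "('c \<times> 'c option) set" where
  "pair_colors \<equiv> pcol col ` prime_pairs"

lemma finite_pair_colors: "finite pair_colors"
proof (rule finite_subset)
  show "pair_colors \<subseteq> (col ` {p. prime p}) \<times> insert None (Some ` (col ` {p. prime p}))"
  proof
    fix z assume "z \<in> pair_colors"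
    then obtain p q where "z = pcol col (p, q)" "prime p" "q = 1 \<or> prime q"
      by (auto simp: prime_pairs_def)
    then show "z \<in> (col ` {p. prime p}) \<times> insert None (Some ` (col ` {p. prime p}))"
      by (cases "q = 1") (auto simp: pcol_def)
  qed
qed (use finite_col in auto)

lemma pair_colors_nonempty: "pair_colors \<noteq> {}"
proof -
  have "(2, 1) \<in> prime_pairs" by (simp add: prime_pairs_def two_is_prime_nat)
  then show ?thesis by blast
qed

text \<open>Window j + t receives the total weight (1 / j) / M, whatever t is. The Turan-Kubilius
  inequality at \<open>x * exp (d * t)\<close> therefore leads to the same combination of averages
  at the points \<open>x * exp (- (d * j))\<close> for every t, and two values of t can be compared.
  In the error, 246 \<kappa> / M comes from shared primes, d^2 from rounding and 3 d from the width
  of the windows.\<close>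

lemma window_average:
  assumes d: "0 < d" "d \<le> 1" and J: "finite J" "\<And>j. j \<in> J \<Longrightarrow> j \<ge> 1" and k: "\<kappa> \<ge> 0"
    and M: "M = (\<Sum>j\<in>J. 1 / real j)" "M > 0" and i0: "i0 \<in> prime_pairs"
    and mass: "\<And>j. j \<in> J \<Longrightarrow>
      1 / real j \<le> \<kappa> * (\<Sum>i | i \<in> window d (j + t) \<and> pcol col i = pcol col i0. theta i / real (pprod i))"
  shows "\<forall>\<^sub>F x in at_top. \<forall>f\<in>Phi.
      cmod (avg f (x * exp (d * t)) -
         (\<Sum>j\<in>J. of_real (1 / real j / M) * avg (\<lambda>m. f (pprod i0 * m)) (x * exp (- (d * j)))))
      \<le> sqrt (246 * \<kappa> / M + d\<^sup>2) + 3 * d"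
proof -
  define B where "B j = {i. i \<in> window d (j + t) \<and> pcol col i = pcol col i0}" for j
  define W where "W j = (\<Sum>i\<in>B j. theta i / real (pprod i))" for j
  have finB: "finite (B j)" for j unfolding B_def by (rule finite_subset[OF _ finite_window]) auto
  have Bp: "i \<in> prime_pairs" if "i \<in> B j" for i j using that by (auto simp: B_def window_def)
  have qpos: "pprod i \<ge> 1" if "i \<in> prime_pairs" for i
    using prime_pairs_pos[OF that] by (auto simp: Suc_le_eq)
  have W: "W j > 0" "1 / real j / W j \<le> \<kappa>" if "j \<in> J" for j
  proof -
    have "W j \<ge> 0" unfolding W_def by (intro sum_nonneg divide_nonneg_nonneg theta_nonneg Bp) auto
    moreover have *: "1 / real j \<le> \<kappa> * W j" using mass[OF that] by (simp add: W_def B_def)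
    moreover have "1 / real j > 0" using J(2)[OF that] by simp
    ultimately show "W j > 0" by (cases "W j = 0") auto
    then show "1 / real j / W j \<le> \<kappa>" using * by (simp only: pos_divide_le_eq)
  qed
  have uniq: "j = j'" if "i \<in> B j" "i \<in> B j'" for i j j'
  proof -
    have "\<not> a < b" if "i \<in> B a" "i \<in> B b" for a b
    proof
      assume "a < b"
      then have "d * real (a + t + 1) \<le> d * real (b + t)" using d by (intro mult_left_mono) auto
      then show False using that by (auto simp: B_def window_def add_ac)
    qed
    then show ?thesis using that by (meson linorder_neqE_nat)
  qed
  define jj where "jj i = (THE j. j \<in> J \<and> i \<in> B j)" for i
  have jj: "jj i = j" if "j \<in> J" "i \<in> B j" for i j
    unfolding jj_def by (rule the_equality) (use that uniq in blast)+
  \<comment> \<open>Dividing by \<open>W (jj i)\<close> normalises the chosen colour class of each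
    window to total \<open>1 / j / M\<close>; the assumption \<open>mass\<close> then bounds
    \<open>lam i\<close> by \<kappa> / M times \<open>theta i\<close>.\<close>
  define lam where "lam i = 1 / real (jj i) / M / W (jj i) * theta i" for i
  define I where "I = (\<Union>j\<in>J. B j)"
  have finI: "finite I" using J finB by (auto simp: I_def)
  have Ip: "I \<subseteq> prime_pairs" using Bp by (auto simp: I_def)
  have sumI: "(\<Sum>i\<in>I. g i) = (\<Sum>j\<in>J. \<Sum>i\<in>B j. g i)" for g :: "nat \<times> nat \<Rightarrow> 'z::comm_monoid_add"
    unfolding I_def using J finB uniq by (intro sum.UNION_disjoint) auto
  have sumB: "(\<Sum>i\<in>B j. lam i / real (pprod i)) = 1 / real j / M" if j: "j \<in> J" for j
  proof -
    have "(\<Sum>i\<in>B j. lam i / real (pprod i)) = (\<Sum>i\<in>B j. 1 / real j / M / W j * (theta i / real (pprod i)))"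
      using jj[OF j] by (intro sum.cong refl) (simp add: lam_def)
    also have "\<dots> = 1 / real j / M / W j * W j" by (simp only: sum_distrib_left[symmetric] W_def)
    finally show ?thesis using W(1)[OF j] by simp
  qed
  have one: "(\<Sum>i\<in>I. lam i / real (pprod i)) = 1"
  proof -
    have "(\<Sum>i\<in>I. lam i / real (pprod i)) = (\<Sum>j\<in>J. 1 / real j / M)"
      unfolding sumI by (intro sum.cong refl sumB)
    also have "\<dots> = M / M" unfolding M(1) by (rule sum_divide_distrib[symmetric])
    finally show ?thesis using M(2) by simp
  qed
  have lam: "0 \<le> lam i \<and> lam i \<le> \<kappa> / M * theta i" if i: "i \<in> I" for i
  proof -
    obtain j where j: "j \<in> J" "i \<in> B j" using i by (auto simp: I_def)
    have th: "theta i \<ge> 0" using Bp[OF j(2)] by (rule theta_nonneg)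
    have "lam i = (1 / real j / W j) / M * theta i" by (simp add: lam_def jj[OF j])
    moreover have "(1 / real j / W j) / M * theta i \<le> \<kappa> / M * theta i"
      using W(2)[OF j(1)] M th by (intro mult_right_mono divide_right_mono) auto
    moreover have "0 \<le> (1 / real j / W j) / M * theta i"
      using W(1)[OF j(1)] M th by simp
    ultimately show ?thesis by simp
  qed
  have corr: "(\<Sum>i\<in>I. \<Sum>j\<in>I. if coprime (pprod i) (pprod j) then 0
            else lam i * lam j / real (lcm (pprod i) (pprod j))) \<le> 246 * (\<kappa> / M)"
    using prime_pairs_correlation_le[OF finI Ip lam _ one] k M by simp
  define La where "La = (\<Sum>i\<in>I. lam i)"
  have La: "La \<ge> 0" unfolding La_def using lam by (intro sum_nonneg) auto
  \<comment> \<open>In the threshold for x, the term with \<open>La\<close> makes the rounding error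
    at most d^2, and the sum over J makes 1 / \<open>y j\<close> at most d for every j in J.\<close>
  have "cmod (avg f (x * exp (d * t)) -
         (\<Sum>j\<in>J. of_real (1 / real j / M) * avg (\<lambda>m. f (pprod i0 * m)) (x * exp (- (d * j)))))
      \<le> sqrt (246 * \<kappa> / M + d\<^sup>2) + 3 * d"
    if x: "x \<ge> 1 + 2 * La / d\<^sup>2 + (\<Sum>j\<in>J. exp (d * j) / d)" and f: "f \<in> Phi" for x f
  proof -
    have s0: "(\<Sum>j\<in>J. exp (d * j) / d) \<ge> 0" using d by (intro sum_nonneg) auto
    have La0: "2 * La / d\<^sup>2 \<ge> 0" using La by simp
    have x1: "x \<ge> 1" "x \<ge> 2 * La / d\<^sup>2" using x s0 La0 by linarith+
    define X where "X = x * exp (d * t)"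
    have "x * 1 \<le> X" unfolding X_def using d x1 by (intro mult_left_mono) auto
    then have X: "X \<ge> x" by simp
    define S where "S = (\<Sum>i\<in>I. of_real (lam i / real (pprod i)) * avg (\<lambda>m. f (pprod i * m)) (X / real (pprod i)))"
    define y where "y j = x * exp (- (d * real j))" for j
    have "cmod (avg f X - S) \<le> sqrt (246 * (\<kappa> / M) + 2 * (\<Sum>i\<in>I. lam i) / X)"
      unfolding S_def using lam one corr X x1 f Ip qpos
      by (intro weighted_turan_kubilius finI) (auto intro: Phi_norm)
    also have "\<dots> \<le> sqrt (246 * \<kappa> / M + d\<^sup>2)"
    proof -
      have "2 * La / X \<le> 2 * La / x" using X x1 La by (intro divide_left_mono) auto
      also have "\<dots> \<le> d\<^sup>2" using x1 d by (simp add: field_simps)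
      finally show ?thesis by (simp add: La_def)
    qed
    finally have 1: "cmod (avg f X - S) \<le> sqrt (246 * \<kappa> / M + d\<^sup>2)" .
    have "(\<Sum>j\<in>J. of_real (1 / real j / M) * avg (\<lambda>m. f (pprod i0 * m)) (y j)) =
       (\<Sum>j\<in>J. \<Sum>i\<in>B j. of_real (lam i / real (pprod i)) * avg (\<lambda>m. f (pprod i0 * m)) (y j))"
      by (intro sum.cong refl) (simp only: sum_distrib_right[symmetric] of_real_sum[symmetric] sumB)
    also have "\<dots> = (\<Sum>i\<in>I. of_real (lam i / real (pprod i)) * avg (\<lambda>m. f (pprod i0 * m)) (y (jj i)))"
      unfolding sumI by (intro sum.cong refl) (simp add: jj)
    finally have "S - (\<Sum>j\<in>J. of_real (1 / real j / M) * avg (\<lambda>m. f (pprod i0 * m)) (y j)) =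
       (\<Sum>i\<in>I. of_real (lam i / real (pprod i)) *
          (avg (\<lambda>m. f (pprod i * m)) (X / real (pprod i)) - avg (\<lambda>m. f (pprod i0 * m)) (y (jj i))))"
      by (simp add: S_def sum_subtractf right_diff_distrib)
    also have "cmod \<dots> \<le> (\<Sum>i\<in>I. lam i / real (pprod i) * (3 * d))"
    proof (rule sum_norm_le)
      fix i assume i: "i \<in> I"
      then obtain j where j: "j \<in> J" "i \<in> B j" by (auto simp: I_def)
      have ip: "i \<in> prime_pairs" using Bp[OF j(2)] .
      \<comment> \<open>The position of i inside its window: X / \<open>pprod i\<close> is
        \<open>y j * exp (- h)\<close> with h between 0 and d, so all members of a window see nearly
        the same scale.\<close>
      define h where "h = ln (real (pprod i)) - d * (j + t)"
      have h: "0 \<le> h" "h \<le> d" using j(2) by (auto simp: h_def B_def window_def algebra_simps)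
      have q0: "real (pprod i) > 0" using qpos[OF ip] by simp
      have yp: "y j > 0" using x1 by (simp add: y_def)
      have "exp (- h) = exp (d * (j + t)) / real (pprod i)"
        using q0 by (simp add: h_def exp_diff)
      then have "y j * exp (- h) = X / real (pprod i)"
        by (simp add: y_def X_def exp_minus distrib_left exp_add field_simps)
      then have "cmod (avg (\<lambda>m. f (pprod i0 * m)) (X / real (pprod i)) - avg (\<lambda>m. f (pprod i0 * m)) (y j)) \<le> 2 * d + 1 / y j"
        using avg_exp_shift[of "\<lambda>m. f (pprod i0 * m)", OF _ yp h] Phi_norm[OF Phi_dilate[OF f qpos[OF i0]]] by simp
      moreover have "avg (\<lambda>m. f (pprod i * m)) (X / real (pprod i)) = avg (\<lambda>m. f (pprod i0 * m)) (X / real (pprod i))"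
        using j(2) by (intro avg_cong Phi_pcol[OF f ip i0]) (auto simp: B_def)
      moreover have "1 / y j \<le> d"
      proof -
        have "exp (d * j) / d \<le> (\<Sum>j\<in>J. exp (d * j) / d)"
          using J j d by (intro member_le_sum) auto
        then have "exp (d * j) / d \<le> x" using x La0 by linarith
        then show ?thesis using d x1 by (simp add: y_def exp_minus field_simps)
      qed
      ultimately have "cmod (avg (\<lambda>m. f (pprod i * m)) (X / real (pprod i)) - avg (\<lambda>m. f (pprod i0 * m)) (y (jj i))) \<le> 3 * d"
        using jj[OF j] by simp
      then have "\<bar>lam i / real (pprod i)\<bar> * cmod (avg (\<lambda>m. f (pprod i * m)) (X / real (pprod i)) - avg (\<lambda>m. f (pprod i0 * m)) (y (jj i)))
          \<le> lam i / real (pprod i) * (3 * d)"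
        using lam[OF i] by (intro mult_mono) auto
      then show "cmod (of_real (lam i / real (pprod i)) *
          (avg (\<lambda>m. f (pprod i * m)) (X / real (pprod i)) - avg (\<lambda>m. f (pprod i0 * m)) (y (jj i)))) \<le> lam i / real (pprod i) * (3 * d)"
        by (simp only: norm_mult norm_of_real)
    qed
    also have "\<dots> = 3 * d" by (simp only: sum_distrib_right[symmetric] one mult_1_left)
    finally have 2: "cmod (S - (\<Sum>j\<in>J. of_real (1 / real j / M) * avg (\<lambda>m. f (pprod i0 * m)) (y j))) \<le> 3 * d" .
    show ?thesis
      using norm_triangle_le[OF add_mono[OF 1 2]] unfolding X_def y_def by simp
  qed
  then show ?thesis unfolding eventually_at_top_linorder by blast
qed

text \<open>The shift r is b - a for two windows j + a L and j + b L with the same majority colour.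
  Both Turan-Kubilius comparisons end at the same combination of averages, so the averages at
  \<open>x * exp (a * s)\<close> and \<open>x * exp (b * s)\<close> are close. The range of r is
  independent of e and s, which \<open>slow_all\<close> exploits.\<close>

lemma avg_close_shift:
  assumes s: "s > 0" and e: "e > 0"
  shows "\<exists>r\<in>{1..card pair_colors}. \<forall>\<^sub>F x in at_top. \<forall>f\<in>Phi.
     cmod (avg f x - avg f (x * exp (- (real r * s)))) \<le> e"
proof -
  define K where "K = card pair_colors"
  have K: "K \<ge> 1" using finite_pair_colors pair_colors_nonempty by (simp add: K_def Suc_le_eq card_gt_0_iff)
  obtain L :: nat where L: "real L > s / min 1 (e / 20)" using reals_Archimedean2 by blast
  have m0: "min 1 (e / 20) > 0" using e by simp
  then have "s / min 1 (e / 20) > 0" using s by (intro divide_pos_pos)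
  then have L0: "real L > 0" using L by linarith
  \<comment> \<open>The width divides s exactly, so moving by L windows is a logarithmic shift by s.
    Since d \<le> e / 20, the contributions of d to the error stay below e / 4.\<close>
  define d where "d = s / real L"
  have d0: "d > 0" using s L0 by (simp add: d_def)
  have "s < real L * min 1 (e / 20)" using L m0 by (simp only: pos_divide_less_eq)
  then have "s \<le> min 1 (e / 20) * real L" by (simp only: mult.commute less_imp_le)
  then have "d \<le> min 1 (e / 20)" using L0 by (simp only: d_def pos_divide_le_eq)
  then have d: "0 < d" "d \<le> 1" "20 * d \<le> e" using d0 by auto
  have dL: "d * real (n * L) = real n * s" for n using L0 by (simp add: d_def)
  obtain j0 where j0: "j0 \<ge> 1" "\<And>j. j \<ge> j0 \<Longrightarrow> (\<Sum>i\<in>window d j. theta i / real (pprod i)) \<ge> 1 / (12 * real j)"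
    using window_mass[OF d(1,2)] by blast
  define mass where "mass j c = (\<Sum>i | i \<in> window d j \<and> pcol col i = c. theta i / real (pprod i))" for j c
  have "\<exists>c\<in>pair_colors. mass j c \<ge> 1 / (12 * K * real j)" if j: "j \<ge> j0" for j
  proof (rule ccontr)
    assume "\<not> ?thesis"
    then have lt: "\<And>c. c \<in> pair_colors \<Longrightarrow> mass j c < 1 / (12 * K * real j)" by force
    have "(\<Sum>i\<in>window d j. theta i / real (pprod i)) = (\<Sum>c\<in>pair_colors. mass j c)"
      unfolding mass_def by (subst sum.group[OF finite_window finite_pair_colors]) (auto simp: window_def)
    also have "\<dots> < (\<Sum>c\<in>pair_colors. 1 / (12 * K * real j))"
      using finite_pair_colors pair_colors_nonempty lt by (intro sum_strict_mono) auto
    also have "\<dots> = 1 / (12 * real j)" using K by (simp add: K_def[symmetric])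
    finally show False using j0(2)[OF j] by linarith
  qed
  then obtain \<gamma> where \<gamma>: "\<And>j. j \<ge> j0 \<Longrightarrow> \<gamma> j \<in> pair_colors \<and> mass j (\<gamma> j) \<ge> 1 / (12 * K * real j)"
    by metis
  \<comment> \<open>For j \<ge> K L and n \<le> K the index j + n L is at most 2 j, so a mass of 1 /
    (12 K (j + n L)) is still at least 1 / (24 K j). This gives the value of \<kappa> below.\<close>
  define j1 where "j1 = max j0 (K * L)"
  have "\<exists>a b. a < b \<and> b \<le> K \<and> \<gamma> (j + a * L) = \<gamma> (j + b * L)" if j: "j \<ge> j1" for j
  proof -
    have "(\<lambda>a. \<gamma> (j + a * L)) ` {0..K} \<subseteq> pair_colors" using \<gamma> j by (auto simp: j1_def)
    then have "card ((\<lambda>a. \<gamma> (j + a * L)) ` {0..K}) \<le> K"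
      unfolding K_def by (intro card_mono finite_pair_colors)
    then have "\<not> inj_on (\<lambda>a. \<gamma> (j + a * L)) {0..K}" using card_image by fastforce
    then obtain a b where "a \<noteq> b" "a \<le> K" "b \<le> K" "\<gamma> (j + a * L) = \<gamma> (j + b * L)"
      unfolding inj_on_def by auto
    then show ?thesis by (metis linorder_neqE_nat)
  qed
  then obtain fa fb where fab: "\<And>j. j \<ge> j1 \<Longrightarrow> fa j < fb j \<and> fb j \<le> K \<and> \<gamma> (j + fa j * L) = \<gamma> (j + fb j * L)"
    by metis
  \<comment> \<open>Both offsets and the common colour are pigeonholed together, with the weights 1
    / j instead of cardinalities: the surviving j must have divergent reciprocals for M to become
    large.\<close>
  define F where "F j = (fa j, fb j, \<gamma> (j + fa j * L))" for j
  have "F ` {j1..} \<subseteq> {0..K} \<times> {0..K} \<times> pair_colors"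
  proof
    fix z assume "z \<in> F ` {j1..}"
    then obtain j where j: "j \<ge> j1" "z = F j" by auto
    have "j + fa j * L \<ge> j0" using j by (simp add: j1_def)
    then show "z \<in> {0..K} \<times> {0..K} \<times> pair_colors"
      using fab[OF j(1)] \<gamma>[of "j + fa j * L"] j by (auto simp: F_def)
  qed
  then have "finite (F ` {j1..})" using finite_pair_colors finite_subset by blast
  from diverges_pigeonhole[OF diverges_reciprocals this]
  obtain z where z: "z \<in> F ` {j1..}" "diverges (\<lambda>j. 1 / real j) {j\<in>{j1..}. F j = z}" by blast
  obtain a b c where abc: "z = (a, b, c)" by (cases z) auto
  have ab: "a < b" "b \<le> K" "c \<in> pair_colors"
    using z(1) fab \<gamma> by (auto simp: abc F_def j1_def)
  obtain i0 where i0: "i0 \<in> prime_pairs" "c = pcol col i0" using ab(3) by blast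
  define \<kappa> where "\<kappa> = 24 * real K"
  \<comment> \<open>The bound makes 246 \<kappa> / M at most (e / 4)^2; the extra 1 makes M
    positive.\<close>
  obtain J where J: "J \<subseteq> {j\<in>{j1..}. F j = z}" "finite J" "(\<Sum>j\<in>J. 1 / real j) \<ge> 246 * \<kappa> * 16 / e\<^sup>2 + 1"
    using z(2) unfolding diverges_def by blast
  define M where "M = (\<Sum>j\<in>J. 1 / real j)"
  have M: "M \<ge> 246 * \<kappa> * 16 / e\<^sup>2 + 1" using J(3) by (simp add: M_def)
  have k0: "\<kappa> \<ge> 0" "246 * \<kappa> * 16 / e\<^sup>2 \<ge> 0" by (auto simp: \<kappa>_def)
  have M0: "M > 0" using M k0 by linarith
  have Jge: "j \<ge> 1" "j \<ge> K * L" "j \<ge> j0" "fa j = a" "fb j = b" "\<gamma> (j + a * L) = c" "\<gamma> (j + b * L) = c" if "j \<in> J" for j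
    using that J(1) j0(1) fab[of j] by (auto simp: j1_def F_def abc)
  have mass': "1 / real j \<le> \<kappa> * (\<Sum>i | i \<in> window d (j + n * L) \<and> pcol col i = pcol col i0. theta i / real (pprod i))"
    if j: "j \<in> J" and n: "n \<in> {a, b}" for j n
  proof -
    have "n * L \<le> K * L" using n ab by (intro mult_right_mono) auto
    then have "n * L \<le> j" using Jge[OF j] by linarith
    then have "real (n * L) \<le> real j" by (simp only: of_nat_le_iff)
    then have "real (j + n * L) \<le> 2 * real j" by (simp only: of_nat_add)
    then have "12 * K * real (j + n * L) \<le> 12 * K * (2 * real j)" by (rule mult_left_mono) simp
    then have "24 * K * real j \<ge> 12 * K * real (j + n * L)" by simp
    moreover have "12 * K * real (j + n * L) > 0"
    proof -
      have "j + n * L > 0" using Jge(1)[OF j] by simp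
      then have "real (j + n * L) > 0" by (simp only: of_nat_0_less_iff)
      then show ?thesis using K by (intro mult_pos_pos) auto
    qed
    ultimately have "1 / (24 * K * real j) \<le> 1 / (12 * K * real (j + n * L))"
      by (intro frac_le) auto
    also have "\<dots> \<le> mass (j + n * L) c" using \<gamma>[of "j + n * L"] Jge[OF j] n by auto
    finally have "1 / (24 * K * real j) \<le> mass (j + n * L) c" .
    then have "24 * K * (1 / (24 * K * real j)) \<le> 24 * K * mass (j + n * L) c"
      using K by (intro mult_left_mono) auto
    then show ?thesis using K by (simp add: \<kappa>_def mass_def i0(2))
  qed
  have bound: "sqrt (246 * \<kappa> / M + d\<^sup>2) + 3 * d \<le> e / 2"
  proof -
    have "246 * \<kappa> / M \<le> (e / 4)\<^sup>2"
    proof -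
      have "246 * \<kappa> * 16 / e\<^sup>2 \<le> M" using M by linarith
      then show ?thesis using M0 e by (simp add: field_simps power2_eq_square)
    qed
    then have "sqrt (246 * \<kappa> / M + d\<^sup>2) \<le> sqrt ((e / 4)\<^sup>2 + d\<^sup>2)" by simp
    also have "\<dots> \<le> e / 4 + d"
      using sqrt_add_le_add_sqrt[of "(e/4)\<^sup>2" "d\<^sup>2"] e d by simp
    finally show ?thesis using d by linarith
  qed
  have av: "\<forall>\<^sub>F x in at_top. \<forall>f\<in>Phi.
      cmod (avg f (x * exp (real n * s)) -
         (\<Sum>j\<in>J. of_real (1 / real j / M) * avg (\<lambda>m. f (pprod i0 * m)) (x * exp (- (d * j))))) \<le> e / 2"
    if n: "n \<in> {a, b}" for n
  proof -
    have *: "\<forall>f\<in>A. g f \<le> e / 2" if "\<forall>f\<in>A. g f \<le> sqrt (246 * \<kappa> / M + d\<^sup>2) + 3 * d"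
      for A and g :: "(nat \<Rightarrow> complex) \<Rightarrow> real"
      using that bound by (meson order_trans)
    show ?thesis
      using window_average[OF d(1,2) J(2) Jge(1) k0(1) M_def M0 i0(1) mass'[OF _ n]]
      unfolding dL by (rule eventually_mono) (assumption | rule *)+
  qed
  have "\<forall>\<^sub>F x in at_top. \<forall>f\<in>Phi. cmod (avg f (x * exp (real b * s)) - avg f (x * exp (real a * s))) \<le> e"
    using av[OF insertI1] av[OF insertI2[OF insertI1]]
  proof eventually_elim
    case (elim x)
    show ?case
    proof
      fix f assume f: "f \<in> Phi"
      have *: "cmod (v - u) \<le> e" if "cmod (u - S) \<le> e / 2" "cmod (v - S) \<le> e / 2" for u v S
        using norm_diff_triangle_le[OF that(2), of u "e / 2"] that(1) by (simp add: norm_minus_commute)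
      show "cmod (avg f (x * exp (real b * s)) - avg f (x * exp (real a * s))) \<le> e"
        by (rule *[OF bspec[OF elim(1) f] bspec[OF elim(2) f]])
    qed
  qed
  from eventually_at_top_scale[OF this, of "exp (- (real b * s))"]
  have "\<forall>\<^sub>F x in at_top. \<forall>f\<in>Phi. cmod (avg f x - avg f (x * exp (- (real (b - a) * s)))) \<le> e"
  proof (rule eventually_mono)
    fix x assume *: "\<forall>f\<in>Phi. cmod (avg f (x * exp (- (real b * s)) * exp (real b * s)) -
                     avg f (x * exp (- (real b * s)) * exp (real a * s))) \<le> e"
    have e1: "x * exp (- (real b * s)) * exp (real b * s) = x" by (simp add: exp_minus)
    have e2: "x * exp (- (real b * s)) * exp (real a * s) = x * exp (- (real (b - a) * s))"
      using ab(1) by (simp add: mult.assoc exp_add[symmetric] of_nat_diff algebra_simps)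
    show "\<forall>f\<in>Phi. cmod (avg f x - avg f (x * exp (- (real (b - a) * s)))) \<le> e"
      using * unfolding e1 e2 .
  qed auto
  moreover have "b - a \<in> {1..card pair_colors}" using ab unfolding K_def by auto
  ultimately show ?thesis by blast
qed

section \<open>Slow variation of the averages on the logarithmic scale\<close>

definition slow :: "real \<Rightarrow> bool" where
  "slow s \<longleftrightarrow> (\<forall>e>0. \<forall>\<^sub>F x in at_top. \<forall>f\<in>Phi. cmod (avg f x - avg f (x * exp (- s))) \<le> e)"

lemma slow_add:
  assumes "slow s" "slow t"
  shows "slow (s + t)"
  unfolding slow_def
proof (intro allI impI)
  fix e :: real assume e: "e > 0"
  have "\<forall>\<^sub>F x in at_top. \<forall>f\<in>Phi. cmod (avg f x - avg f (x * exp (- s))) \<le> e / 2"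
    using assms(1)[unfolded slow_def, rule_format, of "e / 2"] e by simp
  moreover have "\<forall>\<^sub>F x in at_top. \<forall>f\<in>Phi. cmod (avg f (x * exp (- s)) - avg f (x * exp (- s) * exp (- t))) \<le> e / 2"
    using assms(2)[unfolded slow_def, rule_format, of "e / 2"] e
    by (intro eventually_at_top_scale[where c = "exp (- s)"]) simp_all
  ultimately show "\<forall>\<^sub>F x in at_top. \<forall>f\<in>Phi. cmod (avg f x - avg f (x * exp (- (s + t)))) \<le> e"
  proof eventually_elim
    case (elim x)
    show ?case
    proof
      fix f assume f: "f \<in> Phi"
      have eq: "x * exp (- s) * exp (- t) = x * exp (- (s + t))" by (simp add: mult_exp_exp mult.assoc)
      have "cmod (avg f x - avg f (x * exp (- s))) \<le> e / 2"
           "cmod (avg f (x * exp (- s)) - avg f (x * exp (- (s + t)))) \<le> e / 2"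
        using elim f unfolding eq by blast+
      from norm_diff_triangle_le[OF this] show "cmod (avg f x - avg f (x * exp (- (s + t)))) \<le> e" by simp
    qed
  qed
qed

lemma slow_mult: "slow s \<Longrightarrow> slow (real n * s)"
proof (induction n)
  case 0
  then show ?case by (simp add: slow_def)
next
  case (Suc n)
  then show ?case using slow_add[of s "real n * s"] by (simp add: algebra_simps)
qed

text \<open>The multiple r supplied by \<open>avg_close_shift\<close> depends on the tolerance but
  ranges over a finite set, so one r serves all tolerances. With s = t / K! the wanted shift t is an
  integer multiple of r s, whichever r occurs.\<close>

lemma slow_all:
  assumes "t > 0"
  shows "slow t"
proof -
  define K where "K = card pair_colors"
  define s where "s = t / fact K"
  have s: "s > 0" using assms by (simp add: s_def)
  define P where "P r e \<longleftrightarrow> (\<forall>\<^sub>F x in at_top. \<forall>f\<in>Phi. cmod (avg f x - avg f (x * exp (- (real r * s)))) \<le> e)" for r e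
  have mono: "P r e'" if "P r e" "e \<le> e'" for r e e'
    using that(1) unfolding P_def by (rule eventually_mono) (use that(2) in force)
  have ex: "\<exists>r\<in>{1..K}. P r e" if "e > 0" for e
    using avg_close_shift[OF s that] by (simp add: P_def K_def)
  have "\<exists>r\<in>{1..K}. \<forall>e>0. P r e"
  proof (rule ccontr)
    assume "\<not> ?thesis"
    then obtain E where E: "\<And>r. r \<in> {1..K} \<Longrightarrow> E r > 0 \<and> \<not> P r (E r)" by metis
    have "{1..K} \<noteq> {}" using ex[of 1] by auto
    define e where "e = Min (E ` {1..K})"
    have "e > 0" unfolding e_def using \<open>{1..K} \<noteq> {}\<close> E by (subst Min_gr_iff) auto
    then obtain r where r: "r \<in> {1..K}" "P r e" using ex by blast
    have "e \<le> E r" unfolding e_def using r by (intro Min_le) auto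
    then show False using mono r E by blast
  qed
  then obtain r where r: "r \<in> {1..K}" "\<And>e. e > 0 \<Longrightarrow> P r e" by blast
  then have sl: "slow (real r * s)" by (auto simp: slow_def P_def)
  have "r dvd fact K" using r by (intro dvd_fact) auto
  then obtain n where n: "fact K = r * n" by auto
  have "real n * (real r * s) = real (fact K) * s" by (simp only: n of_nat_mult mult_ac)
  also have "\<dots> = t" by (simp add: s_def)
  finally have "real n * (real r * s) = t" .
  then show ?thesis using slow_mult[OF sl, of n] by simp
qed

text \<open>With equal weights on primes p of the colour of \<open>p0\<close>, the average of f at x
  is close to a mean of averages of \<open>f (p0 * m)\<close> at the scales x / p, and slow
  variation moves all of these to x. Distinct primes are coprime, so only the diagonal enters the
  correlation term, which is 1 / L.\<close>

theorem avg_shift_invariant: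
  assumes p0: "prime p0" and div: "diverges (\<lambda>p. 1 / real p) {p. prime p \<and> col p = col p0}" and e: "e > 0"
  shows "\<forall>\<^sub>F x in at_top. \<forall>f\<in>Phi. cmod (avg (\<lambda>m. f (p0 * m)) x - avg f x) \<le> e"
proof -
  \<comment> \<open>With this lower bound 1 / L is at most e^2 / 8, half of the (e / 2)^2 allowed
    under the square root; large x provides the other half.\<close>
  obtain J where J: "J \<subseteq> {p. prime p \<and> col p = col p0}" "finite J" "(\<Sum>p\<in>J. 1 / real p) \<ge> 8 / e\<^sup>2"
    using div unfolding diverges_def by blast
  define L where "L = (\<Sum>p\<in>J. 1 / real p)"
  have L: "L \<ge> 8 / e\<^sup>2" using J by (simp add: L_def)
  have L0: "L > 0" using e by (intro less_le_trans[OF _ L]) auto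
  have Jp: "prime p" "p \<ge> 1" "col p = col p0" if "p \<in> J" for p
    using that J by (auto simp: Suc_le_eq prime_gt_0_nat)
  have one: "(\<Sum>p\<in>J. 1 / L / real p) = 1"
  proof -
    have "(\<Sum>p\<in>J. 1 / L / real p) = (\<Sum>p\<in>J. 1 / real p) / L" by (simp add: sum_divide_distrib mult.commute)
    then show ?thesis using L0 by (simp add: L_def)
  qed
  have corr: "(\<Sum>p\<in>J. \<Sum>q\<in>J. if coprime p q then 0 else 1 / L * (1 / L) / real (lcm p q)) \<le> 1 / L"
  proof -
    have "(\<Sum>q\<in>J. if coprime p q then 0 else 1 / L * (1 / L) / real (lcm p q)) = 1 / L * (1 / L / real p)" if p: "p \<in> J" for p
    proof -
      have "(\<Sum>q\<in>J. if coprime p q then 0 else 1 / L * (1 / L) / real (lcm p q)) =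
        (\<Sum>q\<in>J. if q = p then 1 / L * (1 / L / real p) else 0)"
      proof (intro sum.cong refl)
        fix q assume q: "q \<in> J"
        show "(if coprime p q then 0 else 1 / L * (1 / L) / real (lcm p q)) = (if q = p then 1 / L * (1 / L / real p) else 0)"
        proof (cases "q = p")
          case True
          then show ?thesis using Jp(1)[OF p] by (auto simp: prime_nat_iff)
        next
          case False
          then have "coprime p q" using Jp(1) p q by (auto intro: primes_coprime)
          then show ?thesis using False by simp
        qed
      qed
      then show ?thesis using p J(2) by (simp add: sum.delta)
    qed
    then have "(\<Sum>p\<in>J. \<Sum>q\<in>J. if coprime p q then 0 else 1 / L * (1 / L) / real (lcm p q)) = (\<Sum>p\<in>J. 1 / L * (1 / L / real p))"
      by (intro sum.cong refl)
    also have "\<dots> = 1 / L" by (simp only: sum_distrib_left[symmetric] one mult_1_right)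
    finally show ?thesis by simp
  qed
  define La where "La = (\<Sum>p\<in>J. 1 / L)"
  have La: "La \<ge> 0" using L0 by (auto simp: La_def)
  have "\<forall>\<^sub>F x in at_top. \<forall>p\<in>J. \<forall>f\<in>Phi. cmod (avg f x - avg f (x * exp (- ln (real p)))) \<le> e / 2"
  proof (rule eventually_ball_finite[OF J(2)], rule ballI)
    fix p assume p: "p \<in> J"
    have "ln (real p) > 0" using prime_gt_1_nat[OF Jp(1)[OF p]] by simp
    then show "\<forall>\<^sub>F x in at_top. \<forall>f\<in>Phi. cmod (avg f x - avg f (x * exp (- ln (real p)))) \<le> e / 2"
      using slow_all[unfolded slow_def, rule_format, of "ln (real p)" "e / 2"] e by simp
  qed
  moreover have "\<forall>\<^sub>F x in at_top. x \<ge> max 1 (2 * La * 8 / e\<^sup>2)" by (rule eventually_ge_at_top)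
  ultimately show ?thesis
  proof eventually_elim
    case (elim x)
    then have x: "x \<ge> 1" "x \<ge> 2 * La * 8 / e\<^sup>2" by auto
    show ?case
    proof
      fix f assume f: "f \<in> Phi"
      define S where "S = (\<Sum>p\<in>J. of_real (1 / L / real p) * avg (\<lambda>m. f (p * m)) (x / real p))"
      have "cmod (avg f x - S) \<le> sqrt (1 / L + 2 * (\<Sum>p\<in>J. 1 / L) / x)"
        unfolding S_def using Jp L0 one corr x f J(2)
        by (intro weighted_turan_kubilius[where q = "\<lambda>p. p" and lam = "\<lambda>_. 1 / L"]) (auto intro: Phi_norm)
      also have "\<dots> \<le> sqrt ((e / 2)\<^sup>2)"
      proof -
        have "1 / L \<le> e\<^sup>2 / 8" using L L0 e by (simp add: field_simps)
        moreover have "2 * La / x \<le> e\<^sup>2 / 8" using x e by (simp add: field_simps)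
        moreover have "(e / 2)\<^sup>2 = e\<^sup>2 / 8 + e\<^sup>2 / 8" by (simp add: power2_eq_square)
        ultimately show ?thesis unfolding La_def by (intro real_sqrt_le_mono) linarith
      qed
      also have "\<dots> = e / 2" using e by simp
      finally have 1: "cmod (avg f x - S) \<le> e / 2" .
      have g: "(\<lambda>m. f (p0 * m)) \<in> Phi"
        using f p0 by (intro Phi_dilate) (auto simp: Suc_le_eq prime_gt_0_nat)
      have "avg (\<lambda>m. f (p0 * m)) x = (\<Sum>p\<in>J. of_real (1 / L / real p) * avg (\<lambda>m. f (p0 * m)) x)"
        unfolding sum_distrib_right[symmetric] of_real_sum[symmetric] one by simp
      then have "S - avg (\<lambda>m. f (p0 * m)) x =
          (\<Sum>p\<in>J. of_real (1 / L / real p) * (avg (\<lambda>m. f (p * m)) (x / real p) - avg (\<lambda>m. f (p0 * m)) x))"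
        by (simp add: S_def sum_subtractf right_diff_distrib)
      also have "cmod \<dots> \<le> (\<Sum>p\<in>J. 1 / L / real p * (e / 2))"
      proof (rule sum_norm_le)
        fix p assume p: "p \<in> J"
        have "avg (\<lambda>m. f (p * m)) (x / real p) = avg (\<lambda>m. f (p0 * m)) (x * exp (- ln (real p)))"
        proof -
          have "x * exp (- ln (real p)) = x / real p" using Jp(2)[OF p] by (simp add: exp_minus field_simps)
          then show ?thesis using Phi_col[OF f Jp(1)[OF p] p0 Jp(3)[OF p]] by (simp add: avg_cong[of "\<lambda>m. f (p * m)" "\<lambda>m. f (p0 * m)"])
        qed
        then have "cmod (avg (\<lambda>m. f (p * m)) (x / real p) - avg (\<lambda>m. f (p0 * m)) x) \<le> e / 2"
          using elim(1) p g by (simp add: norm_minus_commute)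
        then have "\<bar>1 / L / real p\<bar> * cmod (avg (\<lambda>m. f (p * m)) (x / real p) - avg (\<lambda>m. f (p0 * m)) x) \<le> 1 / L / real p * (e / 2)"
          using L0 by (intro mult_mono) auto
        then show "cmod (of_real (1 / L / real p) * (avg (\<lambda>m. f (p * m)) (x / real p) - avg (\<lambda>m. f (p0 * m)) x)) \<le> 1 / L / real p * (e / 2)"
          by (simp only: norm_mult norm_of_real)
      qed
      also have "\<dots> = e / 2" by (simp only: sum_distrib_right[symmetric] one mult_1_left)
      finally have 2: "cmod (S - avg (\<lambda>m. f (p0 * m)) x) \<le> e / 2" .
      show "cmod (avg (\<lambda>m. f (p0 * m)) x - avg f x) \<le> e"
        using norm_diff_triangle_le[OF 1 2] by (simp add: norm_minus_commute)
    qed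
  qed
qed

end

section \<open>Orthogonal projections for square-integrable functions\<close>

context prob_space
begin

section \<open>Inner product and seminorm on square-integrable functions\<close>

lemma cmod_add_sq_le: "(cmod (a + b))\<^sup>2 \<le> 2 * (cmod a)\<^sup>2 + 2 * (cmod b)\<^sup>2"
proof -
  have "(cmod (a + b))\<^sup>2 \<le> (cmod a + cmod b)\<^sup>2" by (intro power_mono norm_triangle_ineq) auto
  then show ?thesis using sum_squares_bound[of "cmod a" "cmod b"] by (simp add: power2_sum)
qed

lemma L2_add:
  assumes "F \<in> L2 M" "G \<in> L2 M"
  shows "F + G \<in> L2 M"
proof -
  have [measurable]: "F \<in> borel_measurable M" "G \<in> borel_measurable M" using assms by (auto simp: L2_def)
  have "integrable M (\<lambda>x. 2 * (cmod (F x))\<^sup>2 + 2 * (cmod (G x))\<^sup>2)" using assms by (auto simp: L2_def)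
  then have "integrable M (\<lambda>x. (cmod (F x + G x))\<^sup>2)"
    by (rule Bochner_Integration.integrable_bound) (auto intro!: AE_I2 cmod_add_sq_le)
  then show ?thesis by (simp add: L2_def plus_fun_def)
qed

lemma L2_scale: "F \<in> L2 M \<Longrightarrow> cscale c F \<in> L2 M"
  by (auto simp: L2_def cscale_def norm_mult power_mult_distrib)

lemma L2_0: "0 \<in> L2 M"
  by (simp add: L2_def zero_fun_def)

lemma subspace_L2: "cfun.subspace (L2 M)"
  by (auto simp: cfun.subspace_def L2_0 L2_add L2_scale)

lemmas L2_diff = cfun.subspace_diff[OF subspace_L2]
lemmas L2_sum = cfun.subspace_sum[OF subspace_L2]

lemma l2_norm_nonneg: "l2_norm M F \<ge> 0"
  by (simp add: l2_norm_def)

lemma l2_norm_sq: "(l2_norm M F)\<^sup>2 = (\<integral>x. (cmod (F x))\<^sup>2 \<partial>M)"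
  by (simp add: l2_norm_def)

lemma l2_inner_self: "l2_inner M F F = of_real ((l2_norm M F)\<^sup>2)"
  by (simp add: l2_inner_def l2_norm_sq complex_norm_square[symmetric] flip: integral_complex_of_real)

lemma l2_inner_commute: "l2_inner M G F = cnj (l2_inner M F G)"
proof -
  have "cnj (l2_inner M F G) = (\<integral>x. cnj (F x * cnj (G x)) \<partial>M)"
    unfolding l2_inner_def by (rule Bochner_Integration.integral_cnj[symmetric])
  then show ?thesis by (simp add: l2_inner_def mult.commute)
qed

lemma l2_inner_add_left:
  "F \<in> L2 M \<Longrightarrow> G \<in> L2 M \<Longrightarrow> H \<in> L2 M \<Longrightarrow> l2_inner M (F + G) H = l2_inner M F H + l2_inner M G H"
  by (simp add: l2_inner_def distrib_right l2_mult_integrable)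

lemma l2_inner_scale_left: "l2_inner M (cscale c F) H = c * l2_inner M F H"
  by (simp add: l2_inner_def cscale_def mult.assoc)

lemma l2_inner_add_right:
  "F \<in> L2 M \<Longrightarrow> G \<in> L2 M \<Longrightarrow> H \<in> L2 M \<Longrightarrow> l2_inner M H (F + G) = l2_inner M H F + l2_inner M H G"
  using l2_inner_add_left[of F G H] by (metis complex_cnj_add l2_inner_commute)

lemma l2_inner_scale_right: "l2_inner M H (cscale c F) = cnj c * l2_inner M H F"
  by (metis complex_cnj_mult l2_inner_commute l2_inner_scale_left)

lemma l2_inner_diff_left:
  assumes "F \<in> L2 M" "G \<in> L2 M" "H \<in> L2 M"
  shows "l2_inner M (F - G) H = l2_inner M F H - l2_inner M G H"
  using l2_inner_add_left[of "F - G" G H] L2_diff assms by simp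

lemma l2_inner_diff_right:
  assumes "F \<in> L2 M" "G \<in> L2 M" "H \<in> L2 M"
  shows "l2_inner M H (F - G) = l2_inner M H F - l2_inner M H G"
  using l2_inner_add_right[of "F - G" G H] L2_diff assms by simp

lemma l2_inner_0_left [simp]: "l2_inner M 0 H = 0"
  by (simp add: l2_inner_def)

lemma l2_inner_0_right [simp]: "l2_inner M H 0 = 0"
  by (simp add: l2_inner_def)

lemma l2_inner_sum_left:
  assumes "\<And>i. i \<in> I \<Longrightarrow> F i \<in> L2 M" "H \<in> L2 M"
  shows "l2_inner M (\<Sum>i\<in>I. F i) H = (\<Sum>i\<in>I. l2_inner M (F i) H)"
  using assms(1)
  by (induction I rule: infinite_finite_induct) (auto simp: l2_inner_add_left L2_sum assms(2))

lemma l2_inner_sum_right: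
  assumes "\<And>i. i \<in> I \<Longrightarrow> F i \<in> L2 M" "H \<in> L2 M"
  shows "l2_inner M H (\<Sum>i\<in>I. F i) = (\<Sum>i\<in>I. l2_inner M H (F i))"
  using assms(1)
  by (induction I rule: infinite_finite_induct) (auto simp: l2_inner_add_right L2_sum assms(2))

lemma l2_norm_diff_sq:
  assumes "F \<in> L2 M" "G \<in> L2 M"
  shows "(l2_norm M (F - G))\<^sup>2 = (l2_norm M F)\<^sup>2 + (l2_norm M G)\<^sup>2 - 2 * Re (l2_inner M F G)"
proof -
  have "complex_of_real ((l2_norm M (F - G))\<^sup>2) = l2_inner M (F - G) (F - G)" by (simp add: l2_inner_self)
  also have "\<dots> = l2_inner M F F + l2_inner M G G - (l2_inner M F G + l2_inner M G F)"
    using assms by (simp add: l2_inner_diff_left l2_inner_diff_right L2_diff)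
  also have "\<dots> = of_real ((l2_norm M F)\<^sup>2) + of_real ((l2_norm M G)\<^sup>2) - (l2_inner M F G + cnj (l2_inner M F G))"
    unfolding l2_inner_self l2_inner_commute[of G F] by simp
  also have "\<dots> = of_real ((l2_norm M F)\<^sup>2 + (l2_norm M G)\<^sup>2 - 2 * Re (l2_inner M F G))"
    by (simp add: complex_add_cnj)
  finally show ?thesis by (simp only: of_real_eq_iff)
qed

lemma l2_norm_scale: "l2_norm M (cscale c F) = cmod c * l2_norm M F"
  by (simp add: l2_norm_def cscale_def norm_mult power_mult_distrib real_sqrt_mult)

text \<open>The discriminant argument applied to F - t z G with z the inner product. Since a
  function of norm 0 need not be 0, the case of a null G is treated separately by taking t
  large.\<close>

lemma l2_Cauchy_Schwarz:
  assumes "F \<in> L2 M" "G \<in> L2 M"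
  shows "cmod (l2_inner M F G) \<le> l2_norm M F * l2_norm M G"
proof -
  define z where "z = l2_inner M F G"
  define a where "a = l2_norm M F"
  define b where "b = l2_norm M G"
  have ab: "a \<ge> 0" "b \<ge> 0" by (auto simp: a_def b_def l2_norm_nonneg)
  have *: "2 * t * (cmod z)\<^sup>2 \<le> a\<^sup>2 + t\<^sup>2 * (cmod z)\<^sup>2 * b\<^sup>2" for t :: real
  proof -
    have "0 \<le> (l2_norm M (F - cscale (of_real t * z) G))\<^sup>2" by simp
    also have "\<dots> = a\<^sup>2 + (cmod (of_real t * z) * b)\<^sup>2 - 2 * Re (cnj (of_real t * z) * z)"
      using assms by (simp only: l2_norm_diff_sq L2_scale l2_norm_scale l2_inner_scale_right a_def b_def z_def)
    also have "Re (cnj (of_real t * z) * z) = t * (cmod z)\<^sup>2"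
      by (simp add: cmod_power2) (simp add: power2_eq_square algebra_simps)
    finally show ?thesis by (simp add: norm_mult power_mult_distrib algebra_simps)
  qed
  have "cmod z \<le> a * b"
  proof (cases "b = 0")
    case True
    have "(cmod z)\<^sup>2 = 0"
    proof (rule ccontr)
      assume "(cmod z)\<^sup>2 \<noteq> 0"
      then have p: "(cmod z)\<^sup>2 > 0" by simp
      then show False using *[of "(a\<^sup>2 + 1) / (2 * (cmod z)\<^sup>2)"] True by simp
    qed
    then show ?thesis using True by simp
  next
    case False
    have "(1 / b\<^sup>2)\<^sup>2 * (cmod z)\<^sup>2 * b\<^sup>2 = (cmod z)\<^sup>2 / b\<^sup>2"
      using False by (simp add: power2_eq_square)
    then have "(cmod z)\<^sup>2 / b\<^sup>2 \<le> a\<^sup>2" using *[of "1 / b\<^sup>2"] by simp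
    then have "(cmod z)\<^sup>2 \<le> a\<^sup>2 * b\<^sup>2" using False by (simp add: pos_divide_le_eq)
    then show ?thesis using ab by (metis abs_le_square_iff abs_norm_cancel abs_of_nonneg mult_nonneg_nonneg power_mult_distrib)
  qed
  then show ?thesis by (simp add: z_def a_def b_def)
qed

lemma l2_norm_add_le:
  assumes "F \<in> L2 M" "G \<in> L2 M"
  shows "l2_norm M (F + G) \<le> l2_norm M F + l2_norm M G"
proof -
  have m: "cscale (-1) G \<in> L2 M" by (rule L2_scale[OF assms(2)])
  have e: "F + G = F - cscale (-1) G" by (simp add: fun_eq_iff cscale_def)
  have "(l2_norm M (F + G))\<^sup>2 = (l2_norm M F)\<^sup>2 + (l2_norm M G)\<^sup>2 + 2 * Re (l2_inner M F G)"
    unfolding e l2_norm_diff_sq[OF assms(1) m] l2_norm_scale l2_inner_scale_right by simp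
  also have "Re (l2_inner M F G) \<le> l2_norm M F * l2_norm M G"
    using l2_Cauchy_Schwarz[OF assms] complex_Re_le_cmod order_trans by blast
  finally have "(l2_norm M (F + G))\<^sup>2 \<le> (l2_norm M F + l2_norm M G)\<^sup>2"
    by (simp add: power2_sum)
  then show ?thesis by (rule power2_le_imp_le) (simp add: l2_norm_nonneg)
qed

lemma l2_norm_uminus: "l2_norm M (- F) = l2_norm M F"
  by (simp add: l2_norm_def)

lemma l2_norm_minus_commute: "l2_norm M (F - G) = l2_norm M (G - F)"
  by (simp add: l2_norm_def norm_minus_commute)

lemma l2_norm_diff_triangle:
  assumes "F \<in> L2 M" "G \<in> L2 M" "H \<in> L2 M"
  shows "l2_norm M (F - H) \<le> l2_norm M (F - G) + l2_norm M (G - H)"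
  using l2_norm_add_le[of "F - G" "G - H"] assms L2_diff by simp

lemma l2_norm_sum_le:
  assumes "\<And>i. i \<in> I \<Longrightarrow> F i \<in> L2 M"
  shows "l2_norm M (\<Sum>i\<in>I. F i) \<le> (\<Sum>i\<in>I. l2_norm M (F i))"
  using assms
proof (induction I rule: infinite_finite_induct)
  case (insert i I)
  have "l2_norm M (F i + (\<Sum>i\<in>I. F i)) \<le> l2_norm M (F i) + l2_norm M (\<Sum>i\<in>I. F i)"
    using insert.prems by (intro l2_norm_add_le L2_sum) auto
  then show ?case
    unfolding sum.insert[OF insert.hyps] using insert.IH[OF insert.prems[OF insertI2]] by linarith
qed (auto simp: l2_norm_def)

lemma integral_cmod_le_l2_norm:
  assumes "F \<in> L2 M"
  shows "integrable M (\<lambda>x. cmod (F x))" "(\<integral>x. cmod (F x) \<partial>M) \<le> l2_norm M F"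
proof -
  have a: "(\<lambda>x. of_real (cmod (F x))) \<in> L2 M"
    using assms by (auto simp: L2_def)
  have one: "(\<lambda>x. 1) \<in> L2 M" by (auto simp: L2_def)
  have i: "integrable M (\<lambda>x. complex_of_real (cmod (F x)))"
    using l2_mult_integrable[OF a one] by simp
  show "integrable M (\<lambda>x. cmod (F x))" using integrable_norm[OF i] by simp
  have "cmod (l2_inner M (\<lambda>x. of_real (cmod (F x))) (\<lambda>x. 1)) \<le> l2_norm M F * 1"
    using l2_Cauchy_Schwarz[OF a one] by (simp add: l2_norm_def prob_space)
  moreover have "l2_inner M (\<lambda>x. of_real (cmod (F x))) (\<lambda>x. 1) = of_real (\<integral>x. cmod (F x) \<partial>M)"
    by (simp add: l2_inner_def)
  ultimately show "(\<integral>x. cmod (F x) \<partial>M) \<le> l2_norm M F" by simp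
qed

lemma ennreal_l2_norm_sq:
  assumes "F \<in> L2 M"
  shows "(\<integral>\<^sup>+x. ennreal ((cmod (F x))\<^sup>2) \<partial>M) = ennreal ((l2_norm M F)\<^sup>2)"
  unfolding l2_norm_sq using assms by (intro nn_integral_eq_integral) (auto simp: L2_def)

text \<open>Completeness for geometric increments: on a probability space the absolute increments
  have summable integrals, so the sequence converges almost everywhere, and Fatou's lemma passes the
  norm bounds to the pointwise limit.\<close>

lemma fast_Cauchy_l2_limit:
  assumes g: "\<And>n. g n \<in> L2 M" and c: "\<And>n. l2_norm M (g (Suc n) - g n) \<le> (1/2) ^ n"
  shows "\<exists>G\<in>L2 M. \<forall>n. l2_norm M (G - g n) \<le> 2 * (1/2) ^ n"
proof -
  have [measurable]: "g n \<in> borel_measurable M" for n using g by (auto simp: L2_def)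
  have "(\<integral>\<^sup>+x. (\<Sum>n. ennreal (cmod (g (Suc n) x - g n x))) \<partial>M) =
      (\<Sum>n. \<integral>\<^sup>+x. ennreal (cmod (g (Suc n) x - g n x)) \<partial>M)"
    by (rule nn_integral_suminf) auto
  also have "\<dots> \<le> (\<Sum>n. ennreal ((1/2) ^ n))"
  proof (intro suminf_le)
    fix n
    have d: "g (Suc n) - g n \<in> L2 M" by (intro L2_diff g)
    have "(\<integral>\<^sup>+x. ennreal (cmod (g (Suc n) x - g n x)) \<partial>M) = ennreal (\<integral>x. cmod (g (Suc n) x - g n x) \<partial>M)"
      using integral_cmod_le_l2_norm(1)[OF d] by (intro nn_integral_eq_integral) auto
    also have "\<dots> \<le> ennreal ((1/2) ^ n)"
      using integral_cmod_le_l2_norm(2)[OF d] c[of n] by (intro ennreal_leI) auto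
    finally show "(\<integral>\<^sup>+x. ennreal (cmod (g (Suc n) x - g n x)) \<partial>M) \<le> ennreal ((1/2) ^ n)" .
  qed auto
  also have "\<dots> = ennreal (\<Sum>n. (1/2) ^ n)" by (intro suminf_ennreal_eq summable_sums summable_geometric) auto
  also have "\<dots> < \<infinity>" by simp
  finally have "(\<integral>\<^sup>+x. (\<Sum>n. ennreal (cmod (g (Suc n) x - g n x))) \<partial>M) \<noteq> \<infinity>" by simp
  then have "AE x in M. (\<Sum>n. ennreal (cmod (g (Suc n) x - g n x))) \<noteq> \<infinity>"
    by (intro nn_integral_PInf_AE) auto
  then have conv: "AE x in M. convergent (\<lambda>n. g n x)"
  proof eventually_elim
    case (elim x)
    have "summable (\<lambda>n. cmod (g (Suc n) x - g n x))"
      using elim by (intro summable_suminf_not_top) auto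
    then have "summable (\<lambda>n. g (Suc n) x - g n x)" by (rule summable_norm_cancel)
    then have "convergent (\<lambda>n. \<Sum>i<n. g (Suc i) x - g i x)"
      by (simp add: summable_iff_convergent)
    then have "convergent (\<lambda>n. g n x - g 0 x)" by (simp add: sum_lessThan_telescope[of "\<lambda>n. g n x"])
    then have "convergent (\<lambda>n. (g n x - g 0 x) + g 0 x)" by (intro convergent_add convergent_const)
    then show ?case by simp
  qed
  define G where "G x = lim (\<lambda>n. g n x)" for x
  have Gm [measurable]: "G \<in> borel_measurable M" unfolding G_def by measurable
  have step: "l2_norm M (g (n + k) - g n) \<le> 2 * (1/2) ^ n - 2 * (1/2) ^ (n + k)" for n k
  proof (induction k)
    case 0
    then show ?case by (simp add: l2_norm_def)
  next
    case (Suc k)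
    have "l2_norm M (g (Suc (n + k)) - g n) \<le> (1/2) ^ (n + k) + (2 * (1/2) ^ n - 2 * (1/2) ^ (n + k))"
      by (rule order_trans[OF l2_norm_diff_triangle[OF g g g] add_mono[OF c Suc.IH]])
    also have "\<dots> = 2 * (1/2) ^ n - 2 * (1/2) ^ Suc (n + k)" by simp
    finally show ?case by (simp only: add_Suc_right)
  qed
  have bound: "(\<integral>\<^sup>+x. ennreal ((cmod (G x - g n x))\<^sup>2) \<partial>M) \<le> ennreal ((2 * (1/2) ^ n)\<^sup>2)" for n
  proof -
    have "(\<integral>\<^sup>+x. ennreal ((cmod (G x - g n x))\<^sup>2) \<partial>M) =
        (\<integral>\<^sup>+x. liminf (\<lambda>k. ennreal ((cmod (g k x - g n x))\<^sup>2)) \<partial>M)"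
    proof (rule nn_integral_cong_AE)
      show "AE x in M. ennreal ((cmod (G x - g n x))\<^sup>2) = liminf (\<lambda>k. ennreal ((cmod (g k x - g n x))\<^sup>2))"
        using conv
      proof eventually_elim
        case (elim x)
        then have "(\<lambda>k. g k x) \<longlonglongrightarrow> G x" by (simp add: G_def convergent_LIMSEQ_iff)
        then have "(\<lambda>k. ennreal ((cmod (g k x - g n x))\<^sup>2)) \<longlonglongrightarrow> ennreal ((cmod (G x - g n x))\<^sup>2)"
          by (intro tendsto_ennrealI tendsto_intros)
        from lim_imp_Liminf[OF sequentially_bot this] show ?case by (rule sym)
      qed
    qed
    also have "\<dots> \<le> liminf (\<lambda>k. \<integral>\<^sup>+x. ennreal ((cmod (g k x - g n x))\<^sup>2) \<partial>M)"
      by (intro nn_integral_liminf) auto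
    also have "\<dots> \<le> ennreal ((2 * (1/2) ^ n)\<^sup>2)"
    proof -
      have "eventually (\<lambda>k. (\<integral>\<^sup>+x. ennreal ((cmod (g k x - g n x))\<^sup>2) \<partial>M) \<le> ennreal ((2 * (1/2) ^ n)\<^sup>2)) sequentially"
        using eventually_ge_at_top[of n]
      proof eventually_elim
        case (elim k)
        have "(\<integral>\<^sup>+x. ennreal ((cmod (g k x - g n x))\<^sup>2) \<partial>M) = ennreal ((l2_norm M (g k - g n))\<^sup>2)"
          using ennreal_l2_norm_sq[OF L2_diff[OF g[of k] g[of n]]] by simp
        also have "l2_norm M (g k - g n) \<le> 2 * (1/2) ^ n"
          using step[of n "k - n"] elim by simp (smt (verit) zero_le_power zero_le_divide_1_iff)
        then have "ennreal ((l2_norm M (g k - g n))\<^sup>2) \<le> ennreal ((2 * (1/2) ^ n)\<^sup>2)"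
          by (intro ennreal_leI power_mono l2_norm_nonneg)
        finally show ?case .
      qed
      then have "liminf (\<lambda>k. \<integral>\<^sup>+x. ennreal ((cmod (g k x - g n x))\<^sup>2) \<partial>M) \<le> limsup (\<lambda>k. \<integral>\<^sup>+x. ennreal ((cmod (g k x - g n x))\<^sup>2) \<partial>M)
         \<and> limsup (\<lambda>k. \<integral>\<^sup>+x. ennreal ((cmod (g k x - g n x))\<^sup>2) \<partial>M) \<le> ennreal ((2 * (1/2) ^ n)\<^sup>2)"
        by (intro conjI Liminf_le_Limsup Limsup_bounded) auto
      then show ?thesis by (meson order_trans)
    qed
    finally show ?thesis .
  qed
  have D: "G - g n \<in> L2 M" for n
  proof -
    have "integrable M (\<lambda>x. (cmod (G x - g n x))\<^sup>2)"
      using bound[of n] by (intro integrableI_nonneg) (auto intro: le_less_trans simp: ennreal_less_top)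
    then show ?thesis by (simp add: L2_def fun_diff_def)
  qed
  have "G = (G - g 0) + g 0" by simp
  then have "G \<in> L2 M" using L2_add[OF D g, of 0 0] by simp
  moreover have "l2_norm M (G - g n) \<le> 2 * (1/2) ^ n" for n
  proof -
    have "ennreal ((l2_norm M (G - g n))\<^sup>2) \<le> ennreal ((2 * (1/2) ^ n)\<^sup>2)"
      using bound[of n] ennreal_l2_norm_sq[OF D[of n]] by simp
    then have "(l2_norm M (G - g n))\<^sup>2 \<le> (2 * (1/2) ^ n)\<^sup>2" by (subst (asm) ennreal_le_iff) auto
    then show ?thesis by (rule power2_le_imp_le) simp
  qed
  ultimately show ?thesis by blast
qed

section \<open>Closures of subspaces and orthogonal projection\<close>

lemma l2_closure_subset: "A \<subseteq> L2 M \<Longrightarrow> A \<subseteq> l2_closure M A"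
  by (auto simp: l2_closure_def l2_norm_def intro!: bexI)

lemma l2_closure_L2: "l2_closure M A \<subseteq> L2 M"
  by (auto simp: l2_closure_def)

lemma l2_closure_subspace:
  assumes A: "cfun.subspace A" "A \<subseteq> L2 M"
  shows "cfun.subspace (l2_closure M A)"
proof (rule cfun.subspaceI)
  show "0 \<in> l2_closure M A" using l2_closure_subset[OF A(2)] cfun.subspace_0[OF A(1)] by blast
next
  fix F G assume FG: "F \<in> l2_closure M A" "G \<in> l2_closure M A"
  then have L: "F \<in> L2 M" "G \<in> L2 M" by (auto simp: l2_closure_def)
  have "\<exists>K\<in>A. l2_norm M (F + G - K) < e" if e: "e > 0" for e
  proof -
    obtain F' where F': "F' \<in> A" "l2_norm M (F - F') < e / 2" using FG e by (auto simp: l2_closure_def dest: spec[of _ "e/2"])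
    obtain G' where G': "G' \<in> A" "l2_norm M (G - G') < e / 2" using FG e by (auto simp: l2_closure_def dest: spec[of _ "e/2"])
    have "l2_norm M ((F - F') + (G - G')) \<le> l2_norm M (F - F') + l2_norm M (G - G')"
      using F' G' A L by (intro l2_norm_add_le L2_diff) auto
    moreover have "(F - F') + (G - G') = F + G - (F' + G')" by simp
    ultimately have "l2_norm M (F + G - (F' + G')) < e" using F' G' by simp
    then show ?thesis using cfun.subspace_add[OF A(1) F'(1) G'(1)] by blast
  qed
  then show "F + G \<in> l2_closure M A" using L2_add[OF L] by (simp add: l2_closure_def)
next
  fix c F assume F: "F \<in> l2_closure M A"
  then have L: "F \<in> L2 M" by (auto simp: l2_closure_def)
  have "\<exists>K\<in>A. l2_norm M (cscale c F - K) < e" if e: "e > 0" for e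
  proof -
    have "e / (cmod c + 1) > 0" using e by (intro divide_pos_pos add_nonneg_pos) auto
    then obtain F' where F': "F' \<in> A" "l2_norm M (F - F') < e / (cmod c + 1)" using F unfolding l2_closure_def by blast
    have c1: "cmod c + 1 > 0" by (simp add: add_nonneg_pos)
    have "cscale c F - cscale c F' = cscale c (F - F')" by (simp add: cscale_def fun_eq_iff algebra_simps)
    then have "l2_norm M (cscale c F - cscale c F') = cmod c * l2_norm M (F - F')" by (simp add: l2_norm_scale)
    also have "\<dots> \<le> (cmod c + 1) * l2_norm M (F - F')" by (intro mult_right_mono l2_norm_nonneg) auto
    also have "\<dots> < e" using F'(2) c1 by (simp add: pos_less_divide_eq mult.commute)
    finally show ?thesis using cfun.subspace_scale[OF A(1) F'(1)] by blast
  qed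
  then show "cscale c F \<in> l2_closure M A" using L2_scale[OF L] by (simp add: l2_closure_def)
qed

lemma l2_inner_closure_eq_0:
  assumes R: "R \<in> L2 M" and A: "A \<subseteq> L2 M" "\<And>K. K \<in> A \<Longrightarrow> l2_inner M R K = 0" and F: "F \<in> l2_closure M A"
  shows "l2_inner M R F = 0"
proof (rule ccontr)
  assume n: "l2_inner M R F \<noteq> 0"
  have FL: "F \<in> L2 M" using F by (auto simp: l2_closure_def)
  define e where "e = cmod (l2_inner M R F) / (l2_norm M R + 1)"
  have r: "l2_norm M R + 1 > 0" using l2_norm_nonneg[of R] by linarith
  have "e > 0" using n r by (simp add: e_def)
  then obtain K where K: "K \<in> A" "l2_norm M (F - K) < e" using F by (auto simp: l2_closure_def)
  have KL: "K \<in> L2 M" using K A by auto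
  have "l2_inner M R F = l2_inner M R (F - K)"
    using A(2)[OF K(1)] R FL KL by (simp add: l2_inner_diff_right)
  then have "cmod (l2_inner M R F) \<le> l2_norm M R * l2_norm M (F - K)"
    using l2_Cauchy_Schwarz[OF R L2_diff[OF FL KL]] by simp
  also have "\<dots> \<le> (l2_norm M R + 1) * l2_norm M (F - K)" by (intro mult_right_mono l2_norm_nonneg) auto
  also have "\<dots> < (l2_norm M R + 1) * e" using K r by (intro mult_strict_left_mono) auto
  also have "\<dots> = cmod (l2_inner M R F)" using r by (simp add: e_def)
  finally show False by simp
qed

text \<open>A minimising sequence in A is fast Cauchy by the parallelogram law. Its limit G lies in
  the closure of A, and minimality under perturbation by elements of A gives orthogonality.\<close>

lemma l2_projection:
  assumes A: "cfun.subspace A" "A \<subseteq> L2 M" and F: "F \<in> L2 M"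
  shows "\<exists>G\<in>l2_closure M A. \<forall>K\<in>A. l2_inner M (F - G) K = 0"
proof -
  define d where "d = (INF G\<in>A. (l2_norm M (F - G))\<^sup>2)"
  have ne: "A \<noteq> {}" using cfun.subspace_0[OF A(1)] by auto
  have bdd: "bdd_below ((\<lambda>G. (l2_norm M (F - G))\<^sup>2) ` A)" by (rule bdd_belowI2[of _ 0]) auto
  have d_le: "d \<le> (l2_norm M (F - G))\<^sup>2" if "G \<in> A" for G
    unfolding d_def using that by (intro cINF_lower bdd)
  \<comment> \<open>An excess below 4^(-n) / 4 at both \<open>g n\<close> and
    \<open>g (Suc n)\<close> bounds their squared distance by 4^(-n), the rate demanded by
    \<open>fast_Cauchy_l2_limit\<close>.\<close>
  have "\<exists>G\<in>A. (l2_norm M (F - G))\<^sup>2 < d + ((1/2) ^ n)\<^sup>2 / 4" for n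
  proof -
    have "d < d + ((1/2) ^ n)\<^sup>2 / 4" by simp
    then show ?thesis unfolding d_def using cINF_less_iff[OF ne bdd] by blast
  qed
  then obtain g where g: "\<And>n. g n \<in> A" "\<And>n. (l2_norm M (F - g n))\<^sup>2 < d + ((1/2) ^ n)\<^sup>2 / 4"
    by metis
  have gL: "g n \<in> L2 M" for n using g A by auto
  have "l2_norm M (g (Suc n) - g n) \<le> (1/2) ^ n" for n
  proof -
    define u where "u = F - g n"
    define v where "v = F - g (Suc n)"
    have uv: "u \<in> L2 M" "v \<in> L2 M" using F gL by (auto simp: u_def v_def intro: L2_diff)
    define h where "h = cscale (1/2) (g n + g (Suc n))"
    have hA: "h \<in> A" unfolding h_def by (intro cfun.subspace_scale cfun.subspace_add A g)
    have "u + v = cscale 2 (F - h)" by (simp add: u_def v_def h_def cscale_def fun_eq_iff algebra_simps)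
    then have "(l2_norm M (u + v))\<^sup>2 = 4 * (l2_norm M (F - h))\<^sup>2" by (simp add: l2_norm_scale power_mult_distrib)
    then have s: "(l2_norm M (u + v))\<^sup>2 \<ge> 4 * d" using d_le[OF hA] by simp
    have m: "cscale (-1) v \<in> L2 M" by (rule L2_scale[OF uv(2)])
    have e: "u + v = u - cscale (-1) v" by (simp add: fun_eq_iff cscale_def)
    have "(l2_norm M (u - v))\<^sup>2 + (l2_norm M (u + v))\<^sup>2 = 2 * (l2_norm M u)\<^sup>2 + 2 * (l2_norm M v)\<^sup>2"
      unfolding e l2_norm_diff_sq[OF uv(1) m] l2_norm_diff_sq[OF uv] l2_norm_scale l2_inner_scale_right
      by simp
    moreover have "(l2_norm M u)\<^sup>2 < d + ((1/2) ^ n)\<^sup>2 / 4" using g(2)[of n] by (simp add: u_def)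
    moreover have "(l2_norm M v)\<^sup>2 < d + ((1/2) ^ n)\<^sup>2 / 4"
    proof -
      have "((1/2::real) ^ Suc n)\<^sup>2 \<le> ((1/2) ^ n)\<^sup>2" by (intro power_mono) auto
      then show ?thesis using g(2)[of "Suc n"] unfolding v_def by linarith
    qed
    ultimately have "(l2_norm M (u - v))\<^sup>2 \<le> ((1/2) ^ n)\<^sup>2" using s by linarith
    then have "l2_norm M (u - v) \<le> (1/2) ^ n" by (rule power2_le_imp_le) simp
    moreover have "u - v = g (Suc n) - g n" by (simp add: u_def v_def)
    ultimately show ?thesis by simp
  qed
  from fast_Cauchy_l2_limit[OF gL this]
  obtain G where G: "G \<in> L2 M" "\<And>n. l2_norm M (G - g n) \<le> 2 * (1/2) ^ n" by blast
  have lim0: "(\<lambda>n. 2 * (1/2::real) ^ n) \<longlonglongrightarrow> 0"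
    by (intro tendsto_mult_right_zero LIMSEQ_power_zero) auto
  have "G \<in> l2_closure M A"
  proof -
    have "\<exists>K\<in>A. l2_norm M (G - K) < e" if "e > 0" for e
    proof -
      from order_tendstoD(2)[OF lim0 that] obtain n where "2 * (1/2::real) ^ n < e"
        by (auto simp: eventually_sequentially)
      then show ?thesis using G(2)[of n] g(1)[of n] by (intro bexI[of _ "g n"]) auto
    qed
    then show ?thesis using G(1) by (simp add: l2_closure_def)
  qed
  moreover have "l2_inner M (F - G) K = 0" if K: "K \<in> A" for K
  proof -
    have KL: "K \<in> L2 M" using K A by auto
    define R where "R = F - G"
    have RL: "R \<in> L2 M" using F G by (auto simp: R_def intro: L2_diff)
    define z where "z = l2_inner M R K"
    have Rd: "(l2_norm M R)\<^sup>2 \<le> d"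
    proof (rule LIMSEQ_le_const)
      have "(\<lambda>n. (sqrt (d + ((1/2) ^ n)\<^sup>2 / 4) + 2 * (1/2) ^ n)\<^sup>2) \<longlonglongrightarrow> (sqrt (d + 0\<^sup>2 / 4) + 0)\<^sup>2"
        by (intro tendsto_intros lim0 LIMSEQ_power_zero) auto
      moreover have "d \<ge> 0" unfolding d_def using ne by (intro cINF_greatest) auto
      ultimately show "(\<lambda>n. (sqrt (d + ((1/2) ^ n)\<^sup>2 / 4) + 2 * (1/2) ^ n)\<^sup>2) \<longlonglongrightarrow> d" by simp
      show "\<exists>N. \<forall>n\<ge>N. (l2_norm M R)\<^sup>2 \<le> (sqrt (d + ((1/2) ^ n)\<^sup>2 / 4) + 2 * (1/2) ^ n)\<^sup>2"
      proof (intro exI allI impI power_mono l2_norm_nonneg)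
        fix n
        have "l2_norm M R \<le> l2_norm M (F - g n) + l2_norm M (g n - G)"
          unfolding R_def by (intro l2_norm_diff_triangle F G gL)
        moreover have "l2_norm M (F - g n) \<le> sqrt (d + ((1/2) ^ n)\<^sup>2 / 4)"
          using g(2)[of n] by (intro real_le_rsqrt) simp
        ultimately show "l2_norm M R \<le> sqrt (d + ((1/2) ^ n)\<^sup>2 / 4) + 2 * (1/2) ^ n"
          using G(2)[of n] by (simp add: l2_norm_minus_commute[of "g n"])
      qed
    qed
    \<comment> \<open>G need not belong to A, so the competitor is \<open>g n + cscale c K\<close>,
      and n tends to infinity afterwards.\<close>
    have main: "2 * t * (cmod z)\<^sup>2 \<le> t\<^sup>2 * (cmod z)\<^sup>2 * (l2_norm M K)\<^sup>2" for t :: real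
    proof -
      define c where "c = of_real t * z"
      have "d \<le> (l2_norm M (R - cscale c K))\<^sup>2"
      proof (rule LIMSEQ_le_const)
        show "(\<lambda>n. (l2_norm M (R - cscale c K) + 2 * (1/2) ^ n)\<^sup>2) \<longlonglongrightarrow> (l2_norm M (R - cscale c K))\<^sup>2"
          using tendsto_power[OF tendsto_add[OF tendsto_const lim0], of "l2_norm M (R - cscale c K)" 2] by simp
        show "\<exists>N. \<forall>n\<ge>N. d \<le> (l2_norm M (R - cscale c K) + 2 * (1/2) ^ n)\<^sup>2"
        proof (intro exI allI impI)
          fix n
          have "d \<le> (l2_norm M (F - (g n + cscale c K)))\<^sup>2"
            by (intro d_le cfun.subspace_add cfun.subspace_scale A g K)
          also have "F - (g n + cscale c K) = (R - cscale c K) + (G - g n)" by (simp add: R_def)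
          also have "(l2_norm M \<dots>)\<^sup>2 \<le> (l2_norm M (R - cscale c K) + 2 * (1/2) ^ n)\<^sup>2"
          proof (intro power_mono l2_norm_nonneg)
            have "l2_norm M ((R - cscale c K) + (G - g n)) \<le> l2_norm M (R - cscale c K) + l2_norm M (G - g n)"
              by (intro l2_norm_add_le L2_diff L2_scale RL KL G gL)
            also have "\<dots> \<le> l2_norm M (R - cscale c K) + 2 * (1/2) ^ n"
              by (intro add_left_mono G(2))
            finally show "l2_norm M ((R - cscale c K) + (G - g n)) \<le> l2_norm M (R - cscale c K) + 2 * (1/2) ^ n" .
          qed
          finally show "d \<le> (l2_norm M (R - cscale c K) + 2 * (1/2) ^ n)\<^sup>2" .
        qed
      qed
      also have "(l2_norm M (R - cscale c K))\<^sup>2 = (l2_norm M R)\<^sup>2 + (cmod c * l2_norm M K)\<^sup>2 - 2 * Re (cnj c * z)"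
        using RL KL by (simp only: l2_norm_diff_sq L2_scale l2_norm_scale l2_inner_scale_right z_def)
      also have "Re (cnj c * z) = t * (cmod z)\<^sup>2"
        unfolding c_def by (simp add: cmod_power2) (simp add: power2_eq_square algebra_simps)
      finally show ?thesis using Rd by (simp add: c_def norm_mult power_mult_distrib algebra_simps)
    qed
    \<comment> \<open>The added 1 keeps t = 1 / b meaningful when K has norm 0.\<close>
    define b where "b = (l2_norm M K)\<^sup>2 + 1"
    have b: "b > 0" by (simp add: b_def add_nonneg_pos)
    have "2 * (1 / b) * (cmod z)\<^sup>2 \<le> (1 / b)\<^sup>2 * (cmod z)\<^sup>2 * b"
      using main[of "1 / b"] by (rule order_trans) (auto simp: b_def intro!: mult_left_mono)
    also have "\<dots> = (1 / b) * (cmod z)\<^sup>2" using b by (simp add: power2_eq_square)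
    finally have "(1 / b) * (cmod z)\<^sup>2 \<le> 0" by simp
    then have "(cmod z)\<^sup>2 \<le> 0" using b by (simp add: divide_le_0_iff)
    then show ?thesis by (simp add: z_def R_def)
  qed
  ultimately show ?thesis by blast
qed

lemma measure_preserving_L2:
  assumes T: "T \<in> M \<rightarrow>\<^sub>M M" "distr M M T = M"
  shows "F \<in> L2 M \<Longrightarrow> F \<circ> T \<in> L2 M"
    and "F \<in> L2 M \<Longrightarrow> G \<in> L2 M \<Longrightarrow> l2_inner M (F \<circ> T) (G \<circ> T) = l2_inner M F G"
    and "F \<in> L2 M \<Longrightarrow> l2_norm M (F \<circ> T) = l2_norm M F"
proof -
  note [measurable] = T(1)
  show 1: "F \<circ> T \<in> L2 M" if F: "F \<in> L2 M" for F
  proof -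
    have [measurable]: "F \<in> borel_measurable M" using F by (auto simp: L2_def)
    have "integrable (distr M M T) (\<lambda>x. (cmod (F x))\<^sup>2)" using F by (simp add: T L2_def)
    then have "integrable M (\<lambda>x. (cmod (F (T x)))\<^sup>2)" by (subst (asm) integrable_distr_eq) auto
    moreover have "F \<circ> T \<in> borel_measurable M" by (rule measurable_comp[OF T(1)]) simp
    ultimately show ?thesis by (simp add: L2_def)
  qed
  show 2: "l2_inner M (F \<circ> T) (G \<circ> T) = l2_inner M F G" if FG: "F \<in> L2 M" "G \<in> L2 M" for F G
  proof -
    have "(\<lambda>x. F x * cnj (G x)) \<in> borel_measurable M"
      using l2_mult_integrable[OF FG] by (rule borel_measurable_integrable)
    then have "(\<integral>x. F x * cnj (G x) \<partial>distr M M T) = (\<integral>x. F (T x) * cnj (G (T x)) \<partial>M)"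
      by (intro integral_distr T(1))
    then show ?thesis by (simp add: l2_inner_def T)
  qed
  show "l2_norm M (F \<circ> T) = l2_norm M F" if F: "F \<in> L2 M"
  proof -
    have "complex_of_real ((l2_norm M (F \<circ> T))\<^sup>2) = of_real ((l2_norm M F)\<^sup>2)"
      using 2[OF F F] by (simp only: l2_inner_self)
    then have "(l2_norm M (F \<circ> T))\<^sup>2 = (l2_norm M F)\<^sup>2" by (simp only: of_real_eq_iff)
    then show ?thesis by (simp add: power2_eq_iff_nonneg l2_norm_nonneg)
  qed
qed

end

section \<open>Joint eigenfunctions and coboundaries\<close>

sublocale fg_multiplicative_system \<subseteq> prime_coloring S
  by unfold_locales (rule finitely_generated)

context fg_multiplicative_system
begin

section \<open>The action on square-integrable functions, big generators and characters\<close>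

lemma S_comp: "n \<ge> 1 \<Longrightarrow> m \<ge> 1 \<Longrightarrow> F \<circ> S (n * m) = F \<circ> S n \<circ> S m"
  by (simp add: S_mult o_assoc)

lemma S_1: "S 1 = id"
proof -
  have "S 1 (S 1 x) = S 1 x" for x using S_mult[of 1 1] by (simp add: fun_eq_iff)
  moreover have "inj (S 1)" using S_bij[of 1] by (simp add: bij_is_inj)
  ultimately show ?thesis by (auto simp: inj_def fun_eq_iff)
qed

lemma S_L2: "n \<ge> 1 \<Longrightarrow> F \<in> L2 M \<Longrightarrow> F \<circ> S n \<in> L2 M"
  by (intro measure_preserving_L2 S_measurable S_measure_preserving)

lemma S_inner: "n \<ge> 1 \<Longrightarrow> F \<in> L2 M \<Longrightarrow> G \<in> L2 M \<Longrightarrow> l2_inner M (F \<circ> S n) (G \<circ> S n) = l2_inner M F G"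
  by (intro measure_preserving_L2 S_measurable S_measure_preserving)

lemma S_norm: "n \<ge> 1 \<Longrightarrow> F \<in> L2 M \<Longrightarrow> l2_norm M (F \<circ> S n) = l2_norm M F"
  by (intro measure_preserving_L2 S_measurable S_measure_preserving)

definition gens :: "('a \<Rightarrow> 'a) set" where
  "gens = S ` {p. prime p}"

definition big_gens :: "('a \<Rightarrow> 'a) set" where
  "big_gens = {c \<in> gens. diverges (\<lambda>p. 1 / real p) {p. prime p \<and> S p = c}}"

lemma finite_gens: "finite gens" "finite big_gens"
  using finitely_generated by (auto simp: gens_def big_gens_def)

lemma big_gens_E:
  assumes "c \<in> big_gens"
  obtains p where "prime p" "p \<ge> 1" "S p = c" "diverges (\<lambda>q. 1 / real q) {q. prime q \<and> S q = S p}"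
  using assms that by (auto simp: big_gens_def gens_def Suc_le_eq prime_gt_0_nat)

text \<open>Coordinates are indexed by all maps, but only those in \<open>gens\<close> enter
  \<open>chr\<close>, so compactness concerns finitely many coordinates.\<close>

definition torus :: "(('a \<Rightarrow> 'a) \<Rightarrow> complex) set" where
  "torus = {z. \<forall>c. cmod (z c) = 1}"

lemma torus_norm: "z \<in> torus \<Longrightarrow> cmod (z c) = 1"
  by (simp add: torus_def)

text \<open>The completely multiplicative function with value \<open>z (S p)\<close> at each prime
  p, or equivalently a character of the vector of colour exponents.\<close>

definition chr :: "(('a \<Rightarrow> 'a) \<Rightarrow> complex) \<Rightarrow> nat \<Rightarrow> complex" where
  "chr z n = prod_mset (image_mset (\<lambda>p. z (S p)) (prime_factorization n))"

lemma chr_mult: "n \<ge> 1 \<Longrightarrow> m \<ge> 1 \<Longrightarrow> chr z (n * m) = chr z n * chr z m"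
  by (simp add: chr_def prime_factorization_mult)

lemma chr_prime: "prime p \<Longrightarrow> chr z p = z (S p)"
  by (simp add: chr_def prime_factorization_prime)

lemma chr_1 [simp]: "chr z (Suc 0) = 1"
  by (simp add: chr_def)

lemma chr_norm:
  assumes "z \<in> torus"
  shows "cmod (chr z n) = 1"
proof -
  have "cmod (prod_mset (image_mset (\<lambda>p. z (S p)) A)) = 1" for A
    by (induction A) (auto simp: norm_mult torus_norm[OF assms])
  then show ?thesis by (simp add: chr_def)
qed

lemma chr_cnj: "z \<in> torus \<Longrightarrow> chr z n * cnj (chr z n) = 1"
  by (simp add: complex_norm_square[symmetric] chr_norm)

lemma chr_Mc_fg:
  assumes "z \<in> torus"
  shows "chr z \<in> Mc_fg"
proof -
  have "chr z ` {p. prime p} \<subseteq> z ` gens" by (auto simp: chr_prime gens_def)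
  then have "finite (chr z ` {p. prime p})" using finite_gens(1) finite_subset by blast
  then show ?thesis by (simp add: Mc_fg_def chr_norm[OF assms] chr_mult)
qed

text \<open>The eigenvalue equations hold up to null sets. Only big generators are tested, so the
  other coordinates of z are free.\<close>

definition eigsp :: "(('a \<Rightarrow> 'a) \<Rightarrow> complex) \<Rightarrow> ('a \<Rightarrow> complex) set" where
  "eigsp z = {F \<in> L2 M. \<forall>c\<in>big_gens. l2_norm M ((F \<circ> c) - cscale (z c) F) = 0}"

text \<open>Primes of big colours contribute 0. Each of the finitely many other colours has bounded
  reciprocal sums, and every norm in the series is at most twice that of F.\<close>

lemma eigsp_subset_H_char:
  assumes z: "z \<in> torus"
  shows "eigsp z \<subseteq> H_char M S (chr z)"
proof
  fix F assume F: "F \<in> eigsp z"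
  then have FL: "F \<in> L2 M" by (simp add: eigsp_def)
  define w where "w p = (l2_norm M ((F \<circ> S p) - cscale (chr z p) F))\<^sup>2 / real p" for p
  have w0: "w p \<ge> 0" for p by (simp add: w_def)
  have "\<exists>B. \<forall>Q\<subseteq>{p. prime p \<and> S p = c}. finite Q \<longrightarrow> sum w Q \<le> B" if c: "c \<in> gens" for c
  proof (cases "c \<in> big_gens")
    case True
    have "sum w Q = 0" if "Q \<subseteq> {p. prime p \<and> S p = c}" for Q
    proof (intro sum.neutral ballI)
      fix p assume "p \<in> Q"
      then have p: "prime p" "S p = c" using that by auto
      then show "w p = 0" using F True by (simp add: w_def eigsp_def chr_prime)
    qed
    then show ?thesis by (intro exI[of _ 0]) auto
  next
    case False
    then obtain B where B: "\<And>Q. Q \<subseteq> {p. prime p \<and> S p = c} \<Longrightarrow> finite Q \<Longrightarrow> (\<Sum>p\<in>Q. 1 / real p) < B"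
      using c unfolding big_gens_def diverges_def by (auto simp: not_le) 
    define K where "K = (2 * l2_norm M F)\<^sup>2"
    have "w p \<le> K * (1 / real p)" if "prime p" for p
    proof -
      have p1: "p \<ge> 1" using that by (simp add: Suc_le_eq prime_gt_0_nat)
      have "l2_norm M ((F \<circ> S p) - cscale (chr z p) F) \<le> l2_norm M ((F \<circ> S p) - 0) + l2_norm M (0 - cscale (chr z p) F)"
        by (intro l2_norm_diff_triangle S_L2 p1 FL L2_0 L2_scale)
      also have "\<dots> = 2 * l2_norm M F"
        using S_norm[OF p1 FL] chr_norm[OF z, of p] by (simp only: diff_0_right diff_0 l2_norm_uminus l2_norm_scale)
      finally have "(l2_norm M ((F \<circ> S p) - cscale (chr z p) F))\<^sup>2 \<le> K"
        unfolding K_def by (intro power_mono l2_norm_nonneg)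
      then show ?thesis using p1 by (simp add: w_def divide_right_mono)
    qed
    then have "sum w Q \<le> K * B" if "Q \<subseteq> {p. prime p \<and> S p = c}" "finite Q" for Q
    proof -
      have "sum w Q \<le> (\<Sum>p\<in>Q. K * (1 / real p))" using that \<open>\<And>p. prime p \<Longrightarrow> w p \<le> K * (1 / real p)\<close>
        by (intro sum_mono) auto
      also have "\<dots> = K * (\<Sum>p\<in>Q. 1 / real p)" by (simp only: sum_distrib_left)
      also have "\<dots> \<le> K * B" using B[OF that] by (intro mult_left_mono) (auto simp: K_def)
      finally show ?thesis .
    qed
    then show ?thesis by blast
  qed
  then obtain B where B: "\<And>c Q. c \<in> gens \<Longrightarrow> Q \<subseteq> {p. prime p \<and> S p = c} \<Longrightarrow> finite Q \<Longrightarrow> sum w Q \<le> B c"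
    by metis
  have "w summable_on {p. prime p}"
  proof (rule nonneg_bdd_above_summable_on)
    show "bdd_above (sum w ` {Q. Q \<subseteq> {p. prime p} \<and> finite Q})"
    proof (rule bdd_aboveI2)
      fix Q :: "nat set" assume Q: "Q \<in> {Q. Q \<subseteq> {p. prime p} \<and> finite Q}"
      have "sum w Q = (\<Sum>c\<in>gens. sum w {p\<in>Q. S p = c})"
        using Q finite_gens by (subst sum.group) (auto simp: gens_def)
      also have "\<dots> \<le> (\<Sum>c\<in>gens. B c)"
      proof (rule sum_mono)
        fix c assume "c \<in> gens"
        then show "sum w {p\<in>Q. S p = c} \<le> B c" using Q by (intro B) auto
      qed
      finally show "sum w Q \<le> (\<Sum>c\<in>gens. B c)" .
    qed
  qed (use w0 in auto)
  then show "F \<in> H_char M S (chr z)" using FL by (simp add: H_char_def w_def[abs_def])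
qed

text \<open>Within a big colour f may take several values, but finitely many, so some value t is
  taken on primes with divergent reciprocals. On these primes the norms in the series coincide, and
  convergence forces them to be 0. Thus t is the eigenvalue, even if f is not constant on the
  colour.\<close>

lemma H_char_subset_eigsp:
  assumes f: "f \<in> Mc_fg" and F: "F \<in> H_char M S f"
  shows "\<exists>z\<in>torus. F \<in> eigsp z"
proof -
  have FL: "F \<in> L2 M" using F by (simp add: H_char_def)
  define w where "w p = (l2_norm M ((F \<circ> S p) - cscale (f p) F))\<^sup>2 / real p" for p
  have w0: "w p \<ge> 0" for p by (simp add: w_def)
  have sm: "w summable_on {p. prime p}" using F by (simp add: H_char_def w_def[abs_def])
  have "\<exists>t. cmod t = 1 \<and> l2_norm M ((F \<circ> c) - cscale t F) = 0" if c: "c \<in> big_gens" for c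
  proof -
    define P where "P = {p. prime p \<and> S p = c}"
    have dv: "diverges (\<lambda>p. 1 / real p) P" using c by (simp add: big_gens_def P_def)
    have "f ` P \<subseteq> f ` {p. prime p}" by (auto simp: P_def)
    then have "finite (f ` P)" using f finite_subset by (auto simp: Mc_fg_def)
    from diverges_pigeonhole[OF dv this]
    obtain t where t: "t \<in> f ` P" "diverges (\<lambda>p. 1 / real p) {p\<in>P. f p = t}" by blast
    have "cmod t = 1" using t(1) f by (auto simp: Mc_fg_def P_def Suc_le_eq prime_gt_0_nat)
    moreover have "l2_norm M ((F \<circ> c) - cscale t F) = 0"
    proof (rule ccontr)
      define d where "d = (l2_norm M ((F \<circ> c) - cscale t F))\<^sup>2"
      assume "l2_norm M ((F \<circ> c) - cscale t F) \<noteq> 0"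
      then have d: "d > 0" by (simp add: d_def)
      obtain Q where Q: "Q \<subseteq> {p\<in>P. f p = t}" "finite Q"
         "(\<Sum>p\<in>Q. 1 / real p) \<ge> (infsum w {p. prime p} + 1) / d"
        using t(2) unfolding diverges_def by blast
      have "infsum w {p. prime p} + 1 \<le> d * (\<Sum>p\<in>Q. 1 / real p)"
        using Q(3) d by (simp add: pos_divide_le_eq mult.commute)
      also have "\<dots> = sum w Q"
        unfolding sum_distrib_left by (intro sum.cong refl) (use Q(1) in \<open>auto simp: w_def d_def P_def\<close>)
      also have "\<dots> \<le> infsum w {p. prime p}"
        using Q w0 by (intro finite_sum_le_infsum sm) (auto simp: P_def)
      finally show False by simp
    qed
    ultimately show ?thesis by blast
  qed
  then obtain z where z: "\<And>c. c \<in> big_gens \<Longrightarrow> cmod (z c) = 1 \<and> l2_norm M ((F \<circ> c) - cscale (z c) F) = 0"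
    by metis
  have "(\<lambda>c. if c \<in> big_gens then z c else 1) \<in> torus" using z by (auto simp: torus_def)
  moreover have "F \<in> eigsp (\<lambda>c. if c \<in> big_gens then z c else 1)" using z FL by (simp add: eigsp_def)
  ultimately show ?thesis by blast
qed

text \<open>The inner product is conjugate linear in its second argument, so with the conjugated
  twist every F satisfying F \<circ> c = t F is orthogonal to all \<open>cob t c G\<close>.\<close>

definition cob :: "complex \<Rightarrow> ('a \<Rightarrow> 'a) \<Rightarrow> ('a \<Rightarrow> complex) \<Rightarrow> 'a \<Rightarrow> complex" where
  "cob t c G = cscale (cnj t) (G \<circ> c) - G"

definition Cob :: "(('a \<Rightarrow> 'a) \<Rightarrow> complex) \<Rightarrow> ('a \<Rightarrow> complex) set" where
  "Cob z = {(\<Sum>c\<in>big_gens. cob (z c) c (G c)) | G. \<forall>c\<in>big_gens. G c \<in> L2 M}"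

lemma big_gens_L2: "c \<in> big_gens \<Longrightarrow> G \<in> L2 M \<Longrightarrow> G \<circ> c \<in> L2 M"
  by (erule big_gens_E) (auto intro: S_L2)

lemma cob_L2: "c \<in> big_gens \<Longrightarrow> G \<in> L2 M \<Longrightarrow> cob t c G \<in> L2 M"
  unfolding cob_def by (intro L2_diff L2_scale big_gens_L2)

lemma Cob_L2: "Cob z \<subseteq> L2 M"
  by (auto simp: Cob_def intro!: L2_sum cob_L2)

lemma subspace_Cob: "cfun.subspace (Cob z)"
proof (rule cfun.subspaceI)
  have "cob t c 0 = 0" for t c by (simp add: cob_def cscale_def fun_eq_iff)
  then have "(\<Sum>c\<in>big_gens. cob (z c) c 0) = 0" by simp
  then show "0 \<in> Cob z" unfolding Cob_def using L2_0 by (intro CollectI exI[of _ "\<lambda>_. 0"]) auto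
next
  fix F K assume "F \<in> Cob z" "K \<in> Cob z"
  then obtain G H where G: "F = (\<Sum>c\<in>big_gens. cob (z c) c (G c))" "\<forall>c\<in>big_gens. G c \<in> L2 M"
    and H: "K = (\<Sum>c\<in>big_gens. cob (z c) c (H c))" "\<forall>c\<in>big_gens. H c \<in> L2 M"
    unfolding Cob_def by blast
  have "cob (z c) c (G c + H c) = cob (z c) c (G c) + cob (z c) c (H c)" for c
    by (simp add: cob_def cscale_def fun_eq_iff algebra_simps)
  then have "F + K = (\<Sum>c\<in>big_gens. cob (z c) c (G c + H c))" by (simp only: G H sum.distrib)
  then show "F + K \<in> Cob z" unfolding Cob_def using G H L2_add by (intro CollectI exI[of _ "\<lambda>c. G c + H c"]) auto
next
  fix a F assume "F \<in> Cob z"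
  then obtain G where G: "F = (\<Sum>c\<in>big_gens. cob (z c) c (G c))" "\<forall>c\<in>big_gens. G c \<in> L2 M"
    unfolding Cob_def by blast
  have "cob (z c) c (cscale a (G c)) = cscale a (cob (z c) c (G c))" for c
    by (simp add: cob_def cscale_def fun_eq_iff algebra_simps)
  then have "cscale a F = (\<Sum>c\<in>big_gens. cob (z c) c (cscale a (G c)))" by (simp only: G cfun.scale_sum_right)
  then show "cscale a F \<in> Cob z" unfolding Cob_def using G L2_scale by (intro CollectI exI[of _ "\<lambda>c. cscale a (G c)"]) auto
qed

text \<open>It suffices to test against the coboundary of R itself:
  \<open>z c * l2_inner M R (R \<circ> c)\<close> equals the squared norm of R. This is the equality
  case of Cauchy-Schwarz, so \<open>R \<circ> c\<close> and \<open>cscale (z c) R\<close> have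
  distance 0.\<close>

lemma orthogonal_Cob_eigsp:
  assumes z: "z \<in> torus" and R: "R \<in> L2 M" "\<And>K. K \<in> Cob z \<Longrightarrow> l2_inner M R K = 0"
  shows "R \<in> eigsp z"
proof -
  have "l2_norm M ((R \<circ> c) - cscale (z c) R) = 0" if c: "c \<in> big_gens" for c
  proof -
    have Rc: "R \<circ> c \<in> L2 M" using big_gens_L2[OF c R(1)] .
    have nc: "l2_norm M (R \<circ> c) = l2_norm M R" using c S_norm[OF _ R(1)] by (auto elim!: big_gens_E)
    define G where "G d = (if d = c then R else 0)" for d
    have "cob t d 0 = 0" for t d by (simp add: cob_def cscale_def fun_eq_iff)
    then have "(\<Sum>d\<in>big_gens. cob (z d) d (G d)) = (\<Sum>d\<in>big_gens. if d = c then cob (z c) c R else 0)"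
      by (intro sum.cong) (auto simp: G_def)
    also have "\<dots> = cob (z c) c R" using c finite_gens by simp
    finally have "cob (z c) c R \<in> Cob z" unfolding Cob_def using R(1) L2_0
      by (intro CollectI exI[of _ G]) (auto simp: G_def)
    then have "l2_inner M R (cob (z c) c R) = 0" by (rule R(2))
    then have e: "z c * l2_inner M R (R \<circ> c) = of_real ((l2_norm M R)\<^sup>2)"
      unfolding cob_def using R(1) Rc
      by (simp only: l2_inner_diff_right L2_scale l2_inner_scale_right l2_inner_self) simp
    have "l2_inner M (R \<circ> c) (cscale (z c) R) = cnj (z c * l2_inner M R (R \<circ> c))"
      by (simp add: l2_inner_scale_right l2_inner_commute[of "R \<circ> c" R])
    also have "\<dots> = of_real ((l2_norm M R)\<^sup>2)" unfolding e by simp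
    finally have "Re (l2_inner M (R \<circ> c) (cscale (z c) R)) = (l2_norm M R)\<^sup>2" by simp
    then have "(l2_norm M ((R \<circ> c) - cscale (z c) R))\<^sup>2 = 0"
      using l2_norm_diff_sq[OF Rc L2_scale[OF R(1), of "z c"]] torus_norm[OF z, of c]
      by (simp add: nc l2_norm_scale)
    then show ?thesis by simp
  qed
  then show ?thesis using R(1) by (simp add: eigsp_def)
qed

lemma l2_inner_eq_if_norm_diff_0:
  assumes "F \<in> L2 M" "F' \<in> L2 M" "G \<in> L2 M" "l2_norm M (F - F') = 0"
  shows "l2_inner M F G = l2_inner M F' G"
proof -
  have "cmod (l2_inner M (F - F') G) \<le> 0"
    using l2_Cauchy_Schwarz[OF L2_diff[OF assms(1,2)] assms(3)] assms(4) by simp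
  then show ?thesis using assms by (simp add: l2_inner_diff_left)
qed

lemma eigsp_orthogonal_Cob:
  assumes z: "z \<in> torus" and F: "F \<in> eigsp z" and K: "K \<in> Cob z"
  shows "l2_inner M F K = 0"
proof -
  have FL: "F \<in> L2 M" using F by (simp add: eigsp_def)
  obtain G where G: "K = (\<Sum>c\<in>big_gens. cob (z c) c (G c))" "\<forall>c\<in>big_gens. G c \<in> L2 M"
    using K unfolding Cob_def by blast
  have "l2_inner M F (cob (z c) c (G c)) = 0" if c: "c \<in> big_gens" for c
  proof -
    have L: "G c \<in> L2 M" "G c \<circ> c \<in> L2 M" "F \<circ> c \<in> L2 M" using G(2) c FL big_gens_L2 by auto
    have "l2_inner M (F \<circ> c) (G c \<circ> c) = l2_inner M (cscale (z c) F) (G c \<circ> c)"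
      using F c by (intro l2_inner_eq_if_norm_diff_0 L L2_scale FL) (simp add: eigsp_def)
    moreover have "l2_inner M (F \<circ> c) (G c \<circ> c) = l2_inner M F (G c)"
      using c S_inner[OF _ FL L(1)] by (auto elim!: big_gens_E)
    ultimately have "z c * l2_inner M F (G c \<circ> c) = l2_inner M F (G c)" by (simp add: l2_inner_scale_left)
    then show ?thesis unfolding cob_def using FL L
      by (simp only: l2_inner_diff_right L2_scale l2_inner_scale_right) simp
  qed
  then show ?thesis unfolding G(1) using G(2) FL by (subst l2_inner_sum_right) (auto intro: cob_L2)
qed

text \<open>The residue of F after projection to the coboundaries lies in \<open>eigsp z\<close>. It
  is orthogonal to F by assumption and to the projection by construction, hence has norm 0.\<close>

lemma orthogonal_eigsp_closure_Cob:
  assumes z: "z \<in> torus" and F: "F \<in> L2 M" "\<And>K. K \<in> eigsp z \<Longrightarrow> l2_inner M F K = 0"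
  shows "F \<in> l2_closure M (Cob z)"
proof -
  obtain G where G: "G \<in> l2_closure M (Cob z)" "\<And>K. K \<in> Cob z \<Longrightarrow> l2_inner M (F - G) K = 0"
    using l2_projection[OF subspace_Cob Cob_L2 F(1)] by blast
  have GL: "G \<in> L2 M" using G by (auto simp: l2_closure_def)
  define R where "R = F - G"
  have R: "R \<in> L2 M" unfolding R_def by (intro L2_diff F GL)
  have "R \<in> eigsp z" using G(2) R by (intro orthogonal_Cob_eigsp z) (auto simp: R_def)
  then have "l2_inner M F R = 0" by (rule F(2))
  moreover have "l2_inner M R G = 0" using G R by (intro l2_inner_closure_eq_0[OF R Cob_L2 _ G(1)]) (auto simp: R_def)
  then have "l2_inner M G R = 0" by (simp add: l2_inner_commute[of G R])
  ultimately have "l2_inner M R R = 0" using l2_inner_diff_left[OF F(1) GL R] by (simp add: R_def)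
  then have R0: "l2_norm M (F - G) = 0" by (simp add: l2_inner_self R_def)
  have "\<exists>K\<in>Cob z. l2_norm M (F - K) < e" if e: "e > 0" for e
  proof -
    obtain K where K: "K \<in> Cob z" "l2_norm M (G - K) < e" using G(1) e by (auto simp: l2_closure_def)
    have "l2_norm M (F - K) \<le> l2_norm M (F - G) + l2_norm M (G - K)"
      using K(1) Cob_L2 by (intro l2_norm_diff_triangle F GL) auto
    then have "l2_norm M (F - K) < e" using K R0 by linarith
    then show ?thesis using K(1) by blast
  qed
  then show ?thesis using F(1) by (simp add: l2_closure_def)
qed

section \<open>Averages along coboundaries\<close>

definition good :: "nat \<Rightarrow> bool" where
  "good n \<longleftrightarrow> (\<forall>p\<in>prime_factors n. S p \<in> big_gens)"

lemma good_mult_prime: "prime p \<Longrightarrow> m \<ge> 1 \<Longrightarrow> good (p * m) \<longleftrightarrow> S p \<in> big_gens \<and> good m"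
  by (auto simp: good_def prime_factors_product prime_factorization_prime)

text \<open>The value at p m depends on p only through \<open>S p\<close>, because the twist and the
  transformations are both multiplicative. Division by B normalises the bound to 1. The 0-1 sequence
  a allows averages over all integers or over the good ones.\<close>

lemma inner_Phi:
  assumes z: "z \<in> torus" and GK: "G \<in> L2 M" "K \<in> L2 M" and B: "B > 0" "l2_norm M G * l2_norm M K \<le> B"
    and a: "\<And>n. a n \<in> {0, 1::complex}"
       "\<And>p p' m. prime p \<Longrightarrow> prime p' \<Longrightarrow> S p = S p' \<Longrightarrow> m \<ge> 1 \<Longrightarrow> a (p * m) = a (p' * m)"
  shows "(\<lambda>n. a n * (cnj (chr z n) * l2_inner M (G \<circ> S n) K) / of_real B) \<in> Phi"
  unfolding Phi_def
proof (intro CollectI conjI allI impI)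
  fix n :: nat assume n: "n \<ge> 1"
  have "cmod (l2_inner M (G \<circ> S n) K) \<le> B"
    using l2_Cauchy_Schwarz[OF S_L2[OF n GK(1)] GK(2)] S_norm[OF n GK(1)] B(2) by simp
  then have "cmod (a n) * (1 * cmod (l2_inner M (G \<circ> S n) K)) \<le> 1 * (1 * B)"
    using a(1)[of n] by (intro mult_mono) auto
  then show "cmod (a n * (cnj (chr z n) * l2_inner M (G \<circ> S n) K) / of_real B) \<le> 1"
    using B(1) by (simp add: norm_mult norm_divide chr_norm[OF z] divide_le_eq)
next
  fix p p' m :: nat assume p: "prime p" "prime p'" "S p = S p'" "m \<ge> 1"
  have "p \<ge> 1" "p' \<ge> 1" using p by (auto simp: Suc_le_eq prime_gt_0_nat)
  then show "a (p * m) * (cnj (chr z (p * m)) * l2_inner M (G \<circ> S (p * m)) K) / of_real B =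
     a (p' * m) * (cnj (chr z (p' * m)) * l2_inner M (G \<circ> S (p' * m)) K) / of_real B"
    using p a(2)[OF p] by (simp add: S_mult chr_mult chr_prime)
qed

text \<open>The coboundary of \<open>c\<close> telescopes against the asymptotic invariance of averages under dilation
  by primes \<open>p\<close> with \<open>S p = c\<close>.\<close>

lemma cob_average_small:
  assumes c: "c \<in> big_gens" and G: "G \<in> L2 M" and e: "e > 0"
    and a: "\<And>n. a n \<in> {0, 1::complex}"
       "\<And>p p' m. prime p \<Longrightarrow> prime p' \<Longrightarrow> S p = S p' \<Longrightarrow> m \<ge> 1 \<Longrightarrow> a (p * m) = a (p' * m)"
       "\<And>p m. prime p \<Longrightarrow> S p = c \<Longrightarrow> m \<ge> 1 \<Longrightarrow> a (p * m) = a m"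
  shows "\<forall>\<^sub>F N in sequentially. \<forall>z\<in>torus. \<forall>K\<in>L2 M.
     cmod ((\<Sum>n=1..N. a n * (cnj (chr z n) * l2_inner M (cob (z c) c G \<circ> S n) K)) / of_nat N)
       \<le> e * (l2_norm M K)"
proof -
  obtain p where p: "prime p" "p \<ge> 1" "S p = c" "diverges (\<lambda>q. 1 / real q) {q. prime q \<and> S q = S p}"
    using c by (rule big_gens_E)
  define b where "b = l2_norm M G + 1"
  have b: "b > 0" using l2_norm_nonneg[of G] by (simp add: b_def)
  have "\<forall>\<^sub>F x in at_top. \<forall>f\<in>Phi. cmod (avg (\<lambda>m. f (p * m)) x - avg f x) \<le> e / b"
    using e b by (intro avg_shift_invariant p(1,4)) auto
  from eventually_compose_filterlim[OF this filterlim_real_sequentially]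
  show ?thesis
  proof (rule eventually_mono)
    fix N assume N: "\<forall>f\<in>Phi. cmod (avg (\<lambda>m. f (p * m)) (real N) - avg f (real N)) \<le> e / b"
    show "\<forall>z\<in>torus. \<forall>K\<in>L2 M.
     cmod ((\<Sum>n=1..N. a n * (cnj (chr z n) * l2_inner M (cob (z c) c G \<circ> S n) K)) / of_nat N)
       \<le> e * (l2_norm M K)"
    proof (intro ballI)
      fix z K assume z: "z \<in> torus" and K: "K \<in> L2 M"
      define T where "T = (\<Sum>n=1..N. a n * (cnj (chr z n) * l2_inner M (cob (z c) c G \<circ> S n) K)) / of_nat N"
      show "cmod T \<le> e * l2_norm M K"
      \<comment> \<open>For K of norm 0 the normalisation B below would vanish; Cauchy-Schwarz
        settles this case.\<close>
      proof (cases "l2_norm M K = 0")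
        case True
        have "l2_inner M (cob (z c) c G \<circ> S n) K = 0" if "n \<ge> 1" for n
          using l2_Cauchy_Schwarz[OF S_L2[OF that cob_L2[OF c G]] K] True by simp
        then have "T = 0" unfolding T_def by simp
        then show ?thesis using True by simp
      next
        case False
        then have Kp: "l2_norm M K > 0" using l2_norm_nonneg[of K] by simp
        define B where "B = b * l2_norm M K"
        have B: "B > 0" "l2_norm M G * l2_norm M K \<le> B"
          using b Kp by (auto simp: B_def b_def intro!: mult_right_mono)
        define f where "f n = a n * (cnj (chr z n) * l2_inner M (G \<circ> S n) K) / of_real B" for n
        have fPhi: "f \<in> Phi" unfolding f_def by (intro inner_Phi z G K B a(1,2))
        have "T = of_real B * (avg (\<lambda>m. f (p * m)) (real N) - avg f (real N))"
        proof -
          have "a n * (cnj (chr z n) * l2_inner M (cob (z c) c G \<circ> S n) K) = of_real B * (f (p * n) - f n)" if n: "n \<ge> 1" for n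
          proof -
            have L: "G \<circ> S (p * n) \<in> L2 M" "G \<circ> S n \<in> L2 M"
              using n p(2) by (auto intro!: S_L2 G simp: Suc_le_eq)
            have "cob (z c) c G \<circ> S n = cscale (cnj (z c)) (G \<circ> S (p * n)) - (G \<circ> S n)"
              using n p by (simp add: cob_def S_mult fun_eq_iff cscale_def)
            then have e1: "l2_inner M (cob (z c) c G \<circ> S n) K =
              cnj (z c) * l2_inner M (G \<circ> S (p * n)) K - l2_inner M (G \<circ> S n) K"
              using L K by (simp add: l2_inner_diff_left L2_scale l2_inner_scale_left)
            \<comment> \<open>Passing from n to p n, the conjugated twist produces exactly the
              factor \<open>cnj (z c)\<close> of the coboundary, so each summand is a multiple of
              \<open>f (p * n) - f n\<close>.\<close>
            have e2: "chr z (p * n) = z c * chr z n" using n p by (simp add: chr_mult chr_prime)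
            have e3: "a (p * n) = a n" using a(3) p n by simp
            show ?thesis unfolding f_def e1 e2 e3 using B(1)
              by (simp add: algebra_simps diff_divide_distrib)
          qed
          then have "T = (\<Sum>n=1..N. of_real B * (f (p * n) - f n)) / of_nat N"
            unfolding T_def by (intro arg_cong2[of _ _ _ _ "(/)"] sum.cong refl) auto
          also have "\<dots> = of_real B * (avg (\<lambda>m. f (p * m)) (real N) - avg f (real N))"
            by (simp add: avg_def sum_distrib_left[symmetric] sum_subtractf)
              (simp only: times_divide_eq_right[symmetric] diff_divide_distrib)
          finally show ?thesis .
        qed
        then have "cmod T = B * cmod (avg (\<lambda>m. f (p * m)) (real N) - avg f (real N))"
          using B(1) by (simp add: norm_mult)
        also have "\<dots> \<le> B * (e / b)" using N fPhi B(1) by (intro mult_left_mono) auto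
        also have "\<dots> = e * l2_norm M K" using b by (simp add: B_def)
        finally show ?thesis .
      qed
    qed
  qed
qed

section \<open>Twisted averages as vectors\<close>

definition Av :: "(('a \<Rightarrow> 'a) \<Rightarrow> complex) \<Rightarrow> nat \<Rightarrow> ('a \<Rightarrow> complex) \<Rightarrow> 'a \<Rightarrow> complex" where
  "Av z N G = (\<Sum>n=1..N. cscale (cnj (chr z n) / of_nat N) (G \<circ> S n))"

lemma Av_L2: "G \<in> L2 M \<Longrightarrow> Av z N G \<in> L2 M"
  unfolding Av_def by (intro L2_sum L2_scale S_L2) auto

lemma Av_inner:
  assumes "G \<in> L2 M" "K \<in> L2 M"
  shows "l2_inner M (Av z N G) K = (\<Sum>n=1..N. cnj (chr z n) * l2_inner M (G \<circ> S n) K) / of_nat N"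
proof -
  have "cscale (cnj (chr z n) / of_nat N) (G \<circ> S n) \<in> L2 M" if "n \<in> {1..N}" for n
    using that by (intro L2_scale S_L2 assms) simp
  then show ?thesis unfolding Av_def
    by (subst l2_inner_sum_left[OF _ assms(2)]) (simp_all add: l2_inner_scale_left sum_divide_distrib)
qed

lemma Av_norm_le:
  assumes z: "z \<in> torus" and G: "G \<in> L2 M"
  shows "l2_norm M (Av z N G) \<le> l2_norm M G"
proof -
  have "l2_norm M (Av z N G) \<le> (\<Sum>n=1..N. l2_norm M (cscale (cnj (chr z n) / of_nat N) (G \<circ> S n)))"
    unfolding Av_def using G by (intro l2_norm_sum_le L2_scale S_L2) auto
  also have "\<dots> = (\<Sum>n=1..N. l2_norm M G / N)"
    by (intro sum.cong refl) (auto simp: l2_norm_scale norm_divide chr_norm[OF z] S_norm G)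
  also have "\<dots> \<le> l2_norm M G" using l2_norm_nonneg[of G] by (cases "N = 0") auto
  finally show ?thesis .
qed

lemma Av_add: "Av z N (G + H) = Av z N G + Av z N H"
proof -
  have "cscale a ((G + H) \<circ> T) = cscale a (G \<circ> T) + cscale a (H \<circ> T)" for a and T :: "'a \<Rightarrow> 'a"
    by (simp add: cscale_def fun_eq_iff algebra_simps)
  then show ?thesis by (simp only: Av_def sum.distrib)
qed

lemma Av_0: "Av z N 0 = 0"
proof -
  have "cscale a (0 \<circ> T) = 0" for a and T :: "'a \<Rightarrow> 'a" by (simp add: cscale_def fun_eq_iff)
  then show ?thesis by (simp only: Av_def sum.neutral_const)
qed

lemma Av_sum: "Av z N (\<Sum>c\<in>C. H c) = (\<Sum>c\<in>C. Av z N (H c))"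
  by (induction C rule: infinite_finite_induct) (simp_all only: Av_0 Av_add sum.infinite sum.empty sum.insert not_False_eq_True)

text \<open>The bound for the scalar averages is uniform in the test function K, so K can be taken
  to be the twisted average itself.\<close>

lemma Av_cob_small:
  assumes c: "c \<in> big_gens" and G: "G \<in> L2 M" and e: "e > 0"
  shows "\<forall>\<^sub>F N in sequentially. \<forall>z\<in>torus. l2_norm M (Av z N (cob (z c) c G)) \<le> e"
proof -
  have "\<forall>\<^sub>F N in sequentially. \<forall>z\<in>torus. \<forall>K\<in>L2 M.
     cmod ((\<Sum>n=1..N. 1 * (cnj (chr z n) * l2_inner M (cob (z c) c G \<circ> S n) K)) / of_nat N)
       \<le> e * (l2_norm M K)"
    by (rule cob_average_small[OF c G e]) auto
  then show ?thesis
  proof (rule eventually_mono)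
    fix N assume N: "\<forall>z\<in>torus. \<forall>K\<in>L2 M.
     cmod ((\<Sum>n=1..N. 1 * (cnj (chr z n) * l2_inner M (cob (z c) c G \<circ> S n) K)) / of_nat N)
       \<le> e * (l2_norm M K)"
    show "\<forall>z\<in>torus. l2_norm M (Av z N (cob (z c) c G)) \<le> e"
    proof
      fix z assume z: "z \<in> torus"
      define K where "K = Av z N (cob (z c) c G)"
      have cL: "cob (z c) c G \<in> L2 M" by (rule cob_L2[OF c G])
      have K: "K \<in> L2 M" unfolding K_def by (rule Av_L2[OF cL])
      have "l2_inner M K K = (\<Sum>n=1..N. cnj (chr z n) * l2_inner M (cob (z c) c G \<circ> S n) K) / of_nat N"
        using Av_inner[OF cL K] by (simp only: K_def)
      then have "cmod (l2_inner M K K) \<le> e * l2_norm M K" using N z K by simp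
      then have "l2_norm M K * l2_norm M K \<le> e * l2_norm M K"
        unfolding l2_inner_self norm_of_real by (simp add: power2_eq_square)
      then have "l2_norm M K \<le> e"
        using l2_norm_nonneg[of K] e by (cases "l2_norm M K = 0") auto
      then show "l2_norm M (Av z N (cob (z c) c G)) \<le> e" by (simp add: K_def)
    qed
  qed
qed

end

section \<open>Correlations and characters\<close>

lemma cis_sum_orthogonal:
  assumes "a < K" "b < K"
  shows "(\<Sum>j<K. cis (2 * pi * real j / real K) ^ a * cnj (cis (2 * pi * real j / real K) ^ b)) = (if a = b then of_nat K else 0)"
proof -
  define w where "w = cis (2 * pi * (real a - real b) / real K)"
  have K: "real K > 0" using assms by simp
  have "cis (2 * pi * real j / real K) ^ a * cnj (cis (2 * pi * real j / real K) ^ b) = w ^ j" for j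
  proof -
    have "cis t ^ a * cnj (cis t ^ b) = cis (real a * t - real b * t)" for t
      by (simp add: Complex.DeMoivre cis_cnj cis_mult)
    moreover have "real a * (2 * pi * real j / real K) - real b * (2 * pi * real j / real K) =
        real j * (2 * pi * (real a - real b) / real K)"
      by (simp add: algebra_simps diff_divide_distrib)
    ultimately show ?thesis unfolding w_def by (simp only: Complex.DeMoivre)
  qed
  then have *: "(\<Sum>j<K. cis (2 * pi * real j / real K) ^ a * cnj (cis (2 * pi * real j / real K) ^ b)) = (\<Sum>j<K. w ^ j)"
    by simp
  show ?thesis
  proof (cases "a = b")
    case True
    then show ?thesis unfolding * by (simp add: w_def)
  next
    case False
    have "w \<noteq> 1"
    proof
      assume "w = 1"
      then have "cos (2 * pi * (real a - real b) / real K) = 1" by (simp add: w_def complex_eq_iff)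
      then obtain n :: int where n: "2 * pi * (real a - real b) / real K = of_int n * 2 * pi"
        using cos_one_2pi_int by blast
      then have "2 * pi * (real a - real b) = 2 * pi * (of_int n * real K)"
        using K by (simp add: field_simps)
      then have "real a - real b = of_int n * real K" by (simp only: mult_cancel_left) simp
      then have "of_int (int a - int b) = (of_int (n * int K) :: real)" by simp
      then have e: "int a - int b = n * int K" by (simp only: of_int_eq_iff)
      have "\<bar>int a - int b\<bar> < int K" using assms by auto
      then have "\<bar>n\<bar> * int K < 1 * int K" unfolding e by (simp add: abs_mult)
      then have "\<bar>n\<bar> < 1" by (rule mult_right_less_imp_less) simp
      then have "n = 0" by simp
      then show False using e False by simp
    qed
    moreover have "w ^ K = 1"
    proof -
      have "w ^ K = cis (2 * pi * (of_int (int a - int b)))"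
        using K by (simp add: w_def Complex.DeMoivre)
      also have "\<dots> = 1" by (rule cis_multiple_2pi) simp
      finally show ?thesis .
    qed
    ultimately show ?thesis unfolding * using False by (simp add: sum_gp_strict)
  qed
qed

context fg_multiplicative_system
begin

section \<open>Colour exponents of integers\<close>

definition cnt :: "nat \<Rightarrow> ('a \<Rightarrow> 'a) \<Rightarrow> nat" where
  "cnt n c = size (filter_mset (\<lambda>p. S p = c) (prime_factorization n))"

lemma cnt_mult: "n \<ge> 1 \<Longrightarrow> m \<ge> 1 \<Longrightarrow> cnt (n * m) c = cnt n c + cnt m c"
  by (simp add: cnt_def prime_factorization_mult)

lemma cnt_prime: "prime p \<Longrightarrow> cnt p c = (if S p = c then 1 else 0)"
  by (simp add: cnt_def prime_factorization_prime)

lemma cnt_1 [simp]: "cnt (Suc 0) c = 0"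
  by (simp add: cnt_def)

lemma chr_eq_prod_cnt: "chr z n = (\<Prod>c\<in>gens. z c ^ cnt n c)"
proof -
  have "prod_mset (image_mset (\<lambda>p. z (S p)) A) = (\<Prod>c\<in>gens. z c ^ size (filter_mset (\<lambda>p. S p = c) A))"
    if "\<And>p. p \<in># A \<Longrightarrow> prime p" for A
    using that
  proof (induction A)
    case (add p A)
    have p: "S p \<in> gens" using add.prems[of p] by (auto simp: gens_def)
    have "(\<Prod>c\<in>gens. z c ^ size (filter_mset (\<lambda>q. S q = c) (add_mset p A))) =
      (\<Prod>c\<in>gens. (if c = S p then z c else 1) * z c ^ size (filter_mset (\<lambda>q. S q = c) A))"
      by (intro prod.cong refl) auto
    also have "\<dots> = z (S p) * (\<Prod>c\<in>gens. z c ^ size (filter_mset (\<lambda>q. S q = c) A))"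
      using p finite_gens(1) by (simp add: prod.distrib)
    finally show ?case using add by simp
  qed auto
  then show ?thesis unfolding chr_def cnt_def using in_prime_factors_imp_prime by blast
qed

text \<open>Equal exponents provide a prime factor of m with the same transformation as a given
  prime factor of n; stripping both keeps the exponents equal and makes n smaller.\<close>

lemma S_eq_if_cnt_eq:
  assumes "n \<ge> 1" "m \<ge> 1" "\<And>c. c \<in> gens \<Longrightarrow> cnt n c = cnt m c"
  shows "S n = S m"
  using assms
proof (induction n arbitrary: m rule: less_induct)
  case (less n)
  show ?case
  proof (cases "n = 1")
    case True
    have "m = 1"
    proof (rule ccontr)
      assume "m \<noteq> 1"
      then obtain p where p: "prime p" "p dvd m" using prime_factor_nat by blast
      then obtain k where k: "m = p * k" by auto
      then have "k \<ge> 1" using less.prems by (cases k) auto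
      then have "cnt m (S p) \<ge> 1" using p prime_ge_1_nat by (simp add: k cnt_mult cnt_prime)
      moreover have "cnt n (S p) = cnt m (S p)" using p by (intro less.prems) (auto simp: gens_def)
      ultimately show False using True by simp
    qed
    then show ?thesis using True by simp
  next
    case False
    then obtain p where p: "prime p" "p dvd n" using prime_factor_nat by blast
    then obtain k where k: "n = p * k" by auto
    have k1: "k \<ge> 1" using k less.prems by (cases k) auto
    have p1: "p \<ge> 1" using p prime_ge_1_nat by simp
    have cp: "cnt n (S p) = cnt m (S p)" using p by (intro less.prems) (auto simp: gens_def)
    have "cnt n (S p) \<ge> 1" using p p1 k1 by (simp add: k cnt_mult cnt_prime)
    then have "cnt m (S p) \<noteq> 0" using cp by simp
    then have "filter_mset (\<lambda>q. S q = S p) (prime_factorization m) \<noteq> {#}"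
      unfolding cnt_def size_eq_0_iff_empty .
    then obtain q where "q \<in># filter_mset (\<lambda>q. S q = S p) (prime_factorization m)"
      using multiset_nonemptyE by blast
    then have q: "q \<in># prime_factorization m" "S q = S p" by auto
    then have "prime q" "q dvd m" by auto
    then obtain l where l: "m = q * l" by auto
    have l1: "l \<ge> 1" using l less.prems by (cases l) auto
    have q1: "q \<ge> 1" using \<open>prime q\<close> prime_ge_1_nat by simp
    have "1 * k < p * k" using k1 prime_gt_1_nat[OF p(1)] by (intro mult_strict_right_mono) auto
    then have "k < n" unfolding k by simp
    moreover have "cnt k c = cnt l c" if "c \<in> gens" for c
      using less.prems(3)[OF that]
      unfolding k l cnt_mult[OF p1 k1] cnt_mult[OF q1 l1] cnt_prime[OF p(1)] cnt_prime[OF \<open>prime q\<close>] q(2)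
      by simp
    ultimately have "S k = S l" using less.IH k1 l1 by blast
    then show ?thesis using k l k1 l1 p1 q1 q(2) by (simp add: S_mult)
  qed
qed

definition rep :: "('a \<Rightarrow> 'a) \<Rightarrow> nat" where
  "rep c = (SOME p. prime p \<and> S p = c)"

lemma rep: "c \<in> gens \<Longrightarrow> prime (rep c) \<and> S (rep c) = c"
  unfolding rep_def gens_def by (rule someI_ex) auto

text \<open>An integer with prescribed colour exponents. The functions
  \<open>F \<circ> S (of_exponents h)\<close> run through the orbit of F under the semigroup of
  exponent vectors without a separate definition of that action.\<close>

definition of_exponents :: "(('a \<Rightarrow> 'a) \<Rightarrow> nat) \<Rightarrow> nat" where
  "of_exponents h = (\<Prod>c\<in>gens. rep c ^ h c)"

lemma of_exponents_ge_1: "of_exponents h \<ge> 1"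
proof -
  have "of_exponents h > 0" unfolding of_exponents_def using rep prime_gt_0_nat by (intro prod_pos) auto
  then show ?thesis by simp
qed

lemma cnt_power: "prime p \<Longrightarrow> cnt (p ^ k) c = (if S p = c then k else 0)"
proof (induction k)
  case (Suc k)
  have "p ^ k \<ge> 1" using Suc.prems prime_gt_0_nat[of p] by (simp add: Suc_le_eq)
  then show ?case using Suc prime_ge_1_nat[of p] by (simp add: cnt_mult cnt_prime)
qed auto

lemma cnt_of_exponents: "d \<in> gens \<Longrightarrow> cnt (of_exponents h) d = h d"
proof -
  assume d: "d \<in> gens"
  have "cnt (\<Prod>c\<in>A. rep c ^ h c) d = (\<Sum>c\<in>A. if c = d then h c else 0)" if "A \<subseteq> gens" "finite A" for A
    using that(2,1)
  proof (induction A rule: finite_induct)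
    case (insert c A)
    have "(\<Prod>c\<in>A. rep c ^ h c) > 0" using insert rep prime_gt_0_nat by (intro prod_pos) auto
    moreover have "rep c ^ h c > 0" using insert rep prime_gt_0_nat by auto
    moreover have "prime (rep c)" "S (rep c) = c" using insert rep by auto
    moreover from calculation(1,2) have "cnt (rep c ^ h c * (\<Prod>c\<in>A. rep c ^ h c)) d = cnt (rep c ^ h c) d + cnt (\<Prod>c\<in>A. rep c ^ h c) d"
      by (intro cnt_mult) (simp_all only: Suc_le_eq One_nat_def)
    ultimately show ?case using insert by (auto simp: cnt_power)
  qed auto
  then show ?thesis using d finite_gens(1) by (simp add: of_exponents_def)
qed

text \<open>A finite substitute for the spectral measure of \<open>F\<close>: on a fine grid of characters, the squared norms
  of Fejer-type sums are positive weights whose Fourier coefficients are the correlations of \<open>F\<close>,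
  up to a factor counting the overlap of a box with its translate.\<close>

lemma correlation_sum_le:
  assumes F: "F \<in> L2 M" and N: "N \<ge> 1"
  shows "\<exists>z\<in>torus. (\<Sum>n=1..N. (cmod (l2_inner M (F \<circ> S n) F))\<^sup>2) / real N
     \<le> 2 ^ card gens * (l2_norm M F) ^ 3 * l2_norm M (Av z N F)"
proof -
  \<comment> \<open>A crude bound for every colour exponent of every n \<le> N.\<close>
  define A where "A = (\<Sum>n=1..N. size (prime_factorization n))"
  have cntA: "cnt n c \<le> A" if "n \<in> {1..N}" for n c
  proof -
    have "cnt n c \<le> size (prime_factorization n)" unfolding cnt_def by (intro size_mset_mono) simp
    also have "\<dots> \<le> A" unfolding A_def using that by (intro member_le_sum) auto
    finally show ?thesis .
  qed
  \<comment> \<open>H is twice A + 1, so a box of side H overlaps its translate by the exponents of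
    any n \<le> N in at least the proportion 2^(-k). The grid size K = H + A exceeds all exponent
    sums that occur, so the roots of unity of order K separate them without wrap-around.\<close>
  define H where "H = 2 * A + 2"
  define K where "K = H + A"
  define k where "k = card gens"
  define Box where "Box = PiE gens (\<lambda>_. {..<H})"
  define Grid where "Grid = PiE gens (\<lambda>_. {..<K})"
  have fin: "finite Box" "finite Grid" unfolding Box_def Grid_def using finite_gens by (auto intro: finite_PiE)
  have cardBox: "card Box = H ^ k" unfolding Box_def k_def using finite_gens by (simp add: card_PiE)
  define zz where "zz j c = (if c \<in> gens then cis (2 * pi * real (j c) / real K) else 1)" for j :: "('a \<Rightarrow> 'a) \<Rightarrow> nat" and c
  have zz: "zz j \<in> torus" for j by (simp add: torus_def zz_def)
  have GridNe: "Grid \<noteq> {}" by (simp add: Grid_def PiE_eq_empty_iff K_def H_def lessThan_empty_iff)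
  define v where "v j = (\<Sum>h\<in>Box. cscale (cnj (chr (zz j) (of_exponents h))) (F \<circ> S (of_exponents h)))" for j
  have vt: "cscale a (F \<circ> S (of_exponents h)) \<in> L2 M" for a h by (intro L2_scale S_L2 of_exponents_ge_1 F)
  have vL: "v j \<in> L2 M" for j unfolding v_def by (intro L2_sum vt)
  have ortho: "(\<Sum>j\<in>Grid. chr (zz j) n * chr (zz j) (of_exponents h') * cnj (chr (zz j) (of_exponents h))) =
      (if \<forall>c\<in>gens. cnt n c + h' c = h c then of_nat (K ^ k) else 0)"
    if n: "n \<in> {1..N}" and h: "h \<in> Box" "h' \<in> Box" for n h h'
  proof -
    have "(\<Sum>j\<in>Grid. chr (zz j) n * chr (zz j) (of_exponents h') * cnj (chr (zz j) (of_exponents h))) =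
      (\<Sum>j\<in>Grid. \<Prod>c\<in>gens. cis (2 * pi * real (j c) / real K) ^ (cnt n c + h' c) * cnj (cis (2 * pi * real (j c) / real K) ^ h c))"
    proof (rule sum.cong[OF refl])
      fix j
      have "chr (zz j) n = (\<Prod>c\<in>gens. cis (2 * pi * real (j c) / real K) ^ cnt n c)"
        unfolding chr_eq_prod_cnt by (intro prod.cong refl) (simp add: zz_def)
      moreover have "chr (zz j) (of_exponents g) = (\<Prod>c\<in>gens. cis (2 * pi * real (j c) / real K) ^ g c)" for g
        unfolding chr_eq_prod_cnt by (intro prod.cong refl) (simp add: zz_def cnt_of_exponents)
      ultimately show "chr (zz j) n * chr (zz j) (of_exponents h') * cnj (chr (zz j) (of_exponents h)) =
         (\<Prod>c\<in>gens. cis (2 * pi * real (j c) / real K) ^ (cnt n c + h' c) * cnj (cis (2 * pi * real (j c) / real K) ^ h c))"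
        by (simp only: cnj_prod prod.distrib power_add)
    qed
    also have "\<dots> = (\<Prod>c\<in>gens. \<Sum>i<K. cis (2 * pi * real i / real K) ^ (cnt n c + h' c) * cnj (cis (2 * pi * real i / real K) ^ h c))"
      unfolding Grid_def using finite_gens by (subst prod_sum_PiE) auto
    also have "\<dots> = (\<Prod>c\<in>gens. if cnt n c + h' c = h c then of_nat K else 0)"
    proof (intro prod.cong refl cis_sum_orthogonal)
      fix c assume c: "c \<in> gens"
      have "h' c < H" "h c < H" using h c by (auto simp: Box_def)
      then show "cnt n c + h' c < K" "h c < K" using cntA[OF n, of c] by (auto simp: K_def)
    qed
    also have "\<dots> = (if \<forall>c\<in>gens. cnt n c + h' c = h c then of_nat (K ^ k) else 0)"
    proof (cases "\<forall>c\<in>gens. cnt n c + h' c = h c")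
      case True
      then show ?thesis by (simp add: k_def)
    next
      case False
      then show ?thesis using finite_gens by (auto intro!: prod_zero)
    qed
    finally show ?thesis .
  qed
  \<comment> \<open>The number of points of the box that stay inside after translation by the
    exponents of n, in the role of the coefficients of a Fejer kernel.\<close>
  define w where "w n = card {h'\<in>Box. \<forall>c\<in>gens. cnt n c + h' c < H}" for n
  have coeff: "(\<Sum>j\<in>Grid. chr (zz j) n * of_real ((l2_norm M (v j))\<^sup>2)) = of_nat (K ^ k * w n) * l2_inner M (F \<circ> S n) F"
    if n: "n \<in> {1..N}" for n
  proof -
    have n1: "n \<ge> 1" using n by simp
    define B where "B h h' = l2_inner M (F \<circ> S (of_exponents h)) (F \<circ> S (of_exponents h'))" for h h'
    have "of_real ((l2_norm M (v j))\<^sup>2) = (\<Sum>h\<in>Box. \<Sum>h'\<in>Box. cnj (chr (zz j) (of_exponents h)) * chr (zz j) (of_exponents h') * B h h')" for j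
    proof -
      have "of_real ((l2_norm M (v j))\<^sup>2) = l2_inner M (v j) (v j)" by (simp only: l2_inner_self)
      also have "\<dots> = (\<Sum>h\<in>Box. l2_inner M (cscale (cnj (chr (zz j) (of_exponents h))) (F \<circ> S (of_exponents h))) (v j))"
        unfolding v_def[of j] by (intro l2_inner_sum_left vt L2_sum)
      also have "\<dots> = (\<Sum>h\<in>Box. \<Sum>h'\<in>Box. l2_inner M (cscale (cnj (chr (zz j) (of_exponents h))) (F \<circ> S (of_exponents h))) (cscale (cnj (chr (zz j) (of_exponents h'))) (F \<circ> S (of_exponents h'))))"
        unfolding v_def[of j] by (intro sum.cong refl l2_inner_sum_right vt)
      finally show ?thesis
        by (simp only: l2_inner_scale_left l2_inner_scale_right B_def complex_cnj_cnj mult_ac)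
    qed
    then have "(\<Sum>j\<in>Grid. chr (zz j) n * of_real ((l2_norm M (v j))\<^sup>2)) =
       (\<Sum>j\<in>Grid. \<Sum>h\<in>Box. \<Sum>h'\<in>Box. (chr (zz j) n * chr (zz j) (of_exponents h') * cnj (chr (zz j) (of_exponents h))) * B h h')"
      by (simp add: sum_distrib_left mult_ac)
    also have "\<dots> = (\<Sum>h\<in>Box. \<Sum>h'\<in>Box. (\<Sum>j\<in>Grid. chr (zz j) n * chr (zz j) (of_exponents h') * cnj (chr (zz j) (of_exponents h))) * B h h')"
      unfolding sum_distrib_right by (subst sum.swap) (rule sum.cong[OF refl], rule sum.swap)
    also have "\<dots> = (\<Sum>h\<in>Box. \<Sum>h'\<in>Box. if \<forall>c\<in>gens. cnt n c + h' c = h c then of_nat (K ^ k) * l2_inner M (F \<circ> S n) F else 0)"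
    proof (intro sum.cong refl)
      fix h h' assume h: "h \<in> Box" "h' \<in> Box"
      show "(\<Sum>j\<in>Grid. chr (zz j) n * chr (zz j) (of_exponents h') * cnj (chr (zz j) (of_exponents h))) * B h h' =
         (if \<forall>c\<in>gens. cnt n c + h' c = h c then of_nat (K ^ k) * l2_inner M (F \<circ> S n) F else 0)"
      proof (cases "\<forall>c\<in>gens. cnt n c + h' c = h c")
        case True
        have "S (of_exponents h) = S (n * of_exponents h')"
        proof (rule S_eq_if_cnt_eq)
          show "n * of_exponents h' \<ge> 1" using n1 of_exponents_ge_1[of h'] by (simp add: Suc_le_eq)
          fix c assume "c \<in> gens"
          then show "cnt (of_exponents h) c = cnt (n * of_exponents h') c" using True n1 of_exponents_ge_1 by (simp add: cnt_mult cnt_of_exponents)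
        qed (rule of_exponents_ge_1)
        then have "F \<circ> S (of_exponents h) = F \<circ> S n \<circ> S (of_exponents h')" using S_comp[OF n1 of_exponents_ge_1] by simp
        then have "B h h' = l2_inner M (F \<circ> S n) F"
          unfolding B_def by (simp only: S_inner[OF of_exponents_ge_1 S_L2[OF n1 F] F])
        then show ?thesis using ortho[OF n h] True by simp
      next
        case False
        then show ?thesis using ortho[OF n h] by (simp only: if_False mult_zero_left)
      qed
    qed
    also have "\<dots> = (\<Sum>h'\<in>Box. \<Sum>h\<in>Box. if \<forall>c\<in>gens. cnt n c + h' c = h c then of_nat (K ^ k) * l2_inner M (F \<circ> S n) F else 0)"
      by (rule sum.swap)
    also have "\<dots> = (\<Sum>h'\<in>Box. if \<forall>c\<in>gens. cnt n c + h' c < H then of_nat (K ^ k) * l2_inner M (F \<circ> S n) F else 0)"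
    proof (intro sum.cong refl)
      fix h' assume h': "h' \<in> Box"
      define g where "g = (\<lambda>c\<in>gens. cnt n c + h' c)"
      have eq: "(\<forall>c\<in>gens. cnt n c + h' c = h c) \<longleftrightarrow> h = g" if "h \<in> Box" for h
        using that by (auto simp: g_def Box_def PiE_def extensional_def fun_eq_iff)
      have "(\<Sum>h\<in>Box. if \<forall>c\<in>gens. cnt n c + h' c = h c then of_nat (K ^ k) * l2_inner M (F \<circ> S n) F else 0) =
        (\<Sum>h\<in>Box. if h = g then of_nat (K ^ k) * l2_inner M (F \<circ> S n) F else 0)"
        by (intro sum.cong refl if_cong eq)
      also have "\<dots> = (if g \<in> Box then of_nat (K ^ k) * l2_inner M (F \<circ> S n) F else 0)"
        using fin by (simp add: sum.delta)
      also have "g \<in> Box \<longleftrightarrow> (\<forall>c\<in>gens. cnt n c + h' c < H)" by (auto simp: g_def Box_def PiE_def Pi_def)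
      finally show "(\<Sum>h\<in>Box. if \<forall>c\<in>gens. cnt n c + h' c = h c then of_nat (K ^ k) * l2_inner M (F \<circ> S n) F else 0) =
        (if \<forall>c\<in>gens. cnt n c + h' c < H then of_nat (K ^ k) * l2_inner M (F \<circ> S n) F else 0)" .
    qed
    also have "\<dots> = of_nat (w n) * (of_nat (K ^ k) * l2_inner M (F \<circ> S n) F)"
      using fin by (simp add: w_def sum.inter_filter[symmetric])
    finally show ?thesis by simp
  qed
  have w_lower: "real (H ^ k) \<le> 2 ^ k * real (w n)" if n: "n \<in> {1..N}" for n
  proof -
    have "PiE gens (\<lambda>_. {..<A + 1}) \<subseteq> {h'\<in>Box. \<forall>c\<in>gens. cnt n c + h' c < H}"
    proof
      fix h assume h: "h \<in> PiE gens (\<lambda>_. {..<A + 1})"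
      have "cnt n c + h c < H" if "c \<in> gens" for c
        using h that cntA[OF n, of c] by (auto simp: H_def PiE_def Pi_def dest!: bspec[of _ _ c])
      moreover from this have "h c < H" if "c \<in> gens" for c using that by (meson le_add2 le_less_trans)
      ultimately show "h \<in> {h'\<in>Box. \<forall>c\<in>gens. cnt n c + h' c < H}"
        using h by (auto simp: Box_def PiE_def)
    qed
    then have "card (PiE gens (\<lambda>_. {..<A + 1})) \<le> w n"
      unfolding w_def using fin by (intro card_mono) auto
    then have "(A + 1) ^ k \<le> w n" using finite_gens by (simp add: card_PiE k_def)
    then have "2 ^ k * (A + 1) ^ k \<le> 2 ^ k * w n" by simp
    moreover have "H ^ k = 2 ^ k * (A + 1) ^ k" unfolding H_def by (simp only: power_mult_distrib[symmetric]) simp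
    ultimately have "H ^ k \<le> 2 ^ k * w n" by simp
    then have "real (H ^ k) \<le> real (2 ^ k * w n)" by (simp only: of_nat_le_iff)
    then show ?thesis by simp
  qed
  \<comment> \<open>The total weight is the coefficient at n = 1, where the box overlaps itself
    completely.\<close>
  have total: "(\<Sum>j\<in>Grid. (l2_norm M (v j))\<^sup>2) = real (K ^ k * H ^ k) * (l2_norm M F)\<^sup>2"
  proof -
    have one: "1 \<in> {1..N}" using N by simp
    have "w 1 = H ^ k"
    proof -
      have "{h'\<in>Box. \<forall>c\<in>gens. cnt 1 c + h' c < H} = Box" by (auto simp: Box_def)
      then show ?thesis by (simp only: w_def cardBox)
    qed
    moreover have "l2_inner M (F \<circ> S 1) F = of_real ((l2_norm M F)\<^sup>2)" by (simp only: S_1 comp_id l2_inner_self)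
    ultimately have "complex_of_real (\<Sum>j\<in>Grid. (l2_norm M (v j))\<^sup>2) = of_real (real (K ^ k * H ^ k) * (l2_norm M F)\<^sup>2)"
      using coeff[OF one] by simp
    then show ?thesis by (simp only: of_real_eq_iff)
  qed
  define D where "D = Max ((\<lambda>j. l2_norm M (Av (zz j) N F)) ` Grid)"
  have "D \<in> (\<lambda>j. l2_norm M (Av (zz j) N F)) ` Grid" unfolding D_def using fin GridNe by (intro Max_in) auto
  then obtain j0 where j0: "j0 \<in> Grid" "D = l2_norm M (Av (zz j0) N F)" by blast
  have D: "l2_norm M (Av (zz j) N F) \<le> D" if "j \<in> Grid" for j unfolding D_def using fin that by (intro Max_ge) auto
  define b where "b n = l2_inner M (F \<circ> S n) F" for n
  define \<Sigma> where "\<Sigma> = (\<Sum>n=1..N. (cmod (b n))\<^sup>2)"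
  \<comment> \<open>In each squared modulus one factor is replaced by its expansion over the grid.
    Exchanging sums turns the sum over n into a twisted average of F paired with F, and since the
    weights are nonnegative with known total, only the worst grid point D counts.\<close>
  have "real (K ^ k) * (\<Sum>n=1..N. real (w n) * (cmod (b n))\<^sup>2) \<le> real (K ^ k * H ^ k) * (l2_norm M F)\<^sup>2 * (real N * (D * l2_norm M F))"
  proof -
    have "complex_of_real (real (K ^ k) * (\<Sum>n=1..N. real (w n) * (cmod (b n))\<^sup>2)) =
       (\<Sum>n=1..N. (of_nat (K ^ k * w n) * b n) * cnj (b n))"
    proof -
      have "(of_nat (K ^ k * w n) * b n) * cnj (b n) = complex_of_real (real (K ^ k) * (real (w n) * (cmod (b n))\<^sup>2))" for n
      proof -
        have "b n * cnj (b n) = complex_of_real ((cmod (b n))\<^sup>2)" by (rule complex_norm_square[symmetric])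
        then show ?thesis by (simp only: mult.assoc of_real_mult of_real_of_nat_eq of_nat_mult)
      qed
      then show ?thesis by (simp only: of_real_sum[symmetric] sum_distrib_left[symmetric])
    qed
    also have "\<dots> = (\<Sum>n=1..N. (\<Sum>j\<in>Grid. chr (zz j) n * of_real ((l2_norm M (v j))\<^sup>2)) * cnj (b n))"
      by (intro sum.cong refl) (simp only: coeff b_def)
    also have "\<dots> = (\<Sum>j\<in>Grid. of_real ((l2_norm M (v j))\<^sup>2) * (\<Sum>n=1..N. chr (zz j) n * cnj (b n)))"
      unfolding sum_distrib_right sum_distrib_left by (subst sum.swap) (intro sum.cong refl, simp only: mult_ac)
    also have "\<dots> = (\<Sum>j\<in>Grid. of_real ((l2_norm M (v j))\<^sup>2) * (of_nat N * cnj (l2_inner M (Av (zz j) N F) F)))"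
    proof (intro sum.cong refl arg_cong2[of _ _ _ _ "(*)"])
      fix j
      have "of_nat N * l2_inner M (Av (zz j) N F) F = (\<Sum>n=1..N. cnj (chr (zz j) n) * b n)"
        using Av_inner[OF F F, of "zz j" N] N by (simp add: b_def)
      then have "cnj (of_nat N * l2_inner M (Av (zz j) N F) F) = cnj (\<Sum>n=1..N. cnj (chr (zz j) n) * b n)" by (rule arg_cong)
      then show "(\<Sum>n=1..N. chr (zz j) n * cnj (b n)) = of_nat N * cnj (l2_inner M (Av (zz j) N F) F)"
        by simp
    qed
    finally have "real (K ^ k) * (\<Sum>n=1..N. real (w n) * (cmod (b n))\<^sup>2) =
        cmod (\<Sum>j\<in>Grid. of_real ((l2_norm M (v j))\<^sup>2) * (of_nat N * cnj (l2_inner M (Av (zz j) N F) F)))"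
      by (metis (no_types, lifting) abs_of_nonneg mult_nonneg_nonneg norm_of_real of_nat_0_le_iff sum_nonneg zero_le_power2)
    also have "\<dots> \<le> (\<Sum>j\<in>Grid. (l2_norm M (v j))\<^sup>2 * (real N * (D * l2_norm M F)))"
    proof (rule sum_norm_le)
      fix j assume j: "j \<in> Grid"
      have "cmod (l2_inner M (Av (zz j) N F) F) \<le> D * l2_norm M F"
        using l2_Cauchy_Schwarz[OF Av_L2[OF F] F] D[OF j] l2_norm_nonneg mult_right_mono order_trans by metis
      then show "cmod (of_real ((l2_norm M (v j))\<^sup>2) * (of_nat N * cnj (l2_inner M (Av (zz j) N F) F))) \<le>
          (l2_norm M (v j))\<^sup>2 * (real N * (D * l2_norm M F))"
        unfolding norm_mult norm_of_real norm_of_nat complex_mod_cnj by (simp add: mult_left_mono)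
    qed
    also have "\<dots> = real (K ^ k * H ^ k) * (l2_norm M F)\<^sup>2 * (real N * (D * l2_norm M F))"
      by (simp only: sum_distrib_right[symmetric] total)
    finally show ?thesis .
  qed
  moreover have "real (K ^ k) * (real (H ^ k) * \<Sigma>) \<le> real (K ^ k) * (2 ^ k * (\<Sum>n=1..N. real (w n) * (cmod (b n))\<^sup>2))"
  proof (rule mult_left_mono)
    have "real (H ^ k) * \<Sigma> = (\<Sum>n=1..N. real (H ^ k) * (cmod (b n))\<^sup>2)" by (simp only: \<Sigma>_def sum_distrib_left)
    also have "\<dots> \<le> (\<Sum>n=1..N. (2 ^ k * real (w n)) * (cmod (b n))\<^sup>2)"
      by (intro sum_mono mult_right_mono w_lower) auto
    also have "\<dots> = 2 ^ k * (\<Sum>n=1..N. real (w n) * (cmod (b n))\<^sup>2)" by (simp only: sum_distrib_left mult.assoc)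
    finally show "real (H ^ k) * \<Sigma> \<le> 2 ^ k * (\<Sum>n=1..N. real (w n) * (cmod (b n))\<^sup>2)" .
  qed simp
  ultimately have "real (K ^ k) * (real (H ^ k) * \<Sigma>) \<le> 2 ^ k * (real (K ^ k * H ^ k) * (l2_norm M F)\<^sup>2 * (real N * (D * l2_norm M F)))"
    by (smt (verit, ccfv_SIG) mult.left_commute mult_left_mono zero_le_power)
  also have "\<dots> = (real (K ^ k) * real (H ^ k)) * (2 ^ k * (l2_norm M F) ^ 3 * D * real N)"
    by (simp add: power2_eq_square power3_eq_cube)
  finally have "(real (K ^ k) * real (H ^ k)) * \<Sigma> \<le> (real (K ^ k) * real (H ^ k)) * (2 ^ k * (l2_norm M F) ^ 3 * D * real N)"
    by (simp only: mult.assoc)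
  moreover have "real (K ^ k) * real (H ^ k) > 0" by (simp add: K_def H_def)
  ultimately have "\<Sigma> \<le> 2 ^ k * (l2_norm M F) ^ 3 * D * real N" by (simp only: mult_le_cancel_left_pos)
  then have "\<Sigma> / real N \<le> 2 ^ k * (l2_norm M F) ^ 3 * D" using N by (simp add: pos_divide_le_eq)
  then show ?thesis using zz j0 unfolding \<Sigma>_def b_def k_def by blast
qed

end

section \<open>The decomposition\<close>

lemma bounded_subsequence_finite:
  fixes u :: "nat \<Rightarrow> 'c \<Rightarrow> complex"
  assumes "finite C" "\<And>n c. cmod (u n c) \<le> 1"
  shows "\<exists>r l. strict_mono (r :: nat \<Rightarrow> nat) \<and> (\<forall>c\<in>C. (\<lambda>n. u (r n) c) \<longlonglongrightarrow> l c)"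
  using assms(1)
proof (induction C rule: finite_induct)
  case empty
  show ?case by (intro exI[of _ id]) (simp add: strict_mono_def)
next
  case (insert c C)
  then obtain r l where r: "strict_mono (r :: nat \<Rightarrow> nat)" "\<forall>c\<in>C. (\<lambda>n. u (r n) c) \<longlonglongrightarrow> l c" by blast
  have "bounded (range (\<lambda>n. u (r n) c))" using assms(2) by (auto simp: bounded_iff)
  then obtain t s where s: "strict_mono (s :: nat \<Rightarrow> nat)" "((\<lambda>n. u (r n) c) \<circ> s) \<longlonglongrightarrow> t"
    using bounded_imp_convergent_subsequence by blast
  have "(\<lambda>n. u ((r \<circ> s) n) d) \<longlonglongrightarrow> (l(c := t)) d" if "d \<in> insert c C" for d
  proof (cases "d = c")
    case True
    then show ?thesis using s(2) by (simp add: o_def)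
  next
    case False
    then have "(\<lambda>n. u (r n) d) \<longlonglongrightarrow> l d" using that r by auto
    from LIMSEQ_subseq_LIMSEQ[OF this s(1)] show ?thesis using False by (simp add: o_def)
  qed
  moreover have "strict_mono (r \<circ> s)" using r s by (intro strict_mono_o)
  ultimately show ?case by blast
qed

text \<open>The primes are sieved out one at a time. If p m avoids D then so does m, so the
  multiples of p make up at most the fraction 1 / p of the sum, and 1 - 1 / p is at least exp (- 2 /
  p) for p \<ge> 2. The resulting factor does not depend on N.\<close>

lemma sum_reciprocals_coprime_ge:
  assumes "finite D" "\<And>p. p \<in> D \<Longrightarrow> prime p"
  shows "(\<Sum>n | n \<in> {1..N} \<and> (\<forall>p\<in>D. \<not> p dvd n). 1 / real n) \<ge> exp (- 2 * (\<Sum>p\<in>D. 1 / real p)) * harm N"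
  using assms
proof (induction D rule: finite_induct)
  case empty
  have "{n. n \<in> {1..N} \<and> (\<forall>p\<in>{}. \<not> p dvd n)} = {1..N}" by auto
  then show ?case by (simp only: harm_def inverse_eq_divide) simp
next
  case (insert p D)
  define L where "L D = (\<Sum>n | n \<in> {1..N} \<and> (\<forall>p\<in>D. \<not> p dvd n). 1 / real n)" for D
  have p: "prime p" "p \<ge> 2" using insert.prems prime_ge_2_nat by auto
  have "L D = (\<Sum>n | n \<in> {1..N} \<and> (\<forall>q\<in>insert p D. \<not> q dvd n). 1 / real n) +
     (\<Sum>n | n \<in> {1..N} \<and> p dvd n \<and> (\<forall>q\<in>D. \<not> q dvd n). 1 / real n)"
    unfolding L_def by (subst sum.union_disjoint[symmetric]) (auto intro!: sum.cong)
  also have "(\<Sum>n | n \<in> {1..N} \<and> p dvd n \<and> (\<forall>q\<in>D. \<not> q dvd n). 1 / real n) =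
     (\<Sum>n | n \<in> {1..N} \<and> p dvd n. if \<forall>q\<in>D. \<not> q dvd n then 1 / real n else 0)"
    by (subst sum.inter_filter[symmetric]) (auto intro!: sum.cong)
  also have "\<dots> = (\<Sum>m=1..N div p. if \<forall>q\<in>D. \<not> q dvd p * m then 1 / real (p * m) else 0)"
    using p by (intro sum_multiples) auto
  also have "\<dots> \<le> (\<Sum>m=1..N div p. 1 / real p * (if \<forall>q\<in>D. \<not> q dvd m then 1 / real m else 0))"
    by (intro sum_mono) (auto simp: dvd_mult mult.commute)
  \<comment> \<open>Here reciprocals pay off: extending the cutoff from N div p to N only adds
    nonnegative terms, so no rounding errors accumulate during the sieve.\<close>
  also have "\<dots> \<le> (\<Sum>m=1..N. 1 / real p * (if \<forall>q\<in>D. \<not> q dvd m then 1 / real m else 0))"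
    by (intro sum_mono2) (auto intro: order_trans)
  also have "\<dots> = 1 / real p * L D"
    unfolding sum_distrib_left[symmetric] L_def by (subst sum.inter_filter) auto
  finally have "(1 - 1 / real p) * L D \<le> L (insert p D)" by (simp add: L_def algebra_simps)
  moreover have "exp (- 2 / real p) \<le> 1 - 1 / real p"
  proof -
    define x where "x = 1 / real p"
    have x: "0 < x" "x \<le> 1 / 2" using p by (auto simp: x_def field_simps)
    have "1 + 2 * x \<le> exp (2 * x)" by (rule exp_ge_add_one_self)
    moreover have "1 \<le> (1 - x) * (1 + 2 * x)" using x by (simp add: algebra_simps)
    moreover have "(1 - x) * (1 + 2 * x) \<le> (1 - x) * exp (2 * x)" using x by (intro mult_left_mono) auto
    ultimately have "1 \<le> (1 - x) * exp (2 * x)" by linarith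
    then show ?thesis by (simp add: x_def exp_minus field_simps)
  qed
  moreover have "L D \<ge> 0" unfolding L_def by (intro sum_nonneg) auto
  ultimately have 1: "exp (- 2 / real p) * L D \<le> L (insert p D)"
    by (meson mult_right_mono order_trans)
  have 2: "exp (- 2 / real p) * (exp (- 2 * (\<Sum>p\<in>D. 1 / real p)) * harm N) \<le> exp (- 2 / real p) * L D"
    using insert.IH insert.prems unfolding L_def by (intro mult_left_mono) auto
  have 3: "exp (- 2 * (\<Sum>q\<in>insert p D. 1 / real q)) = exp (- 2 / real p) * exp (- 2 * (\<Sum>q\<in>D. 1 / real q))"
    using insert.hyps by (simp add: exp_add[symmetric] algebra_simps)
  show ?case using order_trans[OF 2 1] unfolding 3 L_def mult.assoc .
qed

text \<open>Partial summation carried out one step at a time: \<open>L n - A n / n\<close> grows by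
  at most \<open>A n / n\<close> times 1 / (n + 1), which is at most e / (n + 1) from
  \<open>n0\<close> on. The constant C absorbs the beginning.\<close>

lemma sum_reciprocals_density_zero:
  fixes P :: "nat \<Rightarrow> bool"
  assumes d: "(\<lambda>N. real (card {n\<in>{1..N}. P n}) / real N) \<longlonglongrightarrow> 0" and e: "e > 0"
  shows "\<exists>C. \<forall>N. (\<Sum>n | n \<in> {1..N} \<and> P n. 1 / real n) \<le> C + e * harm N"
proof -
  define A where "A N = real (card {n\<in>{1..N}. P n})" for N
  obtain n0 where n0: "\<And>n. n \<ge> n0 \<Longrightarrow> A n / real n < e"
    using order_tendstoD(2)[OF d e] unfolding A_def eventually_sequentially by blast
  have A0: "A n \<ge> 0" "A n \<le> real n" for n
  proof -
    have "card {k\<in>{1..n}. P k} \<le> card {1..n}" by (intro card_mono) auto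
    then show "A n \<le> real n" by (simp add: A_def)
  qed (simp add: A_def)
  have A_Suc: "A (Suc n) = A n + (if P (Suc n) then 1 else 0)" for n
  proof -
    have "{k\<in>{1..Suc n}. P k} = {k\<in>{1..n}. P k} \<union> (if P (Suc n) then {Suc n} else {})" by (auto simp: le_Suc_eq)
    then show ?thesis by (auto simp: A_def)
  qed
  define L where "L N = (\<Sum>n | n \<in> {1..N} \<and> P n. 1 / real n)" for N
  have L_Suc: "L (Suc n) = L n + (if P (Suc n) then 1 / real (Suc n) else 0)" for n
  proof -
    have "L n = (\<Sum>k=1..n. if P k then 1 / real k else 0)" for n
      unfolding L_def by (subst sum.inter_filter[symmetric]) auto
    then show ?thesis by simp
  qed
  have step: "L (Suc n) - A (Suc n) / real (Suc n) \<le> L n - A n / real n + A n / real n * (1 / real (Suc n))" if "n \<ge> 1" for n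
  proof -
    have "a / (x + 1) = a / x - a / x * (1 / (x + 1))" if "x > 0" for a x :: real
    proof -
      have "1 - 1 / (x + 1) = x / (x + 1)" using that by (simp add: field_simps)
      then have "a / x * (1 - 1 / (x + 1)) = a / (x + 1)" using that by simp
      then show ?thesis by (simp only: right_diff_distrib mult_1_right)
    qed
    from this[of "real n" "A n"] have "A n / real (Suc n) = A n / real n - A n / real n * (1 / real (Suc n))"
      using that by (simp add: add.commute)
    then show ?thesis by (simp add: L_Suc A_Suc add_divide_distrib)
  qed
  define m where "m = max 1 n0"
  have "L (m + k) - A (m + k) / real (m + k) \<le> L m + e * harm (m + k)" for k
  proof (induction k)
    case 0
    have "0 \<le> A m / real m" "0 \<le> e * harm m" using A0 e by (auto simp: harm_nonneg)
    then show ?case by simp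
  next
    case (Suc k)
    have "A (m + k) / real (m + k) * (1 / real (Suc (m + k))) \<le> e * (1 / real (Suc (m + k)))"
    proof (rule mult_right_mono)
      have "n0 \<le> m + k" by (simp add: m_def)
      from n0[OF this] show "A (m + k) / real (m + k) \<le> e" by (rule less_imp_le)
    qed simp
    moreover have "e * harm (m + Suc k) = e * harm (m + k) + e * (1 / real (Suc (m + k)))"
      by (simp add: harm_Suc inverse_eq_divide distrib_left)
    moreover have "m + k \<ge> 1" by (simp add: m_def)
    note step[OF this]
    ultimately show ?case unfolding add_Suc_right using Suc.IH by linarith
  qed note main = this
  have mono: "L a \<le> L b" if "a \<le> b" for a b
    unfolding L_def using that by (intro sum_mono2) auto
  have "L N \<le> (L m + 1) + e * harm N" for N
  proof (cases "N \<ge> m")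
    case True
    then obtain k where k: "N = m + k" using le_Suc_ex by blast
    have "A N / real N \<le> 1" using A0(2)[of N] by (auto simp: divide_le_eq_1)
    then show ?thesis using main[of k] k by simp
  next
    case False
    then have "L N \<le> L m" by (intro mono) simp
    moreover have "0 \<le> e * harm N" using e by (simp add: harm_nonneg)
    ultimately show ?thesis by linarith
  qed
  then show ?thesis unfolding L_def by blast
qed

context fg_multiplicative_system
begin

text \<open>Characters violating the bound for infinitely many N would have a subsequence converging
  on \<open>gens\<close> to some z. F is close to an element of \<open>Cob z\<close>, whose
  coboundaries are twisted by z while the averages are twisted by the moving characters.
  \<open>Av_cob_small\<close> is uniform over the torus and thus applies to the moving twist; the
  discrepancy of the twists tends to 0.\<close>

lemma Av_uniformly_small:
  assumes F: "F \<in> L2 M" "\<And>z K. z \<in> torus \<Longrightarrow> K \<in> eigsp z \<Longrightarrow> l2_inner M F K = 0" and e: "e > 0"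
  shows "\<forall>\<^sub>F N in sequentially. \<forall>z\<in>torus. l2_norm M (Av z N F) \<le> e"
proof (rule ccontr)
  assume "\<not> ?thesis"
  then obtain r where r: "strict_mono (r :: nat \<Rightarrow> nat)" "\<And>n. \<not> (\<forall>z\<in>torus. l2_norm M (Av z (r n) F) \<le> e)"
    using not_eventually_sequentiallyD by blast
  then obtain u where u: "\<And>n. u n \<in> torus" "\<And>n. l2_norm M (Av (u n) (r n) F) > e"
    by (metis not_le)
  have "cmod (u n c) \<le> 1" for n c using u(1) by (simp add: torus_def)
  from bounded_subsequence_finite[OF finite_gens(1), of u, OF this]
  obtain s l where s: "strict_mono (s :: nat \<Rightarrow> nat)" "\<And>c. c \<in> gens \<Longrightarrow> (\<lambda>n. u (s n) c) \<longlonglongrightarrow> l c"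
    by blast
  define z where "z c = (if c \<in> gens then l c else 1)" for c
  have "cmod (l c) = 1" if "c \<in> gens" for c
    using LIMSEQ_unique[OF tendsto_norm[OF s(2)[OF that]], of 1] u(1) by (simp add: torus_def)
  then have z: "z \<in> torus" by (simp add: torus_def z_def)
  have "F \<in> l2_closure M (Cob z)" using F(2)[OF z] by (intro orthogonal_eigsp_closure_Cob z F(1)) auto
  moreover have "e / 4 > 0" using e by simp
  ultimately obtain W where W: "W \<in> Cob z" "l2_norm M (F - W) < e / 4" unfolding l2_closure_def by blast
  obtain G where G: "W = (\<Sum>c\<in>big_gens. cob (z c) c (G c))" "\<And>c. c \<in> big_gens \<Longrightarrow> G c \<in> L2 M"
    using W(1) unfolding Cob_def by blast
  have WL: "W \<in> L2 M" using W(1) Cob_L2 by blast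
  define m where "m = real (card big_gens) + 1"
  have m: "m > 0" by (simp add: m_def)
  \<comment> \<open>Each coboundary will contribute at most 2 d, all of them together at most e / 2,
    in addition to the e / 4 from approximating F by W.\<close>
  define d where "d = e / (4 * m)"
  have d: "d > 0" using e m by (simp add: d_def)
  have rs: "filterlim (\<lambda>n. r (s n)) sequentially sequentially"
    using filterlim_subseq[OF strict_mono_o[OF r(1) s(1)]] by (simp add: o_def)
  have 1: "\<forall>\<^sub>F n in sequentially. \<forall>c\<in>big_gens. \<forall>v\<in>torus. l2_norm M (Av v (r (s n)) (cob (v c) c (G c))) \<le> d"
  proof (rule eventually_ball_finite[OF finite_gens(2)], rule ballI)
    fix c assume c: "c \<in> big_gens"
    from eventually_compose_filterlim[OF Av_cob_small[OF c G(2)[OF c] d] rs]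
    show "\<forall>\<^sub>F n in sequentially. \<forall>v\<in>torus. l2_norm M (Av v (r (s n)) (cob (v c) c (G c))) \<le> d" .
  qed
  have 2: "\<forall>\<^sub>F n in sequentially. \<forall>c\<in>big_gens. cmod (z c - u (s n) c) * l2_norm M (G c) < d"
  proof (rule eventually_ball_finite[OF finite_gens(2)], rule ballI)
    fix c assume c: "c \<in> big_gens"
    then have cg: "c \<in> gens" by (simp add: big_gens_def)
    then have "(\<lambda>n. u (s n) c) \<longlonglongrightarrow> z c" using s(2) by (simp add: z_def)
    then have "(\<lambda>n. cmod (z c - u (s n) c) * l2_norm M (G c)) \<longlonglongrightarrow> cmod (z c - z c) * l2_norm M (G c)"
      by (intro tendsto_intros)
    then show "\<forall>\<^sub>F n in sequentially. cmod (z c - u (s n) c) * l2_norm M (G c) < d"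
      using d by (intro order_tendstoD(2)) auto
  qed
  obtain n where n: "\<forall>c\<in>big_gens. \<forall>v\<in>torus. l2_norm M (Av v (r (s n)) (cob (v c) c (G c))) \<le> d"
     "\<forall>c\<in>big_gens. cmod (z c - u (s n) c) * l2_norm M (G c) < d"
    using eventually_happens'[OF sequentially_bot eventually_conj[OF 1 2]] by blast
  define v where "v = u (s n)"
  define N where "N = r (s n)"
  have v: "v \<in> torus" using u(1) by (simp add: v_def)
  have each: "l2_norm M (Av v N (cob (z c) c (G c))) \<le> 2 * d" if c: "c \<in> big_gens" for c
  proof -
    have Gc: "G c \<circ> c \<in> L2 M" by (rule big_gens_L2[OF c G(2)[OF c]])
    \<comment> \<open>Changing the twist from z to v alters the coboundary only by a multiple of
      \<open>G c \<circ> c\<close> of size \<open>cmod (z c - v c)\<close>.\<close>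
    have eq: "cob (z c) c (G c) = cob (v c) c (G c) + cscale (cnj (z c - v c)) (G c \<circ> c)"
      by (simp add: cob_def cscale_def fun_eq_iff algebra_simps)
    have "l2_norm M (Av v N (cob (z c) c (G c))) \<le>
        l2_norm M (Av v N (cob (v c) c (G c))) + l2_norm M (Av v N (cscale (cnj (z c - v c)) (G c \<circ> c)))"
      unfolding eq Av_add by (intro l2_norm_add_le Av_L2 cob_L2 L2_scale c G(2) Gc)
    also have "l2_norm M (Av v N (cscale (cnj (z c - v c)) (G c \<circ> c))) \<le> l2_norm M (cscale (cnj (z c - v c)) (G c \<circ> c))"
      by (intro Av_norm_le v L2_scale Gc)
    also have "\<dots> = cmod (z c - v c) * l2_norm M (G c)"
    proof -
      obtain p where "p \<ge> 1" "S p = c" using c by (rule big_gens_E)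
      then show ?thesis using S_norm[OF _ G(2)[OF c], of p] by (simp only: l2_norm_scale complex_mod_cnj)
    qed
    finally show ?thesis using n c v unfolding v_def N_def by force
  qed
  have eqF: "F = (F - W) + W" by simp
  have "l2_norm M (Av v N F) = l2_norm M (Av v N (F - W) + (\<Sum>c\<in>big_gens. Av v N (cob (z c) c (G c))))"
    by (subst eqF, subst Av_add, subst (2) G(1), subst Av_sum) (rule refl)
  also have "\<dots> \<le> l2_norm M (Av v N (F - W)) + l2_norm M (\<Sum>c\<in>big_gens. Av v N (cob (z c) c (G c)))"
    by (intro l2_norm_add_le Av_L2 L2_diff L2_sum cob_L2 F(1) WL G(2))
  also have "l2_norm M (Av v N (F - W)) \<le> l2_norm M (F - W)" by (intro Av_norm_le v L2_diff F(1) WL)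
  also have "l2_norm M (\<Sum>c\<in>big_gens. Av v N (cob (z c) c (G c))) \<le> (\<Sum>c\<in>big_gens. l2_norm M (Av v N (cob (z c) c (G c))))"
    by (intro l2_norm_sum_le Av_L2 cob_L2 G(2))
  also have "\<dots> \<le> (\<Sum>c\<in>big_gens. 2 * d)" by (intro sum_mono each)
  also have "\<dots> = (m - 1) * (2 * d)" by (simp add: m_def)
  also have "\<dots> \<le> m * (2 * d)" using d by (intro mult_right_mono) auto
  also have "\<dots> = e / 2" using m by (simp add: d_def)
  finally have "l2_norm M (Av v N F) \<le> l2_norm M (F - W) + e / 2" by this simp_all
  then show False using u(2)[of "s n"] W(2) e unfolding v_def N_def by linarith
qed

text \<open>The mean square of the correlations is controlled by one twisted average, at a character
  that varies with N; the uniform bound covers it. Cauchy-Schwarz then passes from mean squares to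
  means of absolute values.\<close>

lemma orthogonal_eigsp_H_pr_wm:
  assumes F: "F \<in> L2 M" "\<And>z K. z \<in> torus \<Longrightarrow> K \<in> eigsp z \<Longrightarrow> l2_inner M F K = 0"
  shows "F \<in> H_pr_wm M S"
proof -
  define b where "b n = cmod (l2_inner M (F \<circ> S n) F)" for n
  define mean where "mean N = (\<Sum>n=1..N. b n) / real N" for N
  have mean0: "mean N \<ge> 0" for N by (auto simp: mean_def b_def intro!: divide_nonneg_nonneg sum_nonneg)
  have "mean \<longlonglongrightarrow> 0"
  proof (rule tendstoI)
    fix e :: real assume e: "e > 0"
    define K where "K = 2 ^ card gens * (l2_norm M F) ^ 3"
    have K: "K \<ge> 0" by (simp add: K_def l2_norm_nonneg)
    define d where "d = e\<^sup>2 / (2 * (K + 1))"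
    have d: "d > 0" using e K by (simp add: d_def)
    have Kd: "K * d < e\<^sup>2"
    proof -
      have "K * d \<le> (K + 1) * d" using d by (intro mult_right_mono) auto
      also have "\<dots> = e\<^sup>2 / 2"
      proof -
        have "q * (e\<^sup>2 / (2 * q)) = e\<^sup>2 / 2" if "q > 0" for q using that by simp
        then show ?thesis using K by (simp only: d_def)
      qed
      also have "\<dots> < e\<^sup>2" using e by simp
      finally show ?thesis .
    qed
    have unif: "\<forall>\<^sub>F N in sequentially. \<forall>z\<in>torus. l2_norm M (Av z N F) \<le> d"
      by (rule Av_uniformly_small[OF F(1) F(2) d])
    show "\<forall>\<^sub>F N in sequentially. dist (mean N) 0 < e"
      using unif eventually_ge_at_top[of 1]
    proof eventually_elim
      case (elim N)
      obtain z where z: "z \<in> torus" "(\<Sum>n=1..N. (b n)\<^sup>2) / real N \<le> K * l2_norm M (Av z N F)"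
        using correlation_sum_le[OF F(1) elim(2)] unfolding b_def K_def by blast
      have "(\<Sum>n=1..N. b n)\<^sup>2 \<le> (\<Sum>n=1..N. (b n)\<^sup>2) * real (card {1..N})" by (rule sum_squared_le_sum_of_squares)
      then have "(mean N)\<^sup>2 \<le> (\<Sum>n=1..N. (b n)\<^sup>2) / real N"
        using elim(2) by (simp add: mean_def power_divide power2_eq_square field_simps)
      also have "\<dots> \<le> K * l2_norm M (Av z N F)" by (rule z(2))
      also have "\<dots> \<le> K * d" using elim(1) z(1) K by (intro mult_left_mono) auto
      finally have "(mean N)\<^sup>2 < e\<^sup>2" using Kd by linarith
      then have "mean N < e" by (rule power2_less_imp_less) (use e in simp)
      then show ?case using mean0[of N] by (simp add: dist_real_def)
    qed
  qed
  then show ?thesis using F(1) by (simp add: H_pr_wm_def mean_def[abs_def] b_def)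
qed

text \<open>By pigeonhole the primes of all small colours together have bounded reciprocal sums, so
  sieving them out leaves at least k times \<open>harm N\<close>. Density zero would permit at most
  k / 2 times \<open>harm N\<close> plus a constant, and harmonic numbers are unbounded.\<close>

lemma good_not_density_zero:
  "\<not> (\<lambda>N. real (card {n\<in>{1..N}. good n}) / real N) \<longlonglongrightarrow> 0"
proof
  assume dens: "(\<lambda>N. real (card {n\<in>{1..N}. good n}) / real N) \<longlonglongrightarrow> 0"
  define P where "P = {p. prime p \<and> S p \<notin> big_gens}"
  have "\<not> diverges (\<lambda>p. 1 / real p) P"
  proof
    assume dv: "diverges (\<lambda>p. 1 / real p) P"
    have "S ` P \<subseteq> gens" by (auto simp: P_def gens_def)
    then have "finite (S ` P)" using finite_gens finite_subset by blast
    from diverges_pigeonhole[OF dv this] obtain c where c: "c \<in> S ` P" "diverges (\<lambda>p. 1 / real p) {p\<in>P. S p = c}" by blast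
    have "{p\<in>P. S p = c} = {p. prime p \<and> S p = c}" using c(1) by (auto simp: P_def)
    then have "c \<in> big_gens" using c by (auto simp: big_gens_def gens_def P_def)
    then show False using c(1) by (auto simp: P_def)
  qed
  then obtain B where B: "\<And>J. J \<subseteq> P \<Longrightarrow> finite J \<Longrightarrow> (\<Sum>p\<in>J. 1 / real p) < B"
    unfolding diverges_def by (auto simp: not_le)
  define k where "k = exp (- 2 * B)"
  have k: "k > 0" by (simp add: k_def)
  have lower: "(\<Sum>n | n \<in> {1..N} \<and> good n. 1 / real n) \<ge> k * harm N" for N
  proof -
    define D where "D = {p\<in>{1..N}. p \<in> P}"
    have D: "finite D" "D \<subseteq> P" "\<And>p. p \<in> D \<Longrightarrow> prime p" by (auto simp: D_def P_def)
    have "k * harm N \<le> exp (- 2 * (\<Sum>p\<in>D. 1 / real p)) * harm N"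
      using B[OF D(2,1)] by (intro mult_right_mono) (auto simp: k_def harm_nonneg)
    also have "\<dots> \<le> (\<Sum>n | n \<in> {1..N} \<and> (\<forall>p\<in>D. \<not> p dvd n). 1 / real n)"
      by (rule sum_reciprocals_coprime_ge[OF D(1,3)])
    also have "\<dots> \<le> (\<Sum>n | n \<in> {1..N} \<and> good n. 1 / real n)"
    proof (rule sum_mono2)
      show "{n. n \<in> {1..N} \<and> (\<forall>p\<in>D. \<not> p dvd n)} \<subseteq> {n. n \<in> {1..N} \<and> good n}"
      proof
        fix n assume n: "n \<in> {n. n \<in> {1..N} \<and> (\<forall>p\<in>D. \<not> p dvd n)}"
        have "S p \<in> big_gens" if p: "p \<in> prime_factors n" for p
        proof (rule ccontr)
          assume "S p \<notin> big_gens"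
          moreover have "prime p" "p dvd n" using p by auto
          moreover from this have "p \<le> N" "p \<ge> 1"
            using n dvd_imp_le[of p n] prime_ge_1_nat by auto
          ultimately have "p \<in> D" by (simp add: D_def P_def)
          then show False using n \<open>p dvd n\<close> by auto
        qed
        then show "n \<in> {n. n \<in> {1..N} \<and> good n}" using n by (auto simp: good_def)
      qed
    qed auto
    finally show ?thesis .
  qed
  obtain C where C: "\<And>N. (\<Sum>n | n \<in> {1..N} \<and> good n. 1 / real n) \<le> C + k / 2 * harm N"
    using sum_reciprocals_density_zero[OF dens, of "k / 2"] k by auto
  have bd: "harm N \<le> 2 * C / k" for N
  proof -
    have "k * harm N \<le> C + k / 2 * harm N" using lower[of N] C[of N] by linarith
    then show ?thesis using k by (simp add: field_simps)
  qed
  have "eventually (\<lambda>N. harm N \<ge> 2 * C / k + 1) sequentially"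
    using harm_at_top unfolding filterlim_at_top by blast
  then obtain N where "harm N \<ge> 2 * C / k + 1" using eventually_happens'[OF sequentially_bot] by blast
  then show False using bd[of N] by linarith
qed

text \<open>All prime factors of a good integer act on R by their eigenvalues up to norm 0, and
  composition with \<open>S k\<close> preserves norms, so the equations multiply.\<close>

lemma eigsp_good:
  assumes z: "z \<in> torus" and R: "R \<in> eigsp z" and n: "n \<ge> 1" "good n"
  shows "l2_norm M ((R \<circ> S n) - cscale (chr z n) R) = 0"
  using n
proof (induction n rule: less_induct)
  case (less n)
  have RL: "R \<in> L2 M" using R by (simp add: eigsp_def)
  show ?case
  proof (cases "n = 1")
    case True
    have "(R \<circ> S 1) - cscale (chr z 1) R = 0" by (simp add: S_1[unfolded One_nat_def] cscale_def fun_eq_iff)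
    then show ?thesis using True by (simp only: l2_norm_def) simp
  next
    case False
    then obtain p where p: "prime p" "p dvd n" using prime_factor_nat by blast
    then obtain k where k: "n = p * k" by auto
    have k1: "k \<ge> 1" using k less.prems by (cases k) auto
    have p1: "p \<ge> 1" using p prime_ge_1_nat by simp
    have g: "S p \<in> big_gens" "good k" using less.prems(2) good_mult_prime[OF p(1) k1] by (auto simp: k)
    have "1 * k < p * k" using k1 prime_gt_1_nat[OF p(1)] by (intro mult_strict_right_mono) auto
    then have "k < n" unfolding k by simp
    then have IH: "l2_norm M ((R \<circ> S k) - cscale (chr z k) R) = 0" using less.IH k1 g(2) by blast
    have L: "R \<circ> S p \<in> L2 M" "R \<circ> S k \<in> L2 M" "R \<circ> S n \<in> L2 M"
      using p1 k1 less.prems(1) RL by (auto intro: S_L2)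
    have "l2_norm M ((R \<circ> S n) - cscale (chr z n) R) \<le>
       l2_norm M ((R \<circ> S n) - cscale (z (S p)) (R \<circ> S k)) + l2_norm M (cscale (z (S p)) (R \<circ> S k) - cscale (chr z n) R)"
      by (intro l2_norm_diff_triangle L L2_scale RL)
    also have "(R \<circ> S n) - cscale (z (S p)) (R \<circ> S k) = ((R \<circ> S p) - cscale (z (S p)) R) \<circ> S k"
      using p1 k1 by (simp add: k S_mult fun_eq_iff cscale_def)
    also have "l2_norm M (((R \<circ> S p) - cscale (z (S p)) R) \<circ> S k) = l2_norm M ((R \<circ> S p) - cscale (z (S p)) R)"
      by (intro S_norm k1 L2_diff L2_scale L RL)
    also have "\<dots> = 0" using R g(1) by (simp add: eigsp_def)
    also have "cscale (z (S p)) (R \<circ> S k) - cscale (chr z n) R = cscale (z (S p)) ((R \<circ> S k) - cscale (chr z k) R)"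
      using p(1) p1 k1 by (simp add: k chr_mult chr_prime cscale_def fun_eq_iff algebra_simps)
    finally have "l2_norm M ((R \<circ> S n) - cscale (chr z n) R) \<le> 0" by (simp only: l2_norm_scale IH)
    then show ?thesis using l2_norm_nonneg[of "(R \<circ> S n) - cscale (chr z n) R"] by linarith
  qed
qed

text \<open>F is split as R + G with R in \<open>eigsp z\<close> and G in the closure of
  \<open>Cob z\<close>. The averages T tend to 0 on F by weak mixing and on G by the coboundary
  estimate, while on R they equal the squared norm of R times the proportion of good integers. So R
  has norm 0, and V is orthogonal to R and to G.\<close>

lemma H_pr_wm_orthogonal_eigsp:
  assumes F: "F \<in> H_pr_wm M S" and z: "z \<in> torus" and V: "V \<in> eigsp z"
  shows "l2_inner M F V = 0"
proof -
  have FL: "F \<in> L2 M" using F by (simp add: H_pr_wm_def)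
  have VL: "V \<in> L2 M" using V by (simp add: eigsp_def)
  obtain G where G: "G \<in> l2_closure M (Cob z)" "\<And>K. K \<in> Cob z \<Longrightarrow> l2_inner M (F - G) K = 0"
    using l2_projection[OF subspace_Cob Cob_L2 FL] by blast
  have GL: "G \<in> L2 M" using G by (auto simp: l2_closure_def)
  define R where "R = F - G"
  have RL: "R \<in> L2 M" unfolding R_def by (intro L2_diff FL GL)
  have RE: "R \<in> eigsp z" using G(2) RL by (intro orthogonal_Cob_eigsp z) (auto simp: R_def)
  have FRG: "F = R + G" by (simp add: R_def)
  have RG: "l2_inner M R G = 0" using G by (intro l2_inner_closure_eq_0[OF RL Cob_L2 _ G(1)]) (auto simp: R_def)
  have VG: "l2_inner M V G = 0" using eigsp_orthogonal_Cob[OF z V] by (intro l2_inner_closure_eq_0[OF VL Cob_L2 _ G(1)])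
  have RF: "l2_inner M R F = of_real ((l2_norm M R)\<^sup>2)"
  proof -
    have "l2_inner M R F = l2_inner M R R + l2_inner M R G"
      by (subst FRG) (rule l2_inner_add_right[OF RL GL RL])
    then show ?thesis by (simp only: RG l2_inner_self add_0_right)
  qed
  \<comment> \<open>Multiplication by a prime of a big colour does not change this indicator, so the
    coboundary estimate survives the restriction; and on good n the function R picks up exactly the
    factor \<open>chr z n\<close>.\<close>
  define a where "a n = (if good n then 1 else 0 :: complex)" for n
  have a: "a n \<in> {0, 1}" for n by (simp add: a_def)
  have a1: "a (p * m) = a (p' * m)" if "prime p" "prime p'" "S p = S p'" "m \<ge> 1" for p p' m
    using that by (simp add: a_def good_mult_prime)
  have a2: "a (p * m) = a m" if "prime p" "S p = c" "m \<ge> 1" "c \<in> big_gens" for p m c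
    using that by (simp add: a_def good_mult_prime)
  define T where "T N K = (\<Sum>n=1..N. a n * (cnj (chr z n) * l2_inner M (K \<circ> S n) F)) / of_nat N" for N K
  have T_bound: "cmod (T N K) \<le> l2_norm M K * l2_norm M F" if K: "K \<in> L2 M" for N K
  proof -
    have "cmod (\<Sum>n=1..N. a n * (cnj (chr z n) * l2_inner M (K \<circ> S n) F)) \<le> (\<Sum>n=1..N. l2_norm M K * l2_norm M F)"
    proof (rule sum_norm_le)
      fix n assume n: "n \<in> {1..N}"
      have "cmod (l2_inner M (K \<circ> S n) F) \<le> l2_norm M K * l2_norm M F"
        using l2_Cauchy_Schwarz[OF S_L2[OF _ K] FL, of n] S_norm[OF _ K, of n] n by simp
      then have "cmod (a n) * (1 * cmod (l2_inner M (K \<circ> S n) F)) \<le> 1 * (1 * (l2_norm M K * l2_norm M F))"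
        by (intro mult_mono) (auto simp: a_def)
      then show "cmod (a n * (cnj (chr z n) * l2_inner M (K \<circ> S n) F)) \<le> l2_norm M K * l2_norm M F"
        by (simp add: norm_mult chr_norm[OF z])
    qed
    also have "\<dots> = real N * (l2_norm M K * l2_norm M F)" by simp
    finally have le: "cmod (\<Sum>n=1..N. a n * (cnj (chr z n) * l2_inner M (K \<circ> S n) F)) \<le> real N * (l2_norm M K * l2_norm M F)" .
    have "0 \<le> l2_norm M K * l2_norm M F" by (intro mult_nonneg_nonneg l2_norm_nonneg)
    then show ?thesis using le by (cases "N = 0") (auto simp: T_def norm_divide pos_divide_le_eq mult.commute)
  qed
  have T_add: "T N (K + K') = T N K + T N K'" if K: "K \<in> L2 M" "K' \<in> L2 M" for N K K'
  proof -
    have "l2_inner M ((K + K') \<circ> S n) F = l2_inner M (K \<circ> S n) F + l2_inner M (K' \<circ> S n) F" if n: "n \<ge> 1" for n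
    proof -
      have "(K + K') \<circ> S n = (K \<circ> S n) + (K' \<circ> S n)" by (simp add: fun_eq_iff)
      then show ?thesis by (simp only: l2_inner_add_left[OF S_L2[OF n K(1)] S_L2[OF n K(2)] FL])
    qed
    then have "(\<Sum>n=1..N. a n * (cnj (chr z n) * l2_inner M ((K + K') \<circ> S n) F)) =
       (\<Sum>n=1..N. a n * (cnj (chr z n) * l2_inner M (K \<circ> S n) F) + a n * (cnj (chr z n) * l2_inner M (K' \<circ> S n) F))"
      by (intro sum.cong refl) (simp add: distrib_left)
    then show ?thesis by (simp only: T_def sum.distrib add_divide_distrib)
  qed
  have T_sum: "T N (\<Sum>c\<in>C. H c) = (\<Sum>c\<in>C. T N (H c))" if "finite C" "\<And>c. c \<in> C \<Longrightarrow> H c \<in> L2 M" for N C H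
    using that
  proof (induction C rule: finite_induct)
    case empty
    have "cmod (T N 0) \<le> 0" using T_bound[OF L2_0, of N] by (simp add: l2_norm_def)
    then have "T N 0 = 0" by simp
    then show ?case by (simp only: sum.empty)
  next
    case (insert c C)
    have 1: "T N (H c + (\<Sum>c\<in>C. H c)) = T N (H c) + T N (\<Sum>c\<in>C. H c)"
      using insert.prems by (intro T_add L2_sum) auto
    have 2: "T N (\<Sum>c\<in>C. H c) = (\<Sum>c\<in>C. T N (H c))" by (rule insert.IH) (rule insert.prems[OF insertI2])
    show ?case unfolding sum.insert[OF insert.hyps] 1 2 by (rule refl)
  qed
  have T_G: "(\<lambda>N. T N G) \<longlonglongrightarrow> 0"
  proof (rule tendstoI)
    fix e :: real assume e: "e > 0"
    define f where "f = l2_norm M F + 1"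
    have f: "f > 0" "l2_norm M F \<le> f" using l2_norm_nonneg[of F] by (auto simp: f_def)
    have "e / (2 * f) > 0" using e f by simp
    then obtain W where W: "W \<in> Cob z" "l2_norm M (G - W) < e / (2 * f)" using G(1) unfolding l2_closure_def by blast
    obtain H where H: "W = (\<Sum>c\<in>big_gens. cob (z c) c (H c))" "\<And>c. c \<in> big_gens \<Longrightarrow> H c \<in> L2 M"
      using W(1) unfolding Cob_def by blast
    have WL: "W \<in> L2 M" using W(1) Cob_L2 by blast
    define m where "m = real (card big_gens) + 1"
    have m: "m > 0" by (simp add: m_def)
    define d where "d = e / (2 * m * f)"
    have d: "d > 0" using e m f by (simp add: d_def)
    have "\<forall>\<^sub>F N in sequentially. \<forall>c\<in>big_gens. cmod (T N (cob (z c) c (H c))) \<le> d * l2_norm M F"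
    proof (rule eventually_ball_finite[OF finite_gens(2)], rule ballI)
      fix c assume c: "c \<in> big_gens"
      have "\<forall>\<^sub>F N in sequentially. \<forall>z\<in>torus. \<forall>K\<in>L2 M.
         cmod ((\<Sum>n=1..N. a n * (cnj (chr z n) * l2_inner M (cob (z c) c (H c) \<circ> S n) K)) / of_nat N) \<le> d * l2_norm M K"
        by (rule cob_average_small[OF c H(2)[OF c] d])
          (rule a | rule a1, assumption+ | rule a2, assumption+, rule c)+
      then show "\<forall>\<^sub>F N in sequentially. cmod (T N (cob (z c) c (H c))) \<le> d * l2_norm M F"
        by (rule eventually_mono) (use z FL in \<open>auto simp: T_def\<close>)
    qed
    then show "\<forall>\<^sub>F N in sequentially. dist (T N G) 0 < e"
    proof (rule eventually_mono)
      fix N assume N: "\<forall>c\<in>big_gens. cmod (T N (cob (z c) c (H c))) \<le> d * l2_norm M F"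
      have "T N G = T N ((G - W) + W)" by simp
      also have "\<dots> = T N (G - W) + T N W" by (intro T_add L2_diff GL WL)
      also have "T N W = (\<Sum>c\<in>big_gens. T N (cob (z c) c (H c)))"
        unfolding H(1) using finite_gens by (intro T_sum cob_L2 H(2)) auto
      finally have "T N G = T N (G - W) + (\<Sum>c\<in>big_gens. T N (cob (z c) c (H c)))" .
      then have "cmod (T N G) \<le> cmod (T N (G - W)) + cmod (\<Sum>c\<in>big_gens. T N (cob (z c) c (H c)))"
        by (simp only: norm_triangle_ineq)
      also have "cmod (T N (G - W)) \<le> l2_norm M (G - W) * l2_norm M F" by (intro T_bound L2_diff GL WL)
      also have "\<dots> \<le> l2_norm M (G - W) * f" using f by (intro mult_left_mono l2_norm_nonneg)
      also have "cmod (\<Sum>c\<in>big_gens. T N (cob (z c) c (H c))) \<le> (\<Sum>c\<in>big_gens. d * f)"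
      proof (rule sum_norm_le)
        fix c assume "c \<in> big_gens"
        then have "cmod (T N (cob (z c) c (H c))) \<le> d * l2_norm M F" using N by blast
        also have "\<dots> \<le> d * f" using f d by (intro mult_left_mono) auto
        finally show "cmod (T N (cob (z c) c (H c))) \<le> d * f" .
      qed
      also have "\<dots> = (m - 1) * (d * f)" by (simp add: m_def)
      also have "\<dots> \<le> m * (d * f)" using d f by (intro mult_right_mono) auto
      also have "\<dots> = e / 2" using m f by (simp add: d_def)
      finally have "cmod (T N G) \<le> l2_norm M (G - W) * f + e / 2" by this simp_all
      moreover have "l2_norm M (G - W) * f < e / 2"
        using W(2) f(1) by (simp add: pos_less_divide_eq)
      ultimately show "dist (T N G) 0 < e" by simp
    qed
  qed
  have T_F: "(\<lambda>N. T N F) \<longlonglongrightarrow> 0"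
  proof (rule Lim_null_comparison)
    show "(\<lambda>N. (\<Sum>n=1..N. cmod (l2_inner M (F \<circ> S n) F)) / real N) \<longlonglongrightarrow> 0" using F by (simp add: H_pr_wm_def)
    have "cmod (T N F) \<le> (\<Sum>n=1..N. cmod (l2_inner M (F \<circ> S n) F)) / real N" for N
    proof -
      have "cmod (\<Sum>n=1..N. a n * (cnj (chr z n) * l2_inner M (F \<circ> S n) F)) \<le> (\<Sum>n=1..N. cmod (l2_inner M (F \<circ> S n) F))"
        by (intro sum_norm_le) (auto simp: norm_mult chr_norm[OF z] a_def)
      then show ?thesis by (simp add: T_def norm_divide divide_right_mono)
    qed
    then show "\<forall>\<^sub>F N in sequentially. cmod (T N F) \<le> (\<Sum>n=1..N. cmod (l2_inner M (F \<circ> S n) F)) / real N" by simp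
  qed
  have T_R: "T N R = of_real ((l2_norm M R)\<^sup>2 * (real (card {n\<in>{1..N}. good n}) / real N))" for N
  proof -
    have "a n * (cnj (chr z n) * l2_inner M (R \<circ> S n) F) = (if good n then of_real ((l2_norm M R)\<^sup>2) else 0)" if n: "n \<in> {1..N}" for n
    proof (cases "good n")
      case True
      have n1: "n \<ge> 1" using n by simp
      have "l2_inner M (R \<circ> S n) F = l2_inner M (cscale (chr z n) R) F"
        by (intro l2_inner_eq_if_norm_diff_0 S_L2 n1 RL FL L2_scale eigsp_good[OF z RE n1 True])
      then have "cnj (chr z n) * l2_inner M (R \<circ> S n) F = (chr z n * cnj (chr z n)) * l2_inner M R F"
        by (simp add: l2_inner_scale_left)
      then show ?thesis using True by (simp add: a_def chr_cnj[OF z] RF)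
    qed (simp add: a_def)
    then have "T N R = (\<Sum>n=1..N. if good n then of_real ((l2_norm M R)\<^sup>2) else 0) / of_nat N"
      unfolding T_def by (intro arg_cong2[of _ _ _ _ "(/)"] sum.cong refl) auto
    also have "(\<Sum>n=1..N. if good n then of_real ((l2_norm M R)\<^sup>2) else 0) =
        (\<Sum>n\<in>{n\<in>{1..N}. good n}. complex_of_real ((l2_norm M R)\<^sup>2))"
      by (subst sum.inter_filter) auto
    finally show ?thesis by simp
  qed
  have "T N F = T N R + T N G" for N by (subst FRG) (rule T_add[OF RL GL])
  then have "T N R = T N F - T N G" for N by (metis add_diff_cancel_right')
  then have "(\<lambda>N. T N R) \<longlonglongrightarrow> 0" using tendsto_diff[OF T_F T_G] by simp
  then have "(\<lambda>N. complex_of_real ((l2_norm M R)\<^sup>2 * (real (card {n\<in>{1..N}. good n}) / real N))) \<longlonglongrightarrow> complex_of_real 0"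
    unfolding T_R of_real_0 .
  then have lim: "(\<lambda>N. (l2_norm M R)\<^sup>2 * (real (card {n\<in>{1..N}. good n}) / real N)) \<longlonglongrightarrow> 0"
    by (rule tendsto_of_real_iff[THEN iffD1])
  have "l2_norm M R = 0"
  proof (rule ccontr)
    assume n0: "l2_norm M R \<noteq> 0"
    have "(\<lambda>N. (1 / (l2_norm M R)\<^sup>2) * ((l2_norm M R)\<^sup>2 * (real (card {n\<in>{1..N}. good n}) / real N))) \<longlonglongrightarrow> (1 / (l2_norm M R)\<^sup>2) * 0"
      by (intro tendsto_mult_left lim)
    then show False using good_not_density_zero n0 by simp
  qed
  then have "cmod (l2_inner M R V) \<le> 0" using l2_Cauchy_Schwarz[OF RL VL] by simp
  moreover have "l2_inner M F V = l2_inner M R V + l2_inner M G V"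
    by (subst FRG) (rule l2_inner_add_left[OF RL GL VL])
  moreover have "l2_inner M G V = 0" using VG by (simp add: l2_inner_commute[of G V])
  ultimately show ?thesis by simp
qed

section \<open>The orthogonal complement of the eigenfunctions and the conclusion\<close>

definition eig_span :: "('a \<Rightarrow> complex) set" where
  "eig_span = cfun.span (\<Union>f\<in>Mc_fg. H_char M S f)"

lemma eig_span_L2: "eig_span \<subseteq> L2 M"
  unfolding eig_span_def by (rule cfun.span_minimal) (auto simp: H_char_def subspace_L2)

text \<open>The condition defining \<open>H_pr_wm\<close> is quadratic in F. Its identification with
  an orthogonal complement also shows that it is a linear subspace.\<close>

lemma H_pr_wm_eq: "H_pr_wm M S = {F \<in> L2 M. \<forall>K\<in>eig_span. l2_inner M F K = 0}"
proof (intro equalityI subsetI)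
  fix F assume F: "F \<in> H_pr_wm M S"
  then have FL: "F \<in> L2 M" by (simp add: H_pr_wm_def)
  have sub: "cfun.subspace {K \<in> L2 M. l2_inner M F K = 0}"
    using FL L2_0 L2_add L2_scale
    by (intro cfun.subspaceI) (auto simp: l2_inner_add_right l2_inner_scale_right)
  have "eig_span \<subseteq> {K \<in> L2 M. l2_inner M F K = 0}"
    unfolding eig_span_def
  proof (rule cfun.span_minimal[OF _ sub], safe)
    fix f K assume K: "f \<in> Mc_fg" "K \<in> H_char M S f"
    then show "K \<in> L2 M" by (simp add: H_char_def)
    obtain z where "z \<in> torus" "K \<in> eigsp z" using H_char_subset_eigsp[OF K] by blast
    then show "l2_inner M F K = 0" by (rule H_pr_wm_orthogonal_eigsp[OF F])
  qed
  then show "F \<in> {F \<in> L2 M. \<forall>K\<in>eig_span. l2_inner M F K = 0}" using FL by blast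
next
  fix F assume F: "F \<in> {F \<in> L2 M. \<forall>K\<in>eig_span. l2_inner M F K = 0}"
  show "F \<in> H_pr_wm M S"
  proof (rule orthogonal_eigsp_H_pr_wm)
    fix z K assume z: "z \<in> torus" "K \<in> eigsp z"
    then have "K \<in> (\<Union>f\<in>Mc_fg. H_char M S f)" using eigsp_subset_H_char chr_Mc_fg by blast
    then have "K \<in> eig_span" unfolding eig_span_def by (rule cfun.span_base)
    then show "l2_inner M F K = 0" using F by blast
  qed (use F in blast)
qed

lemma orthogonal_direct_sum_pr_eig_pr_wm:
  "l2_orthogonal_direct_sum M (H_pr_eig M S) (H_pr_wm M S)"
proof -
  have sp: "cfun.subspace eig_span" unfolding eig_span_def by (rule cfun.subspace_span)
  have V: "H_pr_eig M S = l2_closure M eig_span" by (simp add: H_pr_eig_def eig_span_def)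
  have "cfun.subspace (H_pr_wm M S)"
    unfolding H_pr_wm_eq using L2_0 L2_add L2_scale eig_span_L2
    by (intro cfun.subspaceI) (auto simp: l2_inner_add_left l2_inner_scale_left subset_iff)
  moreover have "l2_inner M G H = 0" if G: "G \<in> H_pr_eig M S" and H: "H \<in> H_pr_wm M S" for G H
  proof -
    have HL: "H \<in> L2 M" "\<And>K. K \<in> eig_span \<Longrightarrow> l2_inner M H K = 0"
      using H unfolding H_pr_wm_eq by blast+
    have "l2_inner M H G = 0"
      by (rule l2_inner_closure_eq_0[OF HL(1) eig_span_L2 HL(2) G[unfolded V]])
    then show ?thesis by (simp add: l2_inner_commute[of G H])
  qed
  moreover have "{G + H | G H. G \<in> H_pr_eig M S \<and> H \<in> H_pr_wm M S} = L2 M"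
  proof (intro equalityI subsetI)
    fix F assume "F \<in> {G + H | G H. G \<in> H_pr_eig M S \<and> H \<in> H_pr_wm M S}"
    then show "F \<in> L2 M" using l2_closure_L2[of eig_span] L2_add by (auto simp: V H_pr_wm_eq)
  next
    fix F assume F: "F \<in> L2 M"
    obtain G where G: "G \<in> l2_closure M eig_span" "\<forall>K\<in>eig_span. l2_inner M (F - G) K = 0"
      using l2_projection[OF sp eig_span_L2 F] by blast
    have "F - G \<in> L2 M" using F G(1) l2_closure_L2 by (intro L2_diff) auto
    then have "F - G \<in> H_pr_wm M S" using G(2) by (simp add: H_pr_wm_eq)
    moreover have "F = G + (F - G)" by simp
    ultimately show "F \<in> {G + H | G H. G \<in> H_pr_eig M S \<and> H \<in> H_pr_wm M S}"
      using G(1) unfolding V by blast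
  qed
  ultimately show ?thesis
    using l2_closure_subspace[OF sp eig_span_L2] by (auto simp: l2_orthogonal_direct_sum_def V)
qed

end

theorem theorem1p29:
  fixes M :: "'a::metric_space measure" and S :: "nat \<Rightarrow> 'a \<Rightarrow> 'a"
  assumes "fg_multiplicative_system M S"
  shows "l2_orthogonal_direct_sum M (H_pr_eig M S) (H_pr_wm M S)"
proof -
  interpret fg_multiplicative_system M S by (rule assms)
  show ?thesis by (rule orthogonal_direct_sum_pr_eig_pr_wm)
qed

end
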